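(* Let $N\in\mathbb{N}$. Let $P^N_{t_1,t_2}$ be the transition semigroup of the truncated stochastic KdV equation on $\mathbb{T}=\mathbb{R}/(2\pi\mathbb{Z})$ $$\partial_tu^N+\partial_x^3u^N+\mathbf{P}_N\big(\mathbf{P}_Nu^N\cdot\partial_x\mathbf{P}_Nu^N\big)=\xi,$$ where $\xi$ is a space-time white noise and $\mathbf{P}_N$ is the projection onto spatial frequencies $\{|n|\le N\}$. Then, for any $t_2\ge t_1\ge0$, $$(P^N_{t_1,t_2})^*\mu_{1+t_1}=\mu_{1+t_2},$$ where $\mu_\alpha$ denotes the white noise measure on $\mathbb{T}$ with variance $\alpha$. Namely, $\{\mu_{1+t}\}_{t\in\mathbb{R}_+}$ is an evolution system of measures for the truncated equation.
   Context: $\mathbb{T}$ carries the normalized Lebesgue measure $(2\pi)^{-1}dx$; $\mathbb{R}_+=[0,\infty)$. All functions/distributions on $\mathbb{T}$ are real-valued. White noise measure: $\mu_\alpha=\mathrm{Law}(\sqrt\alpha\,u_0^\omega)$, $u_0^\omega=\sum_{n\in\mathbb{Z}}g_ne^{inx}$, where $\{g_n\}_{n\in\mathbb{Z}}$ are standard complex Gaussians ($\mathbb{E}|g_n|^2=1$, with independent real and imaginary parts of variance $\frac12$ for $n\ne0$), independent for $n\ge0$, with $g_{-n}=\overline{g_n}$ ($g_0$ a real standard Gaussian). Noise: $\xi=\partial_tW$, $W(t)=\sum_{n\in\mathbb{Z}}\beta_n(t)e^{inx}$, where $\{\beta_n\}_{n\ge0}$ are mutually independent Brownian motions, $\beta_{-n}=\overline{\beta_n}$,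 $\beta_0$ is a standard real Brownian motion, $\beta_n$ ($n\ne0$) is complex-valued with independent real and imaginary parts each of variance $t/2$. The truncation acts only on the nonlinearity; the equation decouples into a finite-dimensional system of SDEs for $\mathbf{P}_Nu^N$, namely $\partial_tu_N+\partial_x^3u_N+\mathbf{P}_N(u_N\partial_xu_N)=\mathbf{P}_N\xi$, and the linear equation $\partial_tu_N^\perp+\partial_x^3u_N^\perp=(\mathrm{Id}-\mathbf{P}_N)\xi$ for the high frequencies; both are globally well-posed. $\Phi^N_{t_1,t_2}$ denotes the (random) solution map sending data $\varphi$ at time $t_1$ to the solution at time $t_2$, and $P^N_{t_1,t_2}F(\varphi)=\mathbb{E}[F(\Phi^N_{t_1,t_2}\varphi)]$ for bounded measurable $F$, the expectation being over the noise on $[t_1,t_2]$. Thus $(P^N_{t_1,t_2})^*\mu$ is the law of $\Phi^N_{t_1,t_2}\varphi$ when $\varphi\sim\mu$ is independent of the noise on $[t_1,t_2]$. A family $\{\rho_t\}_{t\in\mathbb{R}_+}$ of probability measures is an evolution system of measures if $\int F\,d\rho_{t_2}=\int P^N_{t_1,t_2}F\,d\rho_{t_1}$ for all bounded continuous $F$ and $t_2\ge t_1\ge0$, equivalently $\rho_{t_2}=(P^N_{t_1,t_2})^*\rho_{t_1}$. *)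

theory Defs
  imports "HOL-Probability.Probability"
begin

text \<open>
  A distribution u on the torus (with normalized Lebesgue measure) is represented by its Fourier
  coefficients: a :: int \<Rightarrow> complex stands for the sum of a n * exp (i n x) over all integers n.
  Distributions are real-valued, i.e. a (- n) = cnj (a n).
\<close>

type_synonym coeffs = "int \<Rightarrow> complex"

definition real_valued :: "coeffs \<Rightarrow> bool" where
  "real_valued a \<longleftrightarrow> (\<forall>n. a (- n) = cnj (a n))"

definition dx :: "coeffs \<Rightarrow> coeffs" where
  "dx a = (\<lambda>n. \<i> * of_int n * a n)"

definition proj :: "nat \<Rightarrow> coeffs \<Rightarrow> coeffs" where
  "proj N a = (\<lambda>n. if \<bar>n\<bar> \<le> int N then a n else 0)"

text \<open>Pointwise product of functions. It is only applied to trigonometric polynomials, where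
  the sum has finitely many non-zero terms.\<close>

definition mult :: "coeffs \<Rightarrow> coeffs \<Rightarrow> coeffs" where
  "mult a b = (\<lambda>n. \<Sum>\<^sub>\<infinity>k\<in>UNIV. a k * b (n - k))"

text \<open>The phase space is the real Sobolev space of order s; white noise lives on it exactly when
  s < -1/2.\<close>

definition sobolev :: "real \<Rightarrow> coeffs set" where
  "sobolev s = {a. real_valued a \<and>
     (\<lambda>n. (1 + (real_of_int n)\<^sup>2) powr s * (cmod (a n))\<^sup>2) summable_on UNIV}"

definition sobolev_dist :: "real \<Rightarrow> coeffs \<Rightarrow> coeffs \<Rightarrow> real" where
  "sobolev_dist s a b =
     sqrt (\<Sum>\<^sub>\<infinity>n\<in>UNIV. (1 + (real_of_int n)\<^sup>2) powr s * (cmod (a n - b n))\<^sup>2)"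

definition sobolev_topology :: "real \<Rightarrow> coeffs topology" where
  "sobolev_topology s = Metric_space.mtopology (sobolev s) (sobolev_dist s)"

definition sobolev_borel :: "real \<Rightarrow> coeffs measure" where
  "sobolev_borel s = sigma (sobolev s) {U. openin (sobolev_topology s) U}"

text \<open>Random Fourier series belong to the Sobolev space only almost surely; on the exceptional
  null set they are replaced by 0.\<close>

definition to_sobolev :: "real \<Rightarrow> coeffs \<Rightarrow> coeffs" where
  "to_sobolev s a = (if a \<in> sobolev s then a else (\<lambda>n. 0))"


section \<open>White noise\<close>

definition real_gaussian :: "'a measure \<Rightarrow> real \<Rightarrow> ('a \<Rightarrow> real) \<Rightarrow> bool" where
  "real_gaussian M v X \<longleftrightarrow> distributed M lborel X (\<lambda>x. ennreal (normal_density 0 (sqrt v) x))"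

definition gaussian_coeffs :: "'a measure \<Rightarrow> (int \<Rightarrow> 'a \<Rightarrow> complex) \<Rightarrow> bool" where
  "gaussian_coeffs M g \<longleftrightarrow>
     prob_space M \<and>
     real_gaussian M 1 (\<lambda>\<omega>. Re (g 0 \<omega>)) \<and> (\<forall>\<omega>\<in>space M. Im (g 0 \<omega>) = 0) \<and>
     (\<forall>n. n \<noteq> 0 \<longrightarrow>
        real_gaussian M (1/2) (\<lambda>\<omega>. Re (g n \<omega>)) \<and>
        real_gaussian M (1/2) (\<lambda>\<omega>. Im (g n \<omega>)) \<and>
        prob_space.indep_var M borel (\<lambda>\<omega>. Re (g n \<omega>)) borel (\<lambda>\<omega>. Im (g n \<omega>))) \<and>
     prob_space.indep_vars M (\<lambda>_. borel) g {0..} \<and>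
     (\<forall>n. \<forall>\<omega>\<in>space M. g (- n) \<omega> = cnj (g n \<omega>))"

definition white_noise ::
  "real \<Rightarrow> 'a measure \<Rightarrow> (int \<Rightarrow> 'a \<Rightarrow> complex) \<Rightarrow> real \<Rightarrow> coeffs measure" where
  "white_noise s M g \<alpha> =
     distr M (sobolev_borel s) (\<lambda>\<omega>. to_sobolev s (\<lambda>n. complex_of_real (sqrt \<alpha>) * g n \<omega>))"


section \<open>Space-time white noise\<close>

definition real_brownian :: "'b measure \<Rightarrow> real \<Rightarrow> (real \<Rightarrow> 'b \<Rightarrow> real) \<Rightarrow> bool" where
  "real_brownian P v B \<longleftrightarrow>
     (\<forall>\<omega>\<in>space P. B 0 \<omega> = 0 \<and> continuous_on {0..} (\<lambda>t. B t \<omega>)) \<and>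
     (\<forall>a b. 0 \<le> a \<longrightarrow> a < b \<longrightarrow> real_gaussian P (v * (b - a)) (\<lambda>\<omega>. B b \<omega> - B a \<omega>)) \<and>
     (\<forall>(t :: nat \<Rightarrow> real) k. 0 \<le> t 0 \<longrightarrow> mono t \<longrightarrow>
        prob_space.indep_vars P (\<lambda>_. borel) (\<lambda>i \<omega>. B (t (Suc i)) \<omega> - B (t i) \<omega>) {..<k})"

text \<open>Independence of processes is independence of the random paths, with the product
  sigma-algebra (generated by the time marginals) on path space.\<close>

definition brownian_coeffs :: "'b measure \<Rightarrow> (int \<Rightarrow> real \<Rightarrow> 'b \<Rightarrow> complex) \<Rightarrow> bool" where
  "brownian_coeffs P \<beta> \<longleftrightarrow>
     prob_space P \<and>
     real_brownian P 1 (\<lambda>t \<omega>. Re (\<beta> 0 t \<omega>)) \<and>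
     (\<forall>t\<ge>0. \<forall>\<omega>\<in>space P. Im (\<beta> 0 t \<omega>) = 0) \<and>
     (\<forall>n. n \<noteq> 0 \<longrightarrow>
        real_brownian P (1/2) (\<lambda>t \<omega>. Re (\<beta> n t \<omega>)) \<and>
        real_brownian P (1/2) (\<lambda>t \<omega>. Im (\<beta> n t \<omega>)) \<and>
        prob_space.indep_var P
          (\<Pi>\<^sub>M t\<in>{0..}. borel) (\<lambda>\<omega>. \<lambda>t\<in>{0..}. Re (\<beta> n t \<omega>))
          (\<Pi>\<^sub>M t\<in>{0..}. borel) (\<lambda>\<omega>. \<lambda>t\<in>{0..}. Im (\<beta> n t \<omega>))) \<and>
     prob_space.indep_vars P (\<lambda>_. \<Pi>\<^sub>M t\<in>{0..}. borel) (\<lambda>n \<omega>. \<lambda>t\<in>{0..}. \<beta> n t \<omega>) {0..} \<and>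
     (\<forall>n. \<forall>t\<ge>0. \<forall>\<omega>\<in>space P. \<beta> (- n) t \<omega> = cnj (\<beta> n t \<omega>))"


section \<open>The truncated stochastic KdV equation\<close>

definition kdv_drift :: "nat \<Rightarrow> coeffs \<Rightarrow> coeffs" where
  "kdv_drift N u = (\<lambda>n. - dx (dx (dx u)) n - proj N (mult (proj N u) (dx (proj N u))) n)"

text \<open>The noise is additive, so the equation makes sense for each noise path w separately. It is
  written in time-integrated form, with the noise entering through its increments, and tested
  against each exponential. Since the coefficients with \<bar>n\<bar> \<le> N solve a closed finite system and
  the others a linear equation, the solution is unique already among coefficientwise continuous
  functions of time.\<close>

definition solves_kdv ::
  "nat \<Rightarrow> (int \<Rightarrow> real \<Rightarrow> complex) \<Rightarrow> real \<Rightarrow> real \<Rightarrow> coeffs \<Rightarrow> (real \<Rightarrow> coeffs) \<Rightarrow> bool" where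
  "solves_kdv N w t1 t2 \<phi> u \<longleftrightarrow>
     (\<forall>t\<in>{t1..t2}. real_valued (u t)) \<and>
     (\<forall>n. continuous_on {t1..t2} (\<lambda>t. u t n)) \<and>
     (\<forall>n. \<forall>t\<in>{t1..t2}.
        u t n = \<phi> n + integral {t1..t} (\<lambda>r. kdv_drift N (u r) n) + (w n t - w n t1))"

definition kdv_flow ::
  "nat \<Rightarrow> (int \<Rightarrow> real \<Rightarrow> complex) \<Rightarrow> real \<Rightarrow> real \<Rightarrow> coeffs \<Rightarrow> coeffs" where
  "kdv_flow N w t1 t2 \<phi> = (THE v. \<exists>u. solves_kdv N w t1 t2 \<phi> u \<and> v = u t2)"

definition kdv_transition ::
  "real \<Rightarrow> 'b measure \<Rightarrow> (int \<Rightarrow> real \<Rightarrow> 'b \<Rightarrow> complex) \<Rightarrow> nat \<Rightarrow> real \<Rightarrow> real \<Rightarrow>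
     (coeffs \<Rightarrow> real) \<Rightarrow> coeffs \<Rightarrow> real" where
  "kdv_transition s P \<beta> N t1 t2 F \<phi> =
     (\<integral>\<omega>. F (to_sobolev s (kdv_flow N (\<lambda>n t. \<beta> n t \<omega>) t1 t2 \<phi>)) \<partial>P)"


section \<open>Evolution systems of measures\<close>

text \<open>For a Markov operator T on bounded measurable functions, the adjoint acts on measures by
  assigning to A the integral of T applied to the indicator of A.\<close>

definition dual_action ::
  "real \<Rightarrow> ((coeffs \<Rightarrow> real) \<Rightarrow> coeffs \<Rightarrow> real) \<Rightarrow> coeffs measure \<Rightarrow> coeffs measure" where
  "dual_action s T \<rho> =
     measure_of (sobolev s) (sets (sobolev_borel s))
       (\<lambda>A. \<integral>\<^sup>+\<phi>. ennreal (T (indicator A) \<phi>) \<partial>\<rho>)"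

definition evolution_system ::
  "real \<Rightarrow> (real \<Rightarrow> real \<Rightarrow> (coeffs \<Rightarrow> real) \<Rightarrow> coeffs \<Rightarrow> real) \<Rightarrow>
     (real \<Rightarrow> coeffs measure) \<Rightarrow> bool" where
  "evolution_system s T \<rho> \<longleftrightarrow>
     (\<forall>t\<ge>0. prob_space (\<rho> t) \<and> sets (\<rho> t) = sets (sobolev_borel s)) \<and>
     (\<forall>F t1 t2. continuous_map (sobolev_topology s) euclideanreal F \<longrightarrow>
        bounded (F ` sobolev s) \<longrightarrow> 0 \<le> t1 \<longrightarrow> t1 \<le> t2 \<longrightarrow>
        (\<integral>\<phi>. F \<phi> \<partial>\<rho> t2) = (\<integral>\<phi>. T t1 t2 F \<phi> \<partial>\<rho> t1))"

end

theory Submission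
  imports Defs
begin

text \<open>
  The truncated equation is approximated by a Lie splitting scheme that alternates a step of the
  drift with an increment of the noise. In the real coordinates of the Fourier coefficients white
  noise of variance v is an infinite product of centred Gaussians of variance v, and the drift is
  a sum of elementary rotations: in a coordinate plane, with an angular velocity that is affine in
  one further coordinate (the interaction of a mode with itself requires a change of axes by 45
  degrees). Replacing each elementary flow by its Cayley transform gives a map that preserves all
  these Gaussian measures exactly, while an independent noise increment over a time step h raises
  the variance by h. So the scheme started from variance 1 + t1 has variance 1 + t2 at time t2,
  and it converges pathwise to the solution. In particular no stochastic integration is needed.
\<close>

section \<open>Gaussian sequences\<close>

text \<open>The classical argument for a quadratic equation of this kind applies Liouville's theorem
  to a divergence-free field with conserved energy, which needs the flow to be differentiable in its
  data. Here no derivative of the flow is taken. Each elementary rotation has an angle that depends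
  only on a coordinate outside its plane, so by Fubini it is a linear isometry once that coordinate
  is frozen. Three obstacles shape the rest. There are infinitely many modes, and the dispersive
  angular velocities n^3 are unbounded, so a separate scheme is built for every window |n| \<le> K
  with K \<ge> N: its law is exact on the whole sequence space, its convergence is claimed only
  inside the window, and K tends to infinity at the end. The quadratic field is only locally
  Lipschitz, and the flow is a definite description that says nothing without a solution, so global
  existence has to be proved from the energy identity. Finally, data and solutions have to be moved
  between coordinate sequences and the Sobolev space, where membership holds only almost surely and
  the Borel sets come from a norm.\<close>

definition gauss :: "real \<Rightarrow> real measure" where
  "gauss v = density lborel (\<lambda>x. ennreal (normal_density 0 (sqrt v) x))"

definition gauss_seq :: "real \<Rightarrow> (int \<Rightarrow> real) measure" where
  "gauss_seq v = (\<Pi>\<^sub>M n\<in>UNIV. gauss v)"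

lemma sets_gauss [simp, measurable_cong]: "sets (gauss v) = sets borel"
  by (simp add: gauss_def)

lemma space_gauss [simp]: "space (gauss v) = UNIV"
  by (simp add: gauss_def)

lemma prob_space_gauss: "v > 0 \<Longrightarrow> prob_space (gauss v)"
  unfolding gauss_def by (rule prob_space_normal_density) simp

lemma sets_gauss_seq [simp, measurable_cong]: "sets (gauss_seq v) = sets borel"
proof -
  have "sets (gauss_seq v) = sets (Pi\<^sub>M UNIV (\<lambda>i::int. borel :: real measure))"
    unfolding gauss_seq_def by (intro sets_PiM_cong) auto
  then show ?thesis by (simp add: sets_PiM_equal_borel)
qed

lemma space_gauss_seq [simp]: "space (gauss_seq v) = UNIV"
  using sets_eq_imp_space_eq[OF sets_gauss_seq] by simp

lemma prob_space_gauss_seq: "v > 0 \<Longrightarrow> prob_space (gauss_seq v)"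
  unfolding gauss_seq_def by (intro prob_space_PiM prob_space_gauss)

lemma borel_measurable_fun_upd [measurable (raw)]:
  fixes f :: "'a \<Rightarrow> 'i::countable \<Rightarrow> 'b::second_countable_topology"
  assumes "f \<in> borel_measurable M" "g \<in> borel_measurable M"
  shows "(\<lambda>\<omega>. (f \<omega>)(i := g \<omega>)) \<in> borel_measurable M"
proof (rule measurable_coordinatewise_then_product)
  fix n
  have "(\<lambda>\<omega>. f \<omega> n) \<in> borel_measurable M"
    using assms(1) by (rule measurable_product_then_coordinatewise)
  then show "(\<lambda>\<omega>. ((f \<omega>)(i := g \<omega>)) n) \<in> borel_measurable M"
    using assms(2) by (cases "n = i") auto
qed

section \<open>Rotation invariance of a Gaussian plane\<close>

lemma nn_integral_shear_fst:
  fixes f :: "real \<times> real \<Rightarrow> ennreal"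
  assumes [measurable]: "f \<in> borel_measurable (lborel \<Otimes>\<^sub>M lborel)"
  shows "(\<integral>\<^sup>+p. f (fst p + t * snd p, snd p) \<partial>(lborel \<Otimes>\<^sub>M lborel)) = (\<integral>\<^sup>+p. f p \<partial>(lborel \<Otimes>\<^sub>M lborel))"
proof -
  have "(\<integral>\<^sup>+p. f (fst p + t * snd p, snd p) \<partial>(lborel \<Otimes>\<^sub>M lborel))
      = (\<integral>\<^sup>+b. \<integral>\<^sup>+a. f (a + t * b, b) \<partial>lborel \<partial>lborel)"
    by (subst lborel_pair.nn_integral_snd[symmetric]) auto
  also have "\<dots> = (\<integral>\<^sup>+b. \<integral>\<^sup>+a. f (a, b) \<partial>lborel \<partial>lborel)"
  proof (rule nn_integral_cong)
    fix b :: real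
    show "(\<integral>\<^sup>+a. f (a + t * b, b) \<partial>lborel) = (\<integral>\<^sup>+a. f (a, b) \<partial>lborel)"
      by (subst nn_integral_real_affine[of "\<lambda>a. f (a, b)" 1 "t * b"]) (auto simp: add.commute)
  qed
  also have "\<dots> = (\<integral>\<^sup>+p. f p \<partial>(lborel \<Otimes>\<^sub>M lborel))"
    by (subst lborel_pair.nn_integral_snd[symmetric]) auto
  finally show ?thesis .
qed

lemma nn_integral_shear_snd:
  fixes f :: "real \<times> real \<Rightarrow> ennreal"
  assumes [measurable]: "f \<in> borel_measurable (lborel \<Otimes>\<^sub>M lborel)"
  shows "(\<integral>\<^sup>+p. f (fst p, snd p + t * fst p) \<partial>(lborel \<Otimes>\<^sub>M lborel)) = (\<integral>\<^sup>+p. f p \<partial>(lborel \<Otimes>\<^sub>M lborel))"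
proof -
  have "(\<integral>\<^sup>+p. f (fst p, snd p + t * fst p) \<partial>(lborel \<Otimes>\<^sub>M lborel))
      = (\<integral>\<^sup>+a. \<integral>\<^sup>+b. f (a, b + t * a) \<partial>lborel \<partial>lborel)"
    by (subst lborel.nn_integral_fst[symmetric]) auto
  also have "\<dots> = (\<integral>\<^sup>+a. \<integral>\<^sup>+b. f (a, b) \<partial>lborel \<partial>lborel)"
  proof (rule nn_integral_cong)
    fix a :: real
    show "(\<integral>\<^sup>+b. f (a, b + t * a) \<partial>lborel) = (\<integral>\<^sup>+b. f (a, b) \<partial>lborel)"
      by (subst nn_integral_real_affine[of "\<lambda>b. f (a, b)" 1 "t * a"]) (auto simp: add.commute)
  qed
  also have "\<dots> = (\<integral>\<^sup>+p. f p \<partial>(lborel \<Otimes>\<^sub>M lborel))"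
    by (subst lborel.nn_integral_fst[symmetric]) auto
  finally show ?thesis .
qed

text \<open>A plane rotation is a product of three shears.\<close>

lemma nn_integral_rotation:
  fixes f :: "real \<times> real \<Rightarrow> ennreal"
  assumes [measurable]: "f \<in> borel_measurable (lborel \<Otimes>\<^sub>M lborel)"
    and cs: "c\<^sup>2 + s\<^sup>2 = 1" "c > -1"
  shows "(\<integral>\<^sup>+p. f (c * fst p + s * snd p, - s * fst p + c * snd p) \<partial>(lborel \<Otimes>\<^sub>M lborel))
    = (\<integral>\<^sup>+p. f p \<partial>(lborel \<Otimes>\<^sub>M lborel))"
proof -
  \<comment> \<open>\<open>t\<close> is the tangent of half the rotation angle. The hypothesis c >
    -1 excludes exactly the half turn, where this tangent is infinite.\<close>
  define t where "t = s / (1 + c)"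
  have "s * s = (1 - c) * (1 + c)"
    using cs by (simp add: power2_eq_square algebra_simps)
  then have st: "s * t = 1 - c"
    using cs(2) by (simp add: t_def)
  have tc: "t + c * t = s"
  proof -
    have "t + c * t = (1 + c) * t" by (simp add: algebra_simps)
    then show ?thesis using cs(2) by (simp add: t_def)
  qed
  \<comment> \<open>The factorisation: shear the first coordinate by \<open>t\<close>, the second by
    \<open>- s\<close>, the first again by \<open>t\<close>.\<close>
  have eq: "c * a + s * b = (a + t * b) + t * (b - s * (a + t * b))"
    "- s * a + c * b = b - s * (a + t * b)" for a b
  proof -
    have "(a + t * b) + t * (b - s * (a + t * b)) = a + 2 * (t * b) - (s * t) * a - (s * t) * (t * b)"
      by (simp add: algebra_simps)
    also have "\<dots> = c * a + (t + c * t) * b"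
      unfolding st by (simp add: algebra_simps)
    finally show "c * a + s * b = (a + t * b) + t * (b - s * (a + t * b))"
      unfolding tc by simp
    have "b - s * (a + t * b) = b - s * a - (s * t) * b"
      by (simp add: algebra_simps)
    then show "- s * a + c * b = b - s * (a + t * b)"
      unfolding st by (simp add: algebra_simps)
  qed
  let ?g = "\<lambda>p. f (fst p + t * snd p, snd p)"
  let ?h = "\<lambda>p. ?g (fst p, snd p + (- s) * fst p)"
  have "(\<integral>\<^sup>+p. f p \<partial>(lborel \<Otimes>\<^sub>M lborel)) = (\<integral>\<^sup>+p. ?g p \<partial>(lborel \<Otimes>\<^sub>M lborel))"
    by (rule nn_integral_shear_fst[symmetric]) measurable
  also have "\<dots> = (\<integral>\<^sup>+p. ?h p \<partial>(lborel \<Otimes>\<^sub>M lborel))"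
    by (rule nn_integral_shear_snd[symmetric]) measurable
  also have "\<dots> = (\<integral>\<^sup>+p. ?h (fst p + t * snd p, snd p) \<partial>(lborel \<Otimes>\<^sub>M lborel))"
    by (rule nn_integral_shear_fst[symmetric]) measurable
  also have "\<dots> = (\<integral>\<^sup>+p. f (c * fst p + s * snd p, - s * fst p + c * snd p) \<partial>(lborel \<Otimes>\<^sub>M lborel))"
    unfolding eq by simp
  finally show ?thesis by simp
qed

text \<open>The product of the two densities depends on the point only through its Euclidean norm;
  this is what lets a Lebesgue-preserving rotation preserve the Gaussian plane.\<close>

lemma nn_integral_gauss_pair:
  assumes v: "v > 0" and [measurable]: "f \<in> borel_measurable (borel \<Otimes>\<^sub>M borel)"
  shows "(\<integral>\<^sup>+a. \<integral>\<^sup>+b. f (a, b) \<partial>gauss v \<partial>gauss v)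
    = (\<integral>\<^sup>+p. ennreal (exp (- ((fst p)\<^sup>2 + (snd p)\<^sup>2) / (2 * v)) / (2 * pi * v)) * f p \<partial>(lborel \<Otimes>\<^sub>M lborel))"
proof -
  let ?n = "normal_density 0 (sqrt v)"
  have "(\<integral>\<^sup>+a. \<integral>\<^sup>+b. f (a, b) \<partial>gauss v \<partial>gauss v)
      = (\<integral>\<^sup>+a. \<integral>\<^sup>+b. ennreal (?n a) * (ennreal (?n b) * f (a, b)) \<partial>lborel \<partial>lborel)"
    unfolding gauss_def
    by (subst nn_integral_density) (auto simp: nn_integral_density nn_integral_cmult)
  also have "\<dots> = (\<integral>\<^sup>+a. \<integral>\<^sup>+b. ennreal (exp (- (a\<^sup>2 + b\<^sup>2) / (2 * v)) / (2 * pi * v)) * f (a, b) \<partial>lborel \<partial>lborel)"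
  proof (intro nn_integral_cong)
    fix a b :: real
    have "?n a * ?n b = exp (- (a\<^sup>2 + b\<^sup>2) / (2 * v)) / (2 * pi * v)"
      using v by (simp add: normal_density_def exp_add[symmetric] add_divide_distrib diff_divide_distrib real_sqrt_mult[symmetric])
    then show "ennreal (?n a) * (ennreal (?n b) * f (a, b))
      = ennreal (exp (- (a\<^sup>2 + b\<^sup>2) / (2 * v)) / (2 * pi * v)) * f (a, b)"
      by (metis ennreal_mult mult.assoc normal_density_nonneg)
  qed
  also have "\<dots> = (\<integral>\<^sup>+p. ennreal (exp (- ((fst p)\<^sup>2 + (snd p)\<^sup>2) / (2 * v)) / (2 * pi * v)) * f p \<partial>(lborel \<Otimes>\<^sub>M lborel))"
    by (subst lborel.nn_integral_fst[symmetric]) auto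
  finally show ?thesis .
qed

lemma nn_integral_gauss_rotation:
  assumes v: "v > 0" and [measurable]: "f \<in> borel_measurable (borel \<Otimes>\<^sub>M borel)"
    and cs: "c\<^sup>2 + s\<^sup>2 = 1" "c > -1"
  shows "(\<integral>\<^sup>+a. \<integral>\<^sup>+b. f (c * a + s * b, - s * a + c * b) \<partial>gauss v \<partial>gauss v)
    = (\<integral>\<^sup>+a. \<integral>\<^sup>+b. f (a, b) \<partial>gauss v \<partial>gauss v)"
proof -
  let ?e = "\<lambda>p. ennreal (exp (- ((fst p)\<^sup>2 + (snd p)\<^sup>2) / (2 * v)) / (2 * pi * v)) :: ennreal"
  let ?r = "\<lambda>p. (c * fst p + s * snd p, - s * fst p + c * snd p)"
  have inv: "(c * a + s * b)\<^sup>2 + (c * b - s * a)\<^sup>2 = a\<^sup>2 + b\<^sup>2" for a b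
  proof -
    have "(c * a + s * b)\<^sup>2 + (c * b - s * a)\<^sup>2 = (c\<^sup>2 + s\<^sup>2) * (a\<^sup>2 + b\<^sup>2)"
      by (simp add: power2_eq_square algebra_simps)
    then show ?thesis using cs by simp
  qed
  have "(\<integral>\<^sup>+a. \<integral>\<^sup>+b. f (c * a + s * b, - s * a + c * b) \<partial>gauss v \<partial>gauss v)
      = (\<integral>\<^sup>+p. ?e p * f (?r p) \<partial>(lborel \<Otimes>\<^sub>M lborel))"
    using nn_integral_gauss_pair[OF v, of "\<lambda>p. f (?r p)"] by simp
  also have "\<dots> = (\<integral>\<^sup>+p. ?e (?r p) * f (?r p) \<partial>(lborel \<Otimes>\<^sub>M lborel))"
    by (simp add: inv)
  also have "\<dots> = (\<integral>\<^sup>+p. ?e p * f p \<partial>(lborel \<Otimes>\<^sub>M lborel))"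
    by (rule nn_integral_rotation[OF _ cs, of "\<lambda>p. ?e p * f p"]) measurable
  also have "\<dots> = (\<integral>\<^sup>+a. \<integral>\<^sup>+b. f (a, b) \<partial>gauss v \<partial>gauss v)"
    by (rule nn_integral_gauss_pair[OF v, symmetric]) simp
  finally show ?thesis .
qed

lemma nn_integral_gauss_uminus:
  assumes [measurable]: "f \<in> borel_measurable borel"
  shows "(\<integral>\<^sup>+a. f (- a) \<partial>gauss v) = (\<integral>\<^sup>+a. f a \<partial>gauss v)"
proof -
  have "(\<integral>\<^sup>+a. f a \<partial>gauss v) = (\<integral>\<^sup>+a. ennreal (normal_density 0 (sqrt v) a) * f a \<partial>lborel)"
    unfolding gauss_def by (subst nn_integral_density) auto
  also have "\<dots> = (\<integral>\<^sup>+a. ennreal (normal_density 0 (sqrt v) a) * f (- a) \<partial>lborel)"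
    by (subst nn_integral_real_affine[where c="-1" and t=0]) (auto simp: normal_density_def)
  also have "\<dots> = (\<integral>\<^sup>+a. f (- a) \<partial>gauss v)"
    unfolding gauss_def by (subst nn_integral_density) auto
  finally show ?thesis by simp
qed

section \<open>Maps that preserve Gaussian sequences\<close>

text \<open>Resampling one coordinate from its own law does not change a product measure. Applied
  once or twice, this turns a statement about infinitely many coordinates into an inner integral
  over one or two of them.\<close>

lemma nn_integral_gauss_seq_upd:
  assumes v: "v > 0" and [measurable]: "f \<in> borel_measurable borel"
  shows "(\<integral>\<^sup>+x. f x \<partial>gauss_seq v) = (\<integral>\<^sup>+x. \<integral>\<^sup>+a. f (x(i := a)) \<partial>gauss v \<partial>gauss_seq v)"
proof -
  interpret g: prob_space "gauss v" by (rule prob_space_gauss[OF v])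
  interpret gs: prob_space "gauss_seq v" by (rule prob_space_gauss_seq[OF v])
  interpret pair_prob_space "gauss_seq v" "gauss v" ..
  have eq: "gauss_seq v = distr (gauss v \<Otimes>\<^sub>M gauss_seq v) (gauss_seq v) (\<lambda>(a, x). x(i := a))"
    using distr_pair_PiM_eq_PiM[of UNIV "\<lambda>_. gauss v" i] g.prob_space_axioms
    by (simp add: gauss_seq_def)
  have "(\<integral>\<^sup>+x. f x \<partial>gauss_seq v) = (\<integral>\<^sup>+p. f ((snd p)(i := fst p)) \<partial>(gauss v \<Otimes>\<^sub>M gauss_seq v))"
    by (subst eq, subst nn_integral_distr) (auto simp: case_prod_unfold)
  also have "\<dots> = (\<integral>\<^sup>+x. \<integral>\<^sup>+a. f (x(i := a)) \<partial>gauss v \<partial>gauss_seq v)"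
  proof -
    interpret q: pair_prob_space "gauss v" "gauss_seq v" ..
    show ?thesis by (subst q.nn_integral_snd[symmetric]) auto
  qed
  finally show ?thesis .
qed

text \<open>All variances are demanded at once because the scheme applies the same map to a sequence
  whose variance grows from step to step.\<close>

definition measure_preserving_seq :: "((int \<Rightarrow> real) \<Rightarrow> (int \<Rightarrow> real)) \<Rightarrow> bool" where
  "measure_preserving_seq S \<longleftrightarrow> S \<in> borel_measurable borel \<and>
     (\<forall>v>0. distr (gauss_seq v) borel S = gauss_seq v)"

lemma measure_preserving_seqI:
  assumes [measurable]: "S \<in> borel_measurable borel"
    and "\<And>v f. v > 0 \<Longrightarrow> f \<in> borel_measurable borel \<Longrightarrow>
      (\<integral>\<^sup>+x. f (S x) \<partial>gauss_seq v) = (\<integral>\<^sup>+x. f x \<partial>gauss_seq v)"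
  shows "measure_preserving_seq S"
  unfolding measure_preserving_seq_def
proof (intro conjI allI impI measure_eqI)
  fix v :: real and A assume v: "v > 0" and A: "A \<in> sets (distr (gauss_seq v) borel S)"
  then have [measurable]: "A \<in> sets borel" by simp
  have "emeasure (distr (gauss_seq v) borel S) A = (\<integral>\<^sup>+x. indicator A x \<partial>distr (gauss_seq v) borel S)"
    by simp
  also have "\<dots> = (\<integral>\<^sup>+x. indicator A (S x) \<partial>gauss_seq v)"
    by (rule nn_integral_distr) measurable
  also have "\<dots> = (\<integral>\<^sup>+x. indicator A x \<partial>gauss_seq v)"
    by (rule assms(2)[OF v]) measurable
  also have "\<dots> = emeasure (gauss_seq v) A" by simp
  finally show "emeasure (distr (gauss_seq v) borel S) A = emeasure (gauss_seq v) A" .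
qed auto

lemma measure_preserving_seq_comp:
  assumes "measure_preserving_seq S" "measure_preserving_seq T"
  shows "measure_preserving_seq (\<lambda>x. S (T x))"
  unfolding measure_preserving_seq_def
proof (intro conjI allI impI)
  have [measurable]: "S \<in> borel_measurable borel" "T \<in> borel_measurable borel"
    using assms by (auto simp: measure_preserving_seq_def)
  show "(\<lambda>x. S (T x)) \<in> borel_measurable borel" by measurable
  fix v :: real assume "v > 0"
  then show "distr (gauss_seq v) borel (\<lambda>x. S (T x)) = gauss_seq v"
    using assms distr_distr[of S borel borel T "gauss_seq v"]
    by (auto simp: measure_preserving_seq_def comp_def)
qed

text \<open>The angle may vary with the sequence as long as it ignores the coordinates
  \<open>i\<close> and \<open>j\<close>. Resampling these two makes the inner integral run over a
  Gaussian plane on which \<open>c x\<close> and \<open>s x\<close> are constants, so the linear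
  case applies for each fixed \<open>x\<close>.\<close>

lemma measure_preserving_seq_rotation:
  fixes c s :: "(int \<Rightarrow> real) \<Rightarrow> real"
  assumes ij: "i \<noteq> j"
    and [measurable]: "c \<in> borel_measurable borel" "s \<in> borel_measurable borel"
    and cs: "\<And>x. (c x)\<^sup>2 + (s x)\<^sup>2 = 1" "\<And>x. c x > -1"
    and indep: "\<And>x a b. c (x(i := a, j := b)) = c x" "\<And>x a b. s (x(i := a, j := b)) = s x"
  shows "measure_preserving_seq
    (\<lambda>x. x(i := c x * x i + s x * x j, j := - s x * x i + c x * x j))" (is "measure_preserving_seq ?S")
proof (rule measure_preserving_seqI)
  show S [measurable]: "?S \<in> borel_measurable borel" by measurable
  fix v :: real and f :: "(int \<Rightarrow> real) \<Rightarrow> ennreal"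
  assume v: "v > 0" and [measurable]: "f \<in> borel_measurable borel"
  interpret g: prob_space "gauss v" by (rule prob_space_gauss[OF v])
  have two: "(\<integral>\<^sup>+x. h x \<partial>gauss_seq v)
      = (\<integral>\<^sup>+x. \<integral>\<^sup>+a. \<integral>\<^sup>+b. h (x(i := a, j := b)) \<partial>gauss v \<partial>gauss v \<partial>gauss_seq v)"
    if [measurable]: "h \<in> borel_measurable borel" for h :: "(int \<Rightarrow> real) \<Rightarrow> ennreal"
    by (subst nn_integral_gauss_seq_upd[OF v, of h j], simp,
        subst nn_integral_gauss_seq_upd[OF v, of _ i]) simp_all
  have "(\<integral>\<^sup>+x. f (?S x) \<partial>gauss_seq v)
      = (\<integral>\<^sup>+x. \<integral>\<^sup>+a. \<integral>\<^sup>+b. f (?S (x(i := a, j := b))) \<partial>gauss v \<partial>gauss v \<partial>gauss_seq v)"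
    by (rule two[of "\<lambda>x. f (?S x)"]) measurable
  also have "\<dots> = (\<integral>\<^sup>+x. \<integral>\<^sup>+a. \<integral>\<^sup>+b. f (x(i := a, j := b)) \<partial>gauss v \<partial>gauss v \<partial>gauss_seq v)"
  proof (rule nn_integral_cong)
    fix x
    have "?S (x(i := a, j := b)) = x(i := c x * a + s x * b, j := - s x * a + c x * b)" for a b
      using ij by (simp add: indep fun_eq_iff)
    then have "(\<integral>\<^sup>+a. \<integral>\<^sup>+b. f (?S (x(i := a, j := b))) \<partial>gauss v \<partial>gauss v)
      = (\<integral>\<^sup>+a. \<integral>\<^sup>+b. (\<lambda>p. f (x(i := fst p, j := snd p))) (c x * a + s x * b, - s x * a + c x * b) \<partial>gauss v \<partial>gauss v)"
      by (simp only: fst_conv snd_conv)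
    also have "\<dots> = (\<integral>\<^sup>+a. \<integral>\<^sup>+b. (\<lambda>p. f (x(i := fst p, j := snd p))) (a, b) \<partial>gauss v \<partial>gauss v)"
      by (rule nn_integral_gauss_rotation[OF v _ cs]) measurable
    finally show "(\<integral>\<^sup>+a. \<integral>\<^sup>+b. f (?S (x(i := a, j := b))) \<partial>gauss v \<partial>gauss v)
      = (\<integral>\<^sup>+a. \<integral>\<^sup>+b. f (x(i := a, j := b)) \<partial>gauss v \<partial>gauss v)"
      by simp
  qed
  also have "\<dots> = (\<integral>\<^sup>+x. f x \<partial>gauss_seq v)"
    by (rule two[symmetric]) simp
  finally show "(\<integral>\<^sup>+x. f (?S x) \<partial>gauss_seq v) = (\<integral>\<^sup>+x. f x \<partial>gauss_seq v)" .
qed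

text \<open>Rotations have determinant 1; this sign change supplies the orientation-reversing
  isometries.\<close>

lemma measure_preserving_seq_uminus:
  "measure_preserving_seq (\<lambda>x. x(j := - x j))"
proof (rule measure_preserving_seqI)
  show [measurable]: "(\<lambda>x. x(j := - x j)) \<in> borel_measurable (borel :: (int \<Rightarrow> real) measure)"
    by measurable
  fix v :: real and f :: "(int \<Rightarrow> real) \<Rightarrow> ennreal"
  assume v: "v > 0" and [measurable]: "f \<in> borel_measurable borel"
  have "(\<integral>\<^sup>+x. f (x(j := - x j)) \<partial>gauss_seq v)
      = (\<integral>\<^sup>+x. \<integral>\<^sup>+a. f (x(j := - a)) \<partial>gauss v \<partial>gauss_seq v)"
    by (subst nn_integral_gauss_seq_upd[OF v, of _ j]) simp_all
  also have "\<dots> = (\<integral>\<^sup>+x. \<integral>\<^sup>+a. f (x(j := a)) \<partial>gauss v \<partial>gauss_seq v)"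
    by (intro nn_integral_cong nn_integral_gauss_uminus) measurable
  also have "\<dots> = (\<integral>\<^sup>+x. f x \<partial>gauss_seq v)"
    by (rule nn_integral_gauss_seq_upd[OF v, symmetric]) simp
  finally show "(\<integral>\<^sup>+x. f (x(j := - x j)) \<partial>gauss_seq v) = (\<integral>\<^sup>+x. f x \<partial>gauss_seq v)" .
qed

section \<open>Sums of independent Gaussian sequences\<close>

lemma gauss_convolution:
  assumes "v > 0" "w > 0"
  shows "distr (gauss v \<Otimes>\<^sub>M gauss w) borel (\<lambda>(x, y). x + y) = gauss (v + w)"
proof -
  have "convolution (gauss v) (gauss w)
    = density lborel (\<lambda>x. \<integral>\<^sup>+y. ennreal (normal_density 0 (sqrt v) (x - y)) * ennreal (normal_density 0 (sqrt w) y) \<partial>lborel)"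
    using prob_space_gauss[OF assms(1)] prob_space_gauss[OF assms(2)] unfolding gauss_def
    by (intro convolution_density) (auto simp: prob_space_def)
  also have "\<dots> = gauss (v + w)"
    using conv_normal_density_zero_mean[of "sqrt v" "sqrt w"] assms
    unfolding gauss_def by (simp add: ennreal_mult)
  finally show ?thesis by (simp add: convolution_def)
qed

lemma distr_gauss_seq_component:
  assumes "v > 0"
  shows "distr (gauss_seq v) borel (\<lambda>x. x n) = gauss v"
proof -
  have "distr (gauss_seq v) borel (\<lambda>x. x n) = distr (gauss_seq v) (gauss v) (\<lambda>x. x n)"
    by (rule distr_cong) auto
  then show ?thesis
    unfolding gauss_seq_def
    using distr_PiM_component[of UNIV "\<lambda>_. gauss v" n] prob_space_gauss[OF assms] by simp
qed

lemma indep_vars_gauss_seq: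
  assumes "v > 0"
  shows "prob_space.indep_vars (gauss_seq v) (\<lambda>_. borel) (\<lambda>n x. x n) UNIV"
proof -
  interpret prob_space "gauss_seq v" by (rule prob_space_gauss_seq[OF assms])
  have "distr (gauss_seq v) (Pi\<^sub>M UNIV (\<lambda>_. borel)) (\<lambda>x. \<lambda>n\<in>UNIV. x n) = distr (gauss_seq v) (gauss_seq v) (\<lambda>x. x)"
    by (intro distr_cong) (auto simp: sets_PiM_equal_borel)
  then show ?thesis
    by (subst indep_vars_iff_distr_eq_PiM) (auto simp: distr_gauss_seq_component[OF assms] distr_id2 gauss_seq_def[symmetric])
qed

lemma gauss_seq_eqI:
  assumes v: "v > 0" and M: "sets M = sets borel"
    and eq: "\<And>J F. finite J \<Longrightarrow> (\<And>j. j \<in> J \<Longrightarrow> F j \<in> sets borel) \<Longrightarrow>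
      emeasure M {x. \<forall>j\<in>J. x j \<in> F j} = (\<Prod>j\<in>J. emeasure (gauss v) (F j))"
  shows "M = gauss_seq v"
proof -
  interpret g: prob_space "gauss v" by (rule prob_space_gauss[OF v])
  interpret product_prob_space "\<lambda>_::int. gauss v" UNIV ..
  show ?thesis
    unfolding gauss_seq_def
  proof (rule PiM_eq)
    show "sets M = sets (Pi\<^sub>M UNIV (\<lambda>i::int. gauss v))"
      using sets_gauss_seq M by (simp add: gauss_seq_def)
  next
    fix J :: "int set" and F :: "int \<Rightarrow> real set"
    assume J: "finite J" "\<And>j. j \<in> J \<Longrightarrow> F j \<in> sets (gauss v)"
    have "prod_emb UNIV (\<lambda>_. gauss v) J (Pi\<^sub>E J F) = {x. \<forall>j\<in>J. x j \<in> F j}"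
      by (auto simp: prod_emb_def)
    then show "emeasure M (prod_emb UNIV (\<lambda>_. gauss v) J (Pi\<^sub>E J F)) = (\<Prod>j\<in>J. emeasure (gauss v) (F j))"
      using eq J by simp
  qed
qed

lemma emeasure_gauss_seq_cylinder:
  assumes v: "v > 0" and J: "finite J" "\<And>j. j \<in> J \<Longrightarrow> F j \<in> sets borel"
  shows "emeasure (gauss_seq v) {x. \<forall>j\<in>J. x j \<in> F j} = (\<Prod>j\<in>J. emeasure (gauss v) (F j))"
proof -
  have "prod_emb UNIV (\<lambda>_. gauss v) J (Pi\<^sub>E J F) = {x. \<forall>j\<in>J. x j \<in> F j}"
    by (auto simp: prod_emb_def)
  then show ?thesis
    using emeasure_PiM_emb[of UNIV "\<lambda>_. gauss v" J F] prob_space_gauss[OF v] J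
    by (simp add: gauss_seq_def)
qed

text \<open>For a fixed second summand the probability of a cylinder is a product of functions of
  single coordinates. These are independent under the law of the second summand, so the integral
  factorises into one-dimensional convolutions.\<close>

lemma gauss_seq_convolution:
  assumes v: "v > 0" and w: "w > 0"
  shows "distr (gauss_seq v \<Otimes>\<^sub>M gauss_seq w) borel (\<lambda>(x, y). \<lambda>n. x n + y n) = gauss_seq (v + w)"
    (is "distr ?M _ ?s = _")
proof (rule gauss_seq_eqI)
  show "v + w > 0" using assms by simp
  interpret gv: prob_space "gauss v" by (rule prob_space_gauss[OF v])
  interpret gw: prob_space "gauss w" by (rule prob_space_gauss[OF w])
  interpret gsv: prob_space "gauss_seq v" by (rule prob_space_gauss_seq[OF v])
  interpret gsw: prob_space "gauss_seq w" by (rule prob_space_gauss_seq[OF w])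
  interpret p: pair_prob_space "gauss_seq v" "gauss_seq w" ..
  interpret p1: pair_prob_space "gauss v" "gauss w" ..
  show "sets (distr ?M borel ?s) = sets borel" by simp
  have s [measurable]: "?s \<in> borel_measurable (borel \<Otimes>\<^sub>M borel)"
    by (rule measurable_coordinatewise_then_product)
       (unfold case_prod_unfold, rule borel_measurable_add;
         rule measurable_compose[OF _ measurable_product_coordinates], simp)
  fix J :: "int set" and F :: "int \<Rightarrow> real set"
  assume J: "finite J" "\<And>j. j \<in> J \<Longrightarrow> F j \<in> sets borel"
  have C [measurable]: "{x. \<forall>j\<in>J. x j \<in> F j} \<in> sets borel"
  proof -
    have "{x \<in> space borel. \<forall>j\<in>J. x j \<in> F j} \<in> sets borel"
    proof (rule sets.sets_Collect_finite_All[OF _ J(1)])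
      fix j assume "j \<in> J"
      from J(2)[OF this] have [measurable]: "F j \<in> sets borel" .
      show "{x \<in> space borel. x j \<in> F j} \<in> sets borel" by measurable
    qed
    then show ?thesis by simp
  qed
  \<comment> \<open>The probability that coordinate \<open>j\<close> of the first summand, shifted
    by \<open>y\<close>, lands in \<open>F j\<close>.\<close>
  let ?X = "\<lambda>j y. emeasure (gauss v) {a. a + y \<in> F j}"
  have Xm: "?X j \<in> borel_measurable borel" if "j \<in> J" for j
  proof -
    have [measurable]: "F j \<in> sets borel" using J that by auto
    have "?X j y = (\<integral>\<^sup>+a. indicator (F j) (a + y) \<partial>gauss v)" for y
    proof -
      have "{a \<in> space borel. a + y \<in> F j} \<in> sets borel" by measurable
      then have "{a. a + y \<in> F j} \<in> sets (gauss v)" by simp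
      then have "?X j y = (\<integral>\<^sup>+a. indicator {a. a + y \<in> F j} a \<partial>gauss v)"
        by (rule nn_integral_indicator[symmetric])
      also have "\<dots> = (\<integral>\<^sup>+a. indicator (F j) (a + y) \<partial>gauss v)"
        by (rule nn_integral_cong) (simp add: indicator_def)
      finally show ?thesis .
    qed
    then show ?thesis by (simp, measurable)
  qed
  have "emeasure (distr ?M borel ?s) {x. \<forall>j\<in>J. x j \<in> F j}
      = emeasure ?M {p. \<forall>j\<in>J. fst p j + snd p j \<in> F j}"
    by (subst emeasure_distr) (auto simp: space_pair_measure intro!: arg_cong2[where f=emeasure])
  also have "\<dots> = (\<integral>\<^sup>+y. emeasure (gauss_seq v) {x. \<forall>j\<in>J. x j \<in> {a. a + y j \<in> F j}} \<partial>gauss_seq w)"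
  proof (subst p.emeasure_pair_measure_alt2)
    have "?s -` {x. \<forall>j\<in>J. x j \<in> F j} \<inter> space (borel \<Otimes>\<^sub>M borel) \<in> sets (borel \<Otimes>\<^sub>M borel)"
      by (rule measurable_sets[OF s C])
    also have "?s -` {x. \<forall>j\<in>J. x j \<in> F j} \<inter> space (borel \<Otimes>\<^sub>M borel) = {p. \<forall>j\<in>J. fst p j + snd p j \<in> F j}"
      by (auto simp: space_pair_measure)
    also have "sets (borel \<Otimes>\<^sub>M borel) = sets ?M"
      by (intro sets_pair_measure_cong) auto
    finally show "{p. \<forall>j\<in>J. fst p j + snd p j \<in> F j} \<in> sets ?M" .
  qed (auto simp: vimage_def)
  also have "\<dots> = (\<integral>\<^sup>+y. (\<Prod>j\<in>J. ?X j (y j)) \<partial>gauss_seq w)"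
  proof (rule nn_integral_cong, rule emeasure_gauss_seq_cylinder[OF v J(1)])
    fix y :: "int \<Rightarrow> real" and j assume "j \<in> J"
    from J(2)[OF this] have [measurable]: "F j \<in> sets borel" .
    have "{a \<in> space borel. a + y j \<in> F j} \<in> sets borel" by measurable
    then show "{a. a + y j \<in> F j} \<in> sets borel" by simp
  qed
  also have "\<dots> = (\<Prod>j\<in>J. \<integral>\<^sup>+y. ?X j (y j) \<partial>gauss_seq w)"
  proof (rule gsw.indep_vars_nn_integral[OF J(1)])
    have "gsw.indep_vars (\<lambda>_. borel) (\<lambda>n x. x n) J"
      using indep_vars_gauss_seq[OF w] by (rule gsw.indep_vars_subset) simp
    then show "gsw.indep_vars (\<lambda>_. borel) (\<lambda>j y. ?X j (y j)) J"
      by (rule gsw.indep_vars_compose2) (rule Xm)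
  qed simp
  also have "\<dots> = (\<Prod>j\<in>J. emeasure (gauss (v + w)) (F j))"
  proof (rule prod.cong[OF refl])
    fix j assume j: "j \<in> J"
    from J(2)[OF this] have [measurable]: "F j \<in> sets borel" .
    have "(\<integral>\<^sup>+y. ?X j (y j) \<partial>gauss_seq w) = (\<integral>\<^sup>+b. ?X j b \<partial>distr (gauss_seq w) borel (\<lambda>y. y j))"
      using Xm[OF j] by (subst nn_integral_distr) auto
    also have "\<dots> = (\<integral>\<^sup>+b. ?X j b \<partial>gauss w)"
      by (simp add: distr_gauss_seq_component[OF w])
    also have "\<dots> = emeasure (gauss v \<Otimes>\<^sub>M gauss w) {p. fst p + snd p \<in> F j}"
    proof (subst p1.emeasure_pair_measure_alt2)
      have "{p \<in> space (borel \<Otimes>\<^sub>M borel). fst p + snd p \<in> F j} \<in> sets (borel \<Otimes>\<^sub>M borel)"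
        by measurable
      also have "sets (borel \<Otimes>\<^sub>M borel) = sets (gauss v \<Otimes>\<^sub>M gauss w)"
        by (intro sets_pair_measure_cong) auto
      finally show "{p. fst p + snd p \<in> F j} \<in> sets (gauss v \<Otimes>\<^sub>M gauss w)"
        by (simp add: space_pair_measure)
    qed (auto simp: vimage_def)
    also have "\<dots> = emeasure (distr (gauss v \<Otimes>\<^sub>M gauss w) borel (\<lambda>(x, y). x + y)) (F j)"
      by (subst emeasure_distr) (auto simp: space_pair_measure intro!: arg_cong2[where f=emeasure])
    finally show "(\<integral>\<^sup>+y. ?X j (y j) \<partial>gauss_seq w) = emeasure (gauss (v + w)) (F j)"
      by (simp add: gauss_convolution[OF v w])
  qed
  finally show "emeasure (distr ?M borel ?s) {x. \<forall>j\<in>J. x j \<in> F j} = (\<Prod>j\<in>J. emeasure (gauss (v + w)) (F j))" .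
qed

section \<open>Splitting schemes for conservative fields\<close>

text \<open>Only coordinates in \<open>I\<close> are controlled. For finite \<open>I\<close> the
  Lipschitz clause also says that the values on \<open>I\<close> depend on nothing outside
  \<open>I\<close>: two sequences that agree on \<open>I\<close> get the same values. The Lipschitz
  constant depends on the radius because the fields in question are quadratic; the last two clauses
  are what exclude blow-up.\<close>

definition conservative_field :: "int set \<Rightarrow> ((int \<Rightarrow> real) \<Rightarrow> int \<Rightarrow> real) \<Rightarrow> bool" where
  "conservative_field I f \<longleftrightarrow>
     (\<forall>R. \<exists>L\<ge>0. \<forall>x y. (\<forall>i\<in>I. \<bar>x i\<bar> \<le> R \<and> \<bar>y i\<bar> \<le> R) \<longrightarrow>
        (\<forall>i\<in>I. \<bar>f x i - f y i\<bar> \<le> L * (\<Sum>k\<in>I. \<bar>x k - y k\<bar>))) \<and>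
     (\<exists>C\<ge>0. \<forall>x. \<forall>i\<in>I. \<bar>f x i\<bar> \<le> C * (1 + (\<Sum>k\<in>I. (x k)\<^sup>2))) \<and>
     (\<forall>x. (\<Sum>i\<in>I. x i * f x i) = 0)"

text \<open>A local error of order h^2 gives a global error of order h after about 1/h steps, so
  first-order consistency is all that convergence requires. Consistency is local to
  \<open>I\<close>, whereas the measure is preserved on the whole sequence space.\<close>

definition splitting ::
  "int set \<Rightarrow> ((int \<Rightarrow> real) \<Rightarrow> int \<Rightarrow> real) \<Rightarrow> (real \<Rightarrow> (int \<Rightarrow> real) \<Rightarrow> int \<Rightarrow> real) \<Rightarrow> bool" where
  "splitting I f S \<longleftrightarrow> conservative_field I f \<and> (\<forall>h. measure_preserving_seq (S h)) \<and>
     (\<forall>R. \<exists>C\<ge>0. \<forall>h x. 0 \<le> h \<longrightarrow> h \<le> 1 \<longrightarrow> (\<forall>i\<in>I. \<bar>x i\<bar> \<le> R) \<longrightarrow>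
        (\<forall>i\<in>I. \<bar>S h x i - x i - h * f x i\<bar> \<le> C * h\<^sup>2))"

lemma conservative_fieldI:
  assumes "\<And>R. \<exists>L\<ge>0. \<forall>x y. (\<forall>i\<in>I. \<bar>x i\<bar> \<le> R \<and> \<bar>y i\<bar> \<le> R) \<longrightarrow>
        (\<forall>i\<in>I. \<bar>f x i - f y i\<bar> \<le> L * (\<Sum>k\<in>I. \<bar>x k - y k\<bar>))"
    and "\<exists>C\<ge>0. \<forall>x. \<forall>i\<in>I. \<bar>f x i\<bar> \<le> C * (1 + (\<Sum>k\<in>I. (x k)\<^sup>2))"
    and "\<And>x. (\<Sum>i\<in>I. x i * f x i) = 0"
  shows "conservative_field I f"
  using assms unfolding conservative_field_def by blast

lemma conservative_field_Lipschitz: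
  "conservative_field I f \<Longrightarrow> \<exists>L\<ge>0. \<forall>x y. (\<forall>i\<in>I. \<bar>x i\<bar> \<le> R) \<longrightarrow> (\<forall>i\<in>I. \<bar>y i\<bar> \<le> R) \<longrightarrow>
    (\<forall>i\<in>I. \<bar>f x i - f y i\<bar> \<le> L * (\<Sum>k\<in>I. \<bar>x k - y k\<bar>))"
  unfolding conservative_field_def by meson

lemma conservative_field_growth:
  "conservative_field I f \<Longrightarrow> \<exists>C\<ge>0. \<forall>x. \<forall>i\<in>I. \<bar>f x i\<bar> \<le> C * (1 + (\<Sum>k\<in>I. (x k)\<^sup>2))"
  unfolding conservative_field_def by blast

lemma conservative_field_energy:
  "conservative_field I f \<Longrightarrow> (\<Sum>i\<in>I. x i * f x i) = 0"
  unfolding conservative_field_def by blast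

lemma splitting_consistent:
  "splitting I f S \<Longrightarrow> \<exists>C\<ge>0. \<forall>h x. 0 \<le> h \<longrightarrow> h \<le> 1 \<longrightarrow> (\<forall>i\<in>I. \<bar>x i\<bar> \<le> R) \<longrightarrow>
     (\<forall>i\<in>I. \<bar>S h x i - x i - h * f x i\<bar> \<le> C * h\<^sup>2)"
  unfolding splitting_def by blast

lemma splitting_field: "splitting I f S \<Longrightarrow> conservative_field I f"
  and splitting_measure_preserving: "splitting I f S \<Longrightarrow> measure_preserving_seq (S h)"
  unfolding splitting_def by blast+

lemma splitting_cong:
  assumes "\<And>x i. i \<in> I \<Longrightarrow> f x i = f' x i" and "splitting I f S"
  shows "splitting I f' S"
proof -
  have "splitting I f S = splitting I f' S"
    unfolding splitting_def conservative_field_def using assms(1) by (simp cong: ball_cong sum.cong)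
  then show ?thesis using assms by simp
qed

lemma measure_preserving_seq_id: "measure_preserving_seq (\<lambda>x. x)"
  unfolding measure_preserving_seq_def by (auto intro!: distr_id2)

lemma splitting_zero: "splitting I (\<lambda>x n. 0) (\<lambda>h x. x)"
  unfolding splitting_def conservative_field_def
  by (auto simp: measure_preserving_seq_id intro!: exI[of _ 0])

lemma field_bounded:
  assumes "conservative_field I f" "finite I"
  shows "\<exists>B\<ge>0. \<forall>x. (\<forall>i\<in>I. \<bar>x i\<bar> \<le> R) \<longrightarrow> (\<forall>i\<in>I. \<bar>f x i\<bar> \<le> B)"
proof -
  obtain C where C: "C \<ge> 0" "\<forall>x. (\<forall>i\<in>I. \<bar>f x i\<bar> \<le> C * (1 + (\<Sum>k\<in>I. (x k)\<^sup>2)))"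
    using conservative_field_growth[OF assms(1)] by blast
  show ?thesis
  proof (intro exI[of _ "C * (1 + (\<Sum>k\<in>I. R\<^sup>2))"] conjI allI impI ballI)
    show "C * (1 + (\<Sum>k\<in>I. R\<^sup>2)) \<ge> 0" using C by (simp add: sum_nonneg)
    fix x i assume x: "\<forall>i\<in>I. \<bar>x i\<bar> \<le> R" and i: "i \<in> I"
    have "(\<Sum>k\<in>I. (x k)\<^sup>2) \<le> (\<Sum>k\<in>I. R\<^sup>2)"
      using x by (intro sum_mono) (metis abs_ge_zero order_trans power_mono power2_abs)
    then have "C * (1 + (\<Sum>k\<in>I. (x k)\<^sup>2)) \<le> C * (1 + (\<Sum>k\<in>I. R\<^sup>2))"
      using C(1) by (intro mult_left_mono) auto
    then show "\<bar>f x i\<bar> \<le> C * (1 + (\<Sum>k\<in>I. R\<^sup>2))" using C(2)[rule_format, OF i, of x] by linarith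
  qed
qed

text \<open>One Lie splitting step. Besides the two local errors there is the cost of evaluating
  \<open>f\<close> at \<open>T h x\<close> instead of \<open>x\<close>; these points differ by O(h),
  and the factor h in front of the field makes the cost O(h^2).\<close>

lemma splitting_add:
  assumes I: "finite I" and f: "splitting I f S" and g: "splitting I g T"
  shows "splitting I (\<lambda>x n. f x n + g x n) (\<lambda>h x. S h (T h x))"
  unfolding splitting_def
proof (intro conjI allI)
  note ff = splitting_field[OF f] and gf = splitting_field[OF g]
  show "conservative_field I (\<lambda>x n. f x n + g x n)"
  proof (rule conservative_fieldI)
    fix R
    obtain L where L: "L \<ge> 0" "\<forall>x y. (\<forall>i\<in>I. \<bar>x i\<bar> \<le> R) \<longrightarrow> (\<forall>i\<in>I. \<bar>y i\<bar> \<le> R) \<longrightarrow> (\<forall>i\<in>I.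
      \<bar>f x i - f y i\<bar> \<le> L * (\<Sum>k\<in>I. \<bar>x k - y k\<bar>))"
      using conservative_field_Lipschitz[OF ff, of R] by blast
    obtain K where K: "K \<ge> 0" "\<forall>x y. (\<forall>i\<in>I. \<bar>x i\<bar> \<le> R) \<longrightarrow> (\<forall>i\<in>I. \<bar>y i\<bar> \<le> R) \<longrightarrow> (\<forall>i\<in>I.
      \<bar>g x i - g y i\<bar> \<le> K * (\<Sum>k\<in>I. \<bar>x k - y k\<bar>))"
      using conservative_field_Lipschitz[OF gf, of R] by blast
    show "\<exists>L\<ge>0. \<forall>x y. (\<forall>i\<in>I. \<bar>x i\<bar> \<le> R \<and> \<bar>y i\<bar> \<le> R) \<longrightarrow>
        (\<forall>i\<in>I. \<bar>f x i + g x i - (f y i + g y i)\<bar> \<le> L * (\<Sum>k\<in>I. \<bar>x k - y k\<bar>))"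
    proof (intro exI[of _ "L + K"] conjI allI impI ballI)
      fix x y i assume "\<forall>i\<in>I. \<bar>x i\<bar> \<le> R \<and> \<bar>y i\<bar> \<le> R" "i \<in> I"
      then show "\<bar>f x i + g x i - (f y i + g y i)\<bar> \<le> (L + K) * (\<Sum>k\<in>I. \<bar>x k - y k\<bar>)"
        using L(2)[rule_format, of x y i] K(2)[rule_format, of x y i] by (auto simp: distrib_right)
    qed (use L K in auto)
  next
    obtain C where C: "C \<ge> 0" "\<forall>x. (\<forall>i\<in>I. \<bar>f x i\<bar> \<le> C * (1 + (\<Sum>k\<in>I. (x k)\<^sup>2)))"
      using conservative_field_growth[OF ff] by blast
    obtain D where D: "D \<ge> 0" "\<forall>x. (\<forall>i\<in>I. \<bar>g x i\<bar> \<le> D * (1 + (\<Sum>k\<in>I. (x k)\<^sup>2)))"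
      using conservative_field_growth[OF gf] by blast
    show "\<exists>C\<ge>0. \<forall>x. \<forall>i\<in>I. \<bar>f x i + g x i\<bar> \<le> C * (1 + (\<Sum>k\<in>I. (x k)\<^sup>2))"
    proof (intro exI[of _ "C + D"] conjI allI ballI)
      fix x i assume "i \<in> I"
      then show "\<bar>f x i + g x i\<bar> \<le> (C + D) * (1 + (\<Sum>k\<in>I. (x k)\<^sup>2))"
        using C(2)[rule_format, of i x] D(2)[rule_format, of i x] abs_triangle_ineq[of "f x i" "g x i"]
          distrib_right[of C D "1 + (\<Sum>k\<in>I. (x k)\<^sup>2)"] by linarith
    qed (use C D in auto)
  next
    show "(\<Sum>i\<in>I. x i * (f x i + g x i)) = 0" for x
      using conservative_field_energy[OF ff, of x] conservative_field_energy[OF gf, of x]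
      by (simp add: distrib_left sum.distrib)
  qed
  show "measure_preserving_seq (\<lambda>x. S h (T h x))" for h
    using splitting_measure_preserving[OF f] splitting_measure_preserving[OF g]
    by (rule measure_preserving_seq_comp)
  fix R :: real
  obtain B where B: "B \<ge> 0" "\<forall>x. (\<forall>k\<in>I. \<bar>x k\<bar> \<le> R) \<longrightarrow> (\<forall>i\<in>I. \<bar>g x i\<bar> \<le> B)"
    using field_bounded[OF gf I, of R] by blast
  obtain C where C: "C \<ge> 0" "\<forall>h x. 0 \<le> h \<longrightarrow> h \<le> 1 \<longrightarrow> (\<forall>i\<in>I. \<bar>x i\<bar> \<le> R) \<longrightarrow> (\<forall>i\<in>I.
    \<bar>T h x i - x i - h * g x i\<bar> \<le> C * h\<^sup>2)"
    using splitting_consistent[OF g, of R] by blast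
  \<comment> \<open>A radius that still contains \<open>T h x\<close>: for h \<le> 1 a step from the
    ball of radius \<open>R\<close> moves by at most h B + C h^2 \<le> B + C in each
    coordinate.\<close>
  define Q where "Q = R + B + C"
  obtain D where D: "D \<ge> 0" "\<forall>h x. 0 \<le> h \<longrightarrow> h \<le> 1 \<longrightarrow> (\<forall>i\<in>I. \<bar>x i\<bar> \<le> Q) \<longrightarrow> (\<forall>i\<in>I.
    \<bar>S h x i - x i - h * f x i\<bar> \<le> D * h\<^sup>2)"
    using splitting_consistent[OF f, of Q] by blast
  obtain L where L: "L \<ge> 0" "\<forall>x y. (\<forall>i\<in>I. \<bar>x i\<bar> \<le> Q) \<longrightarrow> (\<forall>i\<in>I. \<bar>y i\<bar> \<le> Q) \<longrightarrow> (\<forall>i\<in>I.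
    \<bar>f x i - f y i\<bar> \<le> L * (\<Sum>k\<in>I. \<bar>x k - y k\<bar>))"
    using conservative_field_Lipschitz[OF ff, of Q] by blast
  show "\<exists>C\<ge>0. \<forall>h x. 0 \<le> h \<longrightarrow> h \<le> 1 \<longrightarrow> (\<forall>i\<in>I. \<bar>x i\<bar> \<le> R) \<longrightarrow>
    (\<forall>i\<in>I. \<bar>S h (T h x) i - x i - h * (f x i + g x i)\<bar> \<le> C * h\<^sup>2)"
  \<comment> \<open>\<open>C\<close> is the local error of \<open>T\<close>, \<open>D\<close> that
    of \<open>S\<close> at the enlarged radius, and the last term is \<open>L\<close> times the
    total displacement of the coordinates per unit of h.\<close>
  proof (intro exI[of _ "C + D + L * (card I * (B + C))"] conjI allI impI ballI)
    show "0 \<le> C + D + L * (card I * (B + C))" using B C D L by simp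
    fix h x i assume h: "0 \<le> h" "h \<le> (1::real)" and x: "\<forall>i\<in>I. \<bar>x i\<bar> \<le> R" and i: "i \<in> I"
    let ?y = "T h x"
    have hh: "h\<^sup>2 \<le> h" using h by (simp add: power2_eq_square mult_left_le_one_le)
    have yx: "\<bar>?y k - x k\<bar> \<le> h * (B + C)" if "k \<in> I" for k
    proof -
      have "\<bar>?y k - x k - h * g x k\<bar> \<le> C * h\<^sup>2" using C(2)[rule_format, OF h _ that, of x] x by auto
      moreover have "h * \<bar>g x k\<bar> \<le> h * B" using B(2)[rule_format, OF _ that, of x] x h by (intro mult_left_mono) auto
      moreover have "\<bar>h * g x k\<bar> = h * \<bar>g x k\<bar>" using h by (simp add: abs_mult)
      moreover have "C * h\<^sup>2 \<le> C * h" using hh C by (intro mult_left_mono) auto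
      ultimately show ?thesis unfolding distrib_left[of h] mult.commute[of h C] by linarith
    qed
    have y: "\<bar>?y k\<bar> \<le> Q" if "k \<in> I" for k
    proof -
      have "h * (B + C) \<le> B + C" using h B C by (intro mult_left_le_one_le) auto
      moreover have "\<bar>x k\<bar> \<le> R" using x that by blast
      ultimately show ?thesis using yx[OF that] unfolding Q_def by linarith
    qed
    have xQ: "\<bar>x k\<bar> \<le> Q" if "k \<in> I" for k
      proof -
      have "\<bar>x k\<bar> \<le> R" using x that by blast
      then show ?thesis using B(1) C(1) unfolding Q_def by linarith
    qed
    have "\<bar>f ?y i - f x i\<bar> \<le> L * (\<Sum>k\<in>I. \<bar>?y k - x k\<bar>)"
      by (rule L(2)[rule_format, OF _ _ i, of ?y x]) (erule y, erule xQ)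
    also have "\<dots> \<le> L * (\<Sum>k\<in>I. h * (B + C))"
      using yx L by (intro mult_left_mono sum_mono) auto
    finally have "h * \<bar>f ?y i - f x i\<bar> \<le> h * (L * (\<Sum>k\<in>I. h * (B + C)))"
      using h by (intro mult_left_mono)
    also have "\<dots> = L * (card I * (B + C)) * h\<^sup>2" by (simp add: power2_eq_square algebra_simps)
    finally have "\<bar>h * f ?y i - h * f x i\<bar> \<le> L * (card I * (B + C)) * h\<^sup>2"
      using h by (simp add: abs_mult right_diff_distrib[symmetric])
    moreover have "\<bar>S h ?y i - ?y i - h * f ?y i\<bar> \<le> D * h\<^sup>2" using D(2)[rule_format, of h ?y i] h y i by blast
    moreover have "\<bar>?y i - x i - h * g x i\<bar> \<le> C * h\<^sup>2" using C(2)[rule_format, OF h _ i, of x] x by auto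
    ultimately show "\<bar>S h ?y i - x i - h * (f x i + g x i)\<bar> \<le> (C + D + L * (card I * (B + C))) * h\<^sup>2"
      unfolding distrib_right[of _ _ "h\<^sup>2"] distrib_left[of h] by linarith
  qed
qed

lemma splitting_sum:
  assumes "finite I" "finite A" "\<And>e. e \<in> A \<Longrightarrow> \<exists>S. splitting I (f e) S"
  shows "\<exists>S. splitting I (\<lambda>x n. \<Sum>e\<in>A. f e x n) S"
  using assms(2,3)
proof (induction A rule: finite_induct)
  case empty
  then show ?case using splitting_zero by auto
next
  case (insert e A)
  obtain S where "splitting I (f e) S" using insert.prems by blast
  moreover obtain T where "splitting I (\<lambda>x n. \<Sum>e\<in>A. f e x n) T"
    using insert.IH insert.prems by blast
  ultimately have *: "splitting I (f e) S" "splitting I (\<lambda>x n. \<Sum>e\<in>A. f e x n) T" .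
  from splitting_add[OF assms(1) *] insert.hyps show ?case by auto
qed

section \<open>Elementary rotations\<close>

definition rotation_field :: "int \<Rightarrow> int \<Rightarrow> int \<Rightarrow> real \<Rightarrow> real \<Rightarrow> (int \<Rightarrow> real) \<Rightarrow> int \<Rightarrow> real" where
  "rotation_field i j m a b x =
     (\<lambda>n. if n = i then (a + b * x m) * x j else if n = j then - (a + b * x m) * x i else 0)"

text \<open>The Cayley transform of the infinitesimal rotation: its angle is not the exact one, but the
  map stays orthogonal in the plane of i and j and is consistent to second order.\<close>

definition rotation_step :: "int \<Rightarrow> int \<Rightarrow> int \<Rightarrow> real \<Rightarrow> real \<Rightarrow> real \<Rightarrow> (int \<Rightarrow> real) \<Rightarrow> int \<Rightarrow> real" where
  "rotation_step i j m a b h x =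
     (let t = h * (a + b * x m) / 2; c = (1 - t\<^sup>2) / (1 + t\<^sup>2); s = 2 * t / (1 + t\<^sup>2)
      in x(i := c * x i + s * x j, j := - s * x i + c * x j))"

text \<open>With t the tangent of half the angle, these compare cosine with 1 and sine with 2t. The
  sine error is cubic for small t; it is weakened to a quadratic bound that holds for every t, since
  t is not bounded a priori.\<close>

lemma Cayley_bounds:
  fixes t :: real
  shows "\<bar>(1 - t\<^sup>2) / (1 + t\<^sup>2) - 1\<bar> \<le> 2 * t\<^sup>2" "\<bar>2 * t / (1 + t\<^sup>2) - 2 * t\<bar> \<le> 2 * t\<^sup>2"
proof -
  have p: "1 + t\<^sup>2 > 0" using zero_le_power2[of t] by linarith
  have "(1 - t\<^sup>2) / (1 + t\<^sup>2) - 1 = - (2 * t\<^sup>2 / (1 + t\<^sup>2))"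
    using p by (simp add: field_simps)
  moreover have "2 * t\<^sup>2 / (1 + t\<^sup>2) \<le> 2 * t\<^sup>2"
    using p by (simp add: divide_le_eq mult_left_le distrib_left)
  ultimately show "\<bar>(1 - t\<^sup>2) / (1 + t\<^sup>2) - 1\<bar> \<le> 2 * t\<^sup>2"
    using p by simp
  have "2 * t / (1 + t\<^sup>2) - 2 * t = - (2 * t / (1 + t\<^sup>2)) * t\<^sup>2"
    using p by (simp add: field_simps)
  then have "\<bar>2 * t / (1 + t\<^sup>2) - 2 * t\<bar> = \<bar>2 * t / (1 + t\<^sup>2)\<bar> * t\<^sup>2"
    by (simp add: abs_mult)
  also have "\<dots> \<le> 1 * t\<^sup>2"
  proof (intro mult_right_mono)
    have "2 * \<bar>t\<bar> \<le> 1 + t\<^sup>2"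
      using zero_le_power2[of "\<bar>t\<bar> - 1"] by (simp add: power2_eq_square algebra_simps abs_mult_self_eq)
    then show "\<bar>2 * t / (1 + t\<^sup>2)\<bar> \<le> 1" using p by (simp add: abs_mult)
  qed simp
  finally show "\<bar>2 * t / (1 + t\<^sup>2) - 2 * t\<bar> \<le> 2 * t\<^sup>2" using zero_le_power2[of t] by linarith
qed

text \<open>The rational parametrisation of the unit circle. Its one missing point is (-1, 0), the
  half turn that the factorisation into shears cannot reach.\<close>

lemma Cayley_rotation:
  fixes t :: real
  shows "((1 - t\<^sup>2) / (1 + t\<^sup>2))\<^sup>2 + (2 * t / (1 + t\<^sup>2))\<^sup>2 = 1" "- 1 < (1 - t\<^sup>2) / (1 + t\<^sup>2)"
proof -
  have p: "1 + t\<^sup>2 > 0" using zero_le_power2[of t] by linarith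
  have "(1 - t\<^sup>2)\<^sup>2 + (2 * t)\<^sup>2 = (1 + t\<^sup>2)\<^sup>2"
    by (simp add: power2_eq_square algebra_simps)
  then show "((1 - t\<^sup>2) / (1 + t\<^sup>2))\<^sup>2 + (2 * t / (1 + t\<^sup>2))\<^sup>2 = 1"
    unfolding power_divide add_divide_distrib[symmetric] using p by simp
  show "- 1 < (1 - t\<^sup>2) / (1 + t\<^sup>2)"
    using p by (simp add: less_divide_eq)
qed

text \<open>The parameter index \<open>m\<close> differs from \<open>i\<close> and \<open>j\<close>,
  so the angle is untouched by the step itself. Energy is conserved because the two components
  contribute opposite multiples of \<open>x i * x j\<close>.\<close>

lemma splitting_rotation:
  assumes I: "finite I" "i \<in> I" "j \<in> I" "m \<in> I" and ij: "i \<noteq> j" "m \<noteq> i" "m \<noteq> j"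
  shows "splitting I (rotation_field i j m a b) (rotation_step i j m a b)"
  unfolding splitting_def
proof (intro conjI allI)
  let ?f = "rotation_field i j m a b" and ?S = "rotation_step i j m a b"
  have one: "\<bar>x k\<bar> \<le> (\<Sum>k\<in>I. \<bar>x k\<bar>)" if "k \<in> I" for x :: "int \<Rightarrow> real" and k
    using I(1) that by (intro member_le_sum) auto
  have sq: "(x k)\<^sup>2 \<le> (\<Sum>k\<in>I. (x k)\<^sup>2)" if "k \<in> I" for x :: "int \<Rightarrow> real" and k
    using I(1) that by (intro member_le_sum) auto
  show "conservative_field I ?f"
  proof (rule conservative_fieldI)
    fix R
    \<comment> \<open>From the product rule for differences: the term with \<open>a\<close> counts
      once, and the product \<open>x m * x k\<close> leaves two terms, each with one factor bounded
      by |R|.\<close>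
    let ?L = "\<bar>a\<bar> + 2 * \<bar>b\<bar> * \<bar>R\<bar>"
    have *: "\<bar>(a + b * x m) * x k - (a + b * y m) * y k\<bar> \<le> ?L * (\<Sum>k\<in>I. \<bar>x k - y k\<bar>)"
      if xy: "\<forall>i\<in>I. \<bar>x i\<bar> \<le> R \<and> \<bar>y i\<bar> \<le> R" and k: "k \<in> I" for x y k
    proof -
      let ?D = "\<Sum>k\<in>I. \<bar>x k - y k\<bar>"
      have D: "\<bar>x k - y k\<bar> \<le> ?D" "\<bar>x m - y m\<bar> \<le> ?D"
        using one[of k "\<lambda>k. x k - y k"] one[of m "\<lambda>k. x k - y k"] k I by auto
      have "(a + b * x m) * x k - (a + b * y m) * y k
        = a * (x k - y k) + b * (x m * (x k - y k)) + b * ((x m - y m) * y k)"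
        by (simp add: algebra_simps)
      also have "\<bar>\<dots>\<bar> \<le> \<bar>a\<bar> * \<bar>x k - y k\<bar> + \<bar>b\<bar> * (\<bar>x m\<bar> * \<bar>x k - y k\<bar>) + \<bar>b\<bar> * (\<bar>x m - y m\<bar> * \<bar>y k\<bar>)"
      proof -
        have "\<bar>u + v + w\<bar> \<le> \<bar>u\<bar> + \<bar>v\<bar> + \<bar>w\<bar>" for u v w :: real by linarith
        then show ?thesis unfolding abs_mult[symmetric] .
      qed
      also have "\<dots> \<le> \<bar>a\<bar> * ?D + \<bar>b\<bar> * (\<bar>R\<bar> * ?D) + \<bar>b\<bar> * (?D * \<bar>R\<bar>)"
      proof -
        have "\<bar>x m\<bar> \<le> \<bar>R\<bar>" "\<bar>y k\<bar> \<le> \<bar>R\<bar>" using xy I(4) k by fastforce+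
        then show ?thesis using D by (intro add_mono mult_left_mono mult_mono) (auto intro: sum_nonneg)
      qed
      also have "\<dots> = ?L * ?D" by (simp add: algebra_simps)
      finally show ?thesis .
    qed
    show "\<exists>L\<ge>0. \<forall>x y. (\<forall>i\<in>I. \<bar>x i\<bar> \<le> R \<and> \<bar>y i\<bar> \<le> R) \<longrightarrow>
        (\<forall>i\<in>I. \<bar>?f x i - ?f y i\<bar> \<le> L * (\<Sum>k\<in>I. \<bar>x k - y k\<bar>))"
    proof (intro exI[of _ ?L] conjI allI impI ballI)
      fix x y n assume xy: "\<forall>i\<in>I. \<bar>x i\<bar> \<le> R \<and> \<bar>y i\<bar> \<le> R" and n: "n \<in> I"
      let ?D = "\<Sum>k\<in>I. \<bar>x k - y k\<bar>"
      consider "n = i" | "n = j" | "n \<noteq> i" "n \<noteq> j" by blast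
      then show "\<bar>?f x n - ?f y n\<bar> \<le> ?L * ?D"
      proof cases
        case 1
        then have "?f x n - ?f y n = (a + b * x m) * x j - (a + b * y m) * y j"
          by (simp add: rotation_field_def)
        then show ?thesis using *[OF xy I(3)] by (simp only:)
      next
        case 2
        then have "?f x n - ?f y n = - ((a + b * x m) * x i - (a + b * y m) * y i)"
          using ij by (simp add: rotation_field_def algebra_simps)
        then show ?thesis using *[OF xy I(2)] by (simp only: abs_minus_cancel)
      next
        case 3
        then have "?f x n - ?f y n = 0" by (simp add: rotation_field_def)
        moreover have "0 \<le> ?L * ?D" by (intro mult_nonneg_nonneg sum_nonneg) auto
        ultimately show ?thesis by (simp only: abs_zero)
      qed
    qed simp
  next
    \<comment> \<open>From |u| |v| \<le> u^2 + v^2, with u = 1 for the linear part. In the bilinear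
      part both squares are estimated by the full energy, hence the factor 2.\<close>
    let ?C = "\<bar>a\<bar> + 2 * \<bar>b\<bar>"
    have *: "\<bar>(a + b * x m) * x k\<bar> \<le> ?C * (1 + (\<Sum>k\<in>I. (x k)\<^sup>2))" if k: "k \<in> I" for x k
    proof -
      let ?Q = "\<Sum>k\<in>I. (x k)\<^sup>2"
      have ab: "\<bar>u\<bar> * \<bar>v\<bar> \<le> u\<^sup>2 + v\<^sup>2" for u v :: real
      proof -
          have "2 * \<bar>u\<bar> * \<bar>v\<bar> \<le> u\<^sup>2 + v\<^sup>2" using sum_squares_bound[of "\<bar>u\<bar>" "\<bar>v\<bar>"] by simp
          moreover have "0 \<le> \<bar>u\<bar> * \<bar>v\<bar>" by simp
          ultimately show ?thesis by linarith
        qed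
      have "\<bar>x k\<bar> \<le> 1 + ?Q" using ab[of 1 "x k"] sq[OF k, of x] by simp
      then have 1: "\<bar>a\<bar> * \<bar>x k\<bar> \<le> \<bar>a\<bar> * (1 + ?Q)" by (intro mult_left_mono) auto
      have "\<bar>x m\<bar> * \<bar>x k\<bar> \<le> 2 * (1 + ?Q)"
        using order_trans[OF ab add_mono[OF sq[OF I(4)] sq[OF k]], of x x] by simp
      then have 2: "\<bar>b\<bar> * (\<bar>x m\<bar> * \<bar>x k\<bar>) \<le> \<bar>b\<bar> * (2 * (1 + ?Q))" by (intro mult_left_mono) auto
      have "\<bar>(a + b * x m) * x k\<bar> \<le> \<bar>a\<bar> * \<bar>x k\<bar> + \<bar>b\<bar> * (\<bar>x m\<bar> * \<bar>x k\<bar>)"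
        unfolding abs_mult[symmetric] by (simp add: distrib_right mult.assoc)
      then show ?thesis using 1 2 by (simp add: distrib_right distrib_left)
    qed
    show "\<exists>C\<ge>0. \<forall>x. \<forall>i\<in>I. \<bar>?f x i\<bar> \<le> C * (1 + (\<Sum>k\<in>I. (x k)\<^sup>2))"
    proof (intro exI[of _ ?C] conjI allI ballI)
      fix x n
      have "0 \<le> ?C * (1 + (\<Sum>k\<in>I. (x k)\<^sup>2))" by (intro mult_nonneg_nonneg add_nonneg_nonneg sum_nonneg) auto
      moreover have "\<bar>- (a + b * x m) * x i\<bar> = \<bar>(a + b * x m) * x i\<bar>" by (simp only: abs_mult abs_minus_cancel)
      ultimately show "\<bar>?f x n\<bar> \<le> ?C * (1 + (\<Sum>k\<in>I. (x k)\<^sup>2))"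
        using *[OF I(2)] *[OF I(3)] by (auto simp: rotation_field_def)
    qed simp
  next
    fix x
    have "(\<Sum>n\<in>I. x n * ?f x n) = (\<Sum>n\<in>{i, j}. x n * ?f x n)"
      using I by (intro sum.mono_neutral_right) (auto simp: rotation_field_def)
    also have "\<dots> = 0" using ij by (simp add: rotation_field_def algebra_simps)
    finally show "(\<Sum>n\<in>I. x n * ?f x n) = 0" .
  qed
next
  fix h
  let ?t = "\<lambda>x. h * (a + b * x m) / 2"
  show "measure_preserving_seq (rotation_step i j m a b h)"
    unfolding rotation_step_def Let_def
  proof (rule measure_preserving_seq_rotation[OF ij(1)])
    fix x :: "int \<Rightarrow> real"
    show "((1 - (?t x)\<^sup>2) / (1 + (?t x)\<^sup>2))\<^sup>2 + (2 * ?t x / (1 + (?t x)\<^sup>2))\<^sup>2 = 1"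
      "- 1 < (1 - (?t x)\<^sup>2) / (1 + (?t x)\<^sup>2)"
      by (rule Cayley_rotation)+
  qed (use ij in auto)
next
  fix R
  \<comment> \<open>With t = h (a + b x_m) / 2 the cosine and sine errors cost 2 t^2 |R| each, and 4
    t^2 = h^2 (a + b x_m)^2.\<close>
  let ?C = "\<bar>R\<bar> * (\<bar>a\<bar> + \<bar>b\<bar> * \<bar>R\<bar>)\<^sup>2"
  let ?f = "rotation_field i j m a b" and ?S = "rotation_step i j m a b"
  show "\<exists>C\<ge>0. \<forall>h x. 0 \<le> h \<longrightarrow> h \<le> 1 \<longrightarrow> (\<forall>i\<in>I. \<bar>x i\<bar> \<le> R) \<longrightarrow>
        (\<forall>i\<in>I. \<bar>?S h x i - x i - h * ?f x i\<bar> \<le> C * h\<^sup>2)"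
  proof (intro exI[of _ ?C] conjI allI impI ballI)
    show "0 \<le> ?C" by simp
    fix h x n assume h: "0 \<le> h" "h \<le> (1::real)" and x: "\<forall>i\<in>I. \<bar>x i\<bar> \<le> R" and n: "n \<in> I"
    define t where "t = h * (a + b * x m) / 2"
    define c where "c = (1 - t\<^sup>2) / (1 + t\<^sup>2)"
    define s where "s = 2 * t / (1 + t\<^sup>2)"
    have xR: "\<bar>x k\<bar> \<le> \<bar>R\<bar>" if "k \<in> I" for k using x that by fastforce
    have "\<bar>a + b * x m\<bar> \<le> \<bar>a\<bar> + \<bar>b\<bar> * \<bar>x m\<bar>"
      by (metis abs_mult abs_triangle_ineq)
    also have "\<dots> \<le> \<bar>a\<bar> + \<bar>b\<bar> * \<bar>R\<bar>" using xR[OF I(4)] by (intro add_mono mult_left_mono) auto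
    finally have "(a + b * x m)\<^sup>2 \<le> (\<bar>a\<bar> + \<bar>b\<bar> * \<bar>R\<bar>)\<^sup>2" by (metis abs_ge_zero power2_abs power_mono)
    then have "h\<^sup>2 * (a + b * x m)\<^sup>2 * \<bar>R\<bar> \<le> h\<^sup>2 * (\<bar>a\<bar> + \<bar>b\<bar> * \<bar>R\<bar>)\<^sup>2 * \<bar>R\<bar>"
      by (intro mult_right_mono mult_left_mono) auto
    then have t: "4 * t\<^sup>2 * \<bar>R\<bar> \<le> ?C * h\<^sup>2"
    proof -
      have "4 * t\<^sup>2 = h\<^sup>2 * (a + b * x m)\<^sup>2"
        by (simp add: t_def power_mult_distrib power_divide)
      then show ?thesis using \<open>h\<^sup>2 * (a + b * x m)\<^sup>2 * \<bar>R\<bar> \<le> _\<close> by (simp add: mult_ac)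
    qed
    have c: "\<bar>c - 1\<bar> \<le> 2 * t\<^sup>2" and s: "\<bar>s - 2 * t\<bar> \<le> 2 * t\<^sup>2"
      unfolding c_def s_def by (rule Cayley_bounds)+
    have ineq: "\<bar>(c - 1) * u + (s - 2 * t) * v\<bar> \<le> ?C * h\<^sup>2" if "\<bar>u\<bar> \<le> \<bar>R\<bar>" "\<bar>v\<bar> \<le> \<bar>R\<bar>" for u v
    proof -
      have "\<bar>(c - 1) * u + (s - 2 * t) * v\<bar> \<le> \<bar>c - 1\<bar> * \<bar>u\<bar> + \<bar>s - 2 * t\<bar> * \<bar>v\<bar>"
        unfolding abs_mult[symmetric] by (rule abs_triangle_ineq)
      also have "\<dots> \<le> 2 * t\<^sup>2 * \<bar>R\<bar> + 2 * t\<^sup>2 * \<bar>R\<bar>"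
        using c s that by (intro add_mono mult_mono) auto
      finally show ?thesis using t by linarith
    qed
    have S: "?S h x = x(i := c * x i + s * x j, j := - s * x i + c * x j)"
      by (simp add: rotation_step_def Let_def c_def s_def t_def)
    have f: "h * ?f x i = 2 * t * x j" "h * ?f x j = - 2 * t * x i" "n \<noteq> i \<Longrightarrow> n \<noteq> j \<Longrightarrow> ?f x n = 0"
      using ij by (auto simp: rotation_field_def t_def algebra_simps)
    consider "n = i" | "n = j" | "n \<noteq> i" "n \<noteq> j" by blast
    then show "\<bar>?S h x n - x n - h * ?f x n\<bar> \<le> ?C * h\<^sup>2"
    proof cases
      case 1
      then have "?S h x n - x n - h * ?f x n = (c - 1) * x i + (s - 2 * t) * x j"
        using ij f unfolding S by (simp add: algebra_simps)
      then show ?thesis using ineq[OF xR[OF I(2)] xR[OF I(3)]] by (simp only:)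
    next
      case 2
      then have "?S h x n - x n - h * ?f x n = (c - 1) * x j + (s - 2 * t) * (- x i)"
        using ij f unfolding S by (simp add: algebra_simps)
      then show ?thesis using ineq[of "x j" "- x i"] xR[OF I(2)] xR[OF I(3)] by (simp only: abs_minus_cancel)
    next
      case 3
      then show ?thesis using f unfolding S by simp
    qed
  qed
qed

section \<open>Change of axes by 45 degrees\<close>

text \<open>A reflection rather than a rotation: for distinct \<open>i\<close> and \<open>j\<close>
  it is symmetric and its own inverse, so conjugation uses the same map on both sides.\<close>

definition diagonal_reflection :: "int \<Rightarrow> int \<Rightarrow> (int \<Rightarrow> real) \<Rightarrow> int \<Rightarrow> real" where
  "diagonal_reflection i j x = x(i := (x i + x j) / sqrt 2, j := (x i - x j) / sqrt 2)"

text \<open>The determinant is -1, so the map is written as a rotation by 45 degrees followed by a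
  sign change of coordinate \<open>j\<close>.\<close>

lemma measure_preserving_diagonal_reflection:
  assumes "i \<noteq> j"
  shows "measure_preserving_seq (diagonal_reflection i j)"
proof -
  have rot: "measure_preserving_seq (\<lambda>x. x(i := 1 / sqrt 2 * x i + 1 / sqrt 2 * x j, j := - (1 / sqrt 2) * x i + 1 / sqrt 2 * x j))"
  proof (rule measure_preserving_seq_rotation[OF assms])
    have "(0::real) < 1 / sqrt 2" by simp
    then show "- 1 < 1 / sqrt 2" by linarith
  qed (auto simp: power_divide)
  have "diagonal_reflection i j = (\<lambda>x. (\<lambda>x. x(j := - x j)) ((\<lambda>x. x(i := 1 / sqrt 2 * x i + 1 / sqrt 2 * x j, j := - (1 / sqrt 2) * x i + 1 / sqrt 2 * x j)) x))"
    using assms by (auto simp: diagonal_reflection_def fun_eq_iff add_divide_distrib diff_divide_distrib)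
  then show ?thesis
    using measure_preserving_seq_comp[OF measure_preserving_seq_uminus[of j] rot] by (simp only:)
qed

text \<open>Orthogonal changes of coordinates keep every clause: they are linear, bounded, energy
  preserving and measure preserving. Linearity passes the local error through the outer
  reflection.\<close>

lemma splitting_conj:
  assumes I: "finite I" "i \<in> I" "j \<in> I" and ij: "i \<noteq> j" and f: "splitting I f S"
  shows "splitting I (\<lambda>x. diagonal_reflection i j (f (diagonal_reflection i j x))) (\<lambda>h x. diagonal_reflection i j (S h (diagonal_reflection i j x)))"
    (is "splitting I ?g ?T")
  unfolding splitting_def
proof (intro conjI allI)
  let ?r = "diagonal_reflection i j"
  note ff = splitting_field[OF f]
  have r2: "?r (?r x) k = x k" for x k
    using ij by (auto simp: diagonal_reflection_def field_simps)
  have s2: "(1::real) \<le> sqrt 2" "(2::real) / sqrt 2 \<le> 2" by (auto simp: divide_le_eq)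
  \<comment> \<open>The crude factor 2 dominates the true factor \<open>sqrt 2\<close>; it is the
    only cost of a reflection in all the sup-norm bounds below.\<close>
  have rb: "\<bar>?r x k\<bar> \<le> 2 * B" if "\<And>k. k \<in> I \<Longrightarrow> \<bar>x k\<bar> \<le> B" "k \<in> I" for x B k
  proof -
    have B: "\<bar>x i\<bar> \<le> B" "\<bar>x j\<bar> \<le> B" "\<bar>x k\<bar> \<le> B" using that I by auto
    then have "B \<ge> 0" by linarith
    have "\<bar>u\<bar> / sqrt 2 \<le> 2 * B" if "\<bar>u\<bar> \<le> 2 * B" for u
    proof -
      have "\<bar>u\<bar> / sqrt 2 \<le> \<bar>u\<bar> / 1" using s2(1) by (intro divide_left_mono) auto
      then show ?thesis using that by simp
    qed
    from this[of "x i + x j"] this[of "x i - x j"] show ?thesis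
      using B \<open>B \<ge> 0\<close> by (auto simp: diagonal_reflection_def)
  qed
  have rl: "?r (\<lambda>k. x k - y k) k = ?r x k - ?r y k" for x y k
    by (auto simp: diagonal_reflection_def field_simps)
  have rm: "?r (\<lambda>k. h * x k) k = h * ?r x k" for h x k
    by (auto simp: diagonal_reflection_def field_simps)
  \<comment> \<open>The reflection is self-adjoint. Together with \<open>r2\<close> this makes it an
    isometry, and it moves the reflection in x . r f(r x) over to the first factor.\<close>
  have self: "(\<Sum>k\<in>I. ?r x k * y k) = (\<Sum>k\<in>I. x k * ?r y k)" for x y
  proof -
    have spl: "sum F I = F i + F j + sum F (I - {i, j})" for F :: "int \<Rightarrow> real"
    proof -
      have "sum F I = F i + sum F (I - {i})" using I by (simp add: sum.remove)
      also have "sum F (I - {i}) = F j + sum F (I - {i} - {j})" using I ij by (intro sum.remove) auto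
      also have "I - {i} - {j} = I - {i, j}" by auto
      finally show ?thesis by simp
    qed
    have "(\<Sum>k\<in>I - {i, j}. ?r x k * y k) = (\<Sum>k\<in>I - {i, j}. x k * ?r y k)"
      by (intro sum.cong) (auto simp: diagonal_reflection_def)
    moreover have "?r x i * y i + ?r x j * y j = x i * ?r y i + x j * ?r y j"
      using ij by (simp add: diagonal_reflection_def add_divide_distrib[symmetric]) (simp add: algebra_simps)
    ultimately show ?thesis by (simp add: spl)
  qed
  show "conservative_field I ?g"
  proof (rule conservative_fieldI)
    fix R
    obtain L where L: "L \<ge> 0" "\<forall>x y. (\<forall>i\<in>I. \<bar>x i\<bar> \<le> 2 * R) \<longrightarrow> (\<forall>i\<in>I. \<bar>y i\<bar> \<le> 2 * R) \<longrightarrow> (\<forall>i\<in>I.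
      \<bar>f x i - f y i\<bar> \<le> L * (\<Sum>k\<in>I. \<bar>x k - y k\<bar>))"
      using conservative_field_Lipschitz[OF ff, of "2 * R"] by blast
    show "\<exists>L\<ge>0. \<forall>x y. (\<forall>i\<in>I. \<bar>x i\<bar> \<le> R \<and> \<bar>y i\<bar> \<le> R) \<longrightarrow>
        (\<forall>i\<in>I. \<bar>?g x i - ?g y i\<bar> \<le> L * (\<Sum>k\<in>I. \<bar>x k - y k\<bar>))"
    proof (intro exI[of _ "2 * (L * (card I * 2))"] conjI allI impI ballI)
      fix x y n assume xy: "\<forall>i\<in>I. \<bar>x i\<bar> \<le> R \<and> \<bar>y i\<bar> \<le> R" and n: "n \<in> I"
      let ?D = "\<Sum>k\<in>I. \<bar>x k - y k\<bar>"
      have D: "\<bar>x k - y k\<bar> \<le> ?D" if "k \<in> I" for k using I(1) that by (intro member_le_sum) auto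
      have rD: "\<bar>?r x k - ?r y k\<bar> \<le> 2 * ?D" if "k \<in> I" for k
        using rb[of "\<lambda>k. x k - y k" ?D k] D that by (simp add: rl)
      have fD: "\<bar>f (?r x) k - f (?r y) k\<bar> \<le> L * (card I * 2) * ?D" if k: "k \<in> I" for k
      proof -
        have "\<bar>f (?r x) k - f (?r y) k\<bar> \<le> L * (\<Sum>k\<in>I. \<bar>?r x k - ?r y k\<bar>)"
          using xy by (intro L(2)[rule_format] rb k) auto
        also have "\<dots> \<le> L * (\<Sum>k\<in>I. 2 * ?D)"
          using L(1) rD by (intro mult_left_mono sum_mono) auto
        finally show ?thesis by (simp add: algebra_simps)
      qed
      show "\<bar>?g x n - ?g y n\<bar> \<le> 2 * (L * (card I * 2)) * ?D"
        using rb[of "\<lambda>k. f (?r x) k - f (?r y) k" "L * (card I * 2) * ?D" n] fD n by (simp add: rl)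
    qed (use L in auto)
  next
    obtain C where C: "C \<ge> 0" "\<forall>x. (\<forall>i\<in>I. \<bar>f x i\<bar> \<le> C * (1 + (\<Sum>k\<in>I. (x k)\<^sup>2)))"
      using conservative_field_growth[OF ff] by blast
    show "\<exists>C\<ge>0. \<forall>x. \<forall>i\<in>I. \<bar>?g x i\<bar> \<le> C * (1 + (\<Sum>k\<in>I. (x k)\<^sup>2))"
    proof (intro exI[of _ "2 * C"] conjI allI ballI)
      fix x n assume n: "n \<in> I"
      have "(\<Sum>k\<in>I. (?r x k)\<^sup>2) = (\<Sum>k\<in>I. (x k)\<^sup>2)"
        using self[of x "?r x"] by (simp add: r2 power2_eq_square)
      then have "\<bar>f (?r x) k\<bar> \<le> C * (1 + (\<Sum>k\<in>I. (x k)\<^sup>2))" if "k \<in> I" for k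
        using C(2)[rule_format, OF that, of "?r x"] by simp
      from rb[of "f (?r x)", OF this n] show "\<bar>?g x n\<bar> \<le> 2 * C * (1 + (\<Sum>k\<in>I. (x k)\<^sup>2))" by simp
    qed (use C in auto)
  next
    show "(\<Sum>k\<in>I. x k * ?g x k) = 0" for x
      using conservative_field_energy[OF ff, of "?r x"] by (simp add: self[symmetric])
  qed
  show "measure_preserving_seq (?T h)" for h
    by (rule measure_preserving_seq_comp[OF measure_preserving_diagonal_reflection[OF ij]
          measure_preserving_seq_comp[OF splitting_measure_preserving[OF f] measure_preserving_diagonal_reflection[OF ij]]])
  fix R
  obtain C where C: "C \<ge> 0" "\<forall>h x. 0 \<le> h \<longrightarrow> h \<le> 1 \<longrightarrow> (\<forall>i\<in>I. \<bar>x i\<bar> \<le> 2 * R) \<longrightarrow> (\<forall>i\<in>I.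
    \<bar>S h x i - x i - h * f x i\<bar> \<le> C * h\<^sup>2)"
    using splitting_consistent[OF f, of "2 * R"] by blast
  show "\<exists>C\<ge>0. \<forall>h x. 0 \<le> h \<longrightarrow> h \<le> 1 \<longrightarrow> (\<forall>i\<in>I. \<bar>x i\<bar> \<le> R) \<longrightarrow>
        (\<forall>i\<in>I. \<bar>?T h x i - x i - h * ?g x i\<bar> \<le> C * h\<^sup>2)"
  proof (intro exI[of _ "2 * C"] conjI allI impI ballI)
    fix h x n assume h: "0 \<le> h" "h \<le> (1::real)" and x: "\<forall>i\<in>I. \<bar>x i\<bar> \<le> R" and n: "n \<in> I"
    have "\<bar>S h (?r x) k - ?r x k - h * f (?r x) k\<bar> \<le> C * h\<^sup>2" if "k \<in> I" for k
      using x by (intro C(2)[rule_format] h rb that) auto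
    from rb[of "\<lambda>k. S h (?r x) k - ?r x k - h * f (?r x) k", OF this n] show "\<bar>?T h x n - x n - h * ?g x n\<bar> \<le> 2 * C * h\<^sup>2"
      by (simp add: rl rm r2)
  qed (use C in auto)
qed

section \<open>Convergence of the splitting scheme\<close>

text \<open>The increments \<open>d\<close> are plain data here: the same recursion serves the
  pathwise convergence, with \<open>d\<close> read off one path, and the computation of the law,
  with \<open>d\<close> random.\<close>

primrec split_scheme ::
  "(real \<Rightarrow> (int \<Rightarrow> real) \<Rightarrow> int \<Rightarrow> real) \<Rightarrow> real \<Rightarrow> (int \<Rightarrow> real) \<Rightarrow> (nat \<Rightarrow> int \<Rightarrow> real) \<Rightarrow> nat \<Rightarrow> int \<Rightarrow> real" where
  "split_scheme S h x d 0 = x"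
| "split_scheme S h x d (Suc j) = (\<lambda>n. S h (split_scheme S h x d j) n + d j n)"

lemma paths_bounded:
  fixes x :: "real \<Rightarrow> int \<Rightarrow> real"
  assumes I: "finite I" and x: "\<And>i. i \<in> I \<Longrightarrow> continuous_on {a..b} (\<lambda>t. x t i)"
  obtains R where "R \<ge> 0" "\<forall>t\<in>{a..b}. \<forall>i\<in>I. \<bar>x t i\<bar> \<le> R"
proof -
  have "\<exists>B. \<forall>t\<in>{a..b}. \<bar>x t k\<bar> \<le> B" if "k \<in> I" for k
  proof -
    have "compact ((\<lambda>t. x t k) ` {a..b})" using x[OF that] compact_Icc by (rule compact_continuous_image)
    then show ?thesis using compact_imp_bounded bounded_iff by (metis (no_types, lifting) image_eqI real_norm_def)
  qed
  then obtain B where B: "\<And>k t. k \<in> I \<Longrightarrow> t \<in> {a..b} \<Longrightarrow> \<bar>x t k\<bar> \<le> B k" by metis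
  show thesis
  proof
    show "(\<Sum>k\<in>I. \<bar>B k\<bar>) \<ge> 0" by (simp add: sum_nonneg)
    show "\<forall>t\<in>{a..b}. \<forall>i\<in>I. \<bar>x t i\<bar> \<le> (\<Sum>k\<in>I. \<bar>B k\<bar>)"
    proof (intro ballI)
      fix t k assume t: "t \<in> {a..b}" and k: "k \<in> I"
      have "\<bar>B k\<bar> \<le> (\<Sum>k\<in>I. \<bar>B k\<bar>)" using I k by (intro member_le_sum) auto
      then show "\<bar>x t k\<bar> \<le> (\<Sum>k\<in>I. \<bar>B k\<bar>)" using B[OF k t] by linarith
    qed
  qed
qed

lemma field_continuous_on:
  fixes x :: "real \<Rightarrow> int \<Rightarrow> real"
  assumes f: "conservative_field I f" and I: "finite I"
    and x: "\<And>i. i \<in> I \<Longrightarrow> continuous_on {a..b} (\<lambda>t. x t i)" and i: "i \<in> I"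
  shows "continuous_on {a..b} (\<lambda>t. f (x t) i)"
proof -
  obtain R where R: "R \<ge> 0" "\<forall>t\<in>{a..b}. \<forall>i\<in>I. \<bar>x t i\<bar> \<le> R"
    using paths_bounded[OF I x] .
  obtain L where L: "L \<ge> 0" "\<forall>x y. (\<forall>i\<in>I. \<bar>x i\<bar> \<le> R) \<longrightarrow> (\<forall>i\<in>I. \<bar>y i\<bar> \<le> R) \<longrightarrow>
    (\<forall>i\<in>I. \<bar>f x i - f y i\<bar> \<le> L * (\<Sum>k\<in>I. \<bar>x k - y k\<bar>))"
    using conservative_field_Lipschitz[OF f, of R] by blast
  show ?thesis
    unfolding continuous_on_def
  proof
    fix t assume t: "t \<in> {a..b}"
    have "((\<lambda>s. L * (\<Sum>k\<in>I. \<bar>x s k - x t k\<bar>)) \<longlongrightarrow> L * (\<Sum>k\<in>I. \<bar>x t k - x t k\<bar>)) (at t within {a..b})"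
      using x t by (intro tendsto_intros) (auto simp: continuous_on_def)
    then have lim: "((\<lambda>s. L * (\<Sum>k\<in>I. \<bar>x s k - x t k\<bar>)) \<longlongrightarrow> 0) (at t within {a..b})" by simp
    have ev: "\<forall>\<^sub>F s in at t within {a..b}. norm (f (x s) i - f (x t) i) \<le> L * (\<Sum>k\<in>I. \<bar>x s k - x t k\<bar>)"
      using L(2) R t i by (auto simp: eventually_at_filter)
    have "((\<lambda>s. f (x s) i - f (x t) i) \<longlongrightarrow> 0) (at t within {a..b})"
      by (rule Lim_null_comparison[OF ev lim])
    then show "((\<lambda>s. f (x s) i) \<longlongrightarrow> f (x t) i) (at t within {a..b})"
      by (simp add: LIM_zero_iff)
  qed
qed

text \<open>Coordinates outside \<open>I\<close> are left arbitrary; for conservative fields on a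
  finite \<open>I\<close> they do not influence the equation on \<open>I\<close>.\<close>

definition drift_solution ::
  "int set \<Rightarrow> ((int \<Rightarrow> real) \<Rightarrow> int \<Rightarrow> real) \<Rightarrow> (real \<Rightarrow> int \<Rightarrow> real) \<Rightarrow> real \<Rightarrow> real \<Rightarrow> (int \<Rightarrow> real) \<Rightarrow> (real \<Rightarrow> int \<Rightarrow> real) \<Rightarrow> bool" where
  "drift_solution I f w a b x0 x \<longleftrightarrow> (\<forall>i\<in>I. continuous_on {a..b} (\<lambda>t. x t i)) \<and>
     (\<forall>i\<in>I. \<forall>t\<in>{a..b}. x t i = x0 i + integral {a..t} (\<lambda>r. f (x r) i) + (w t i - w a i))"

text \<open>Nothing is assumed about uniqueness of the solution: convergence of the scheme to every
  solution proves it.\<close>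

lemma split_scheme_error:
  assumes I: "finite I" and S: "splitting I f S" and ab: "a \<le> b"
    and x: "drift_solution I f w a b x0 x" and \<eta>: "\<eta> > 0"
  shows "\<exists>m0. \<forall>m\<ge>m0. \<forall>i\<in>I. \<bar>split_scheme S ((b - a) / m) x0
      (\<lambda>j n. w (a + Suc j * ((b - a) / m)) n - w (a + j * ((b - a) / m)) n) m i - x b i\<bar> \<le> \<eta>"
proof -
  note f = splitting_field[OF S]
  have xc: "\<And>i. i \<in> I \<Longrightarrow> continuous_on {a..b} (\<lambda>t. x t i)"
    and xe: "\<And>i t. i \<in> I \<Longrightarrow> t \<in> {a..b} \<Longrightarrow> x t i = x0 i + integral {a..t} (\<lambda>r. f (x r) i) + (w t i - w a i)"
    using x unfolding drift_solution_def by auto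
  obtain R0 where R0: "R0 \<ge> 0" "\<forall>t\<in>{a..b}. \<forall>i\<in>I. \<bar>x t i\<bar> \<le> R0"
    using paths_bounded[OF I xc] .
  \<comment> \<open>One unit of room around the exact path: the scheme stays in this ball as long as
    its error is at most 1.\<close>
  define R where "R = R0 + 1"
  obtain L where L: "L \<ge> 0" "\<forall>x y. (\<forall>i\<in>I. \<bar>x i\<bar> \<le> R) \<longrightarrow> (\<forall>i\<in>I. \<bar>y i\<bar> \<le> R) \<longrightarrow>
    (\<forall>i\<in>I. \<bar>f x i - f y i\<bar> \<le> L * (\<Sum>k\<in>I. \<bar>x k - y k\<bar>))"
    using conservative_field_Lipschitz[OF f, of R] by blast
  obtain C where C: "C \<ge> 0" "\<forall>h x. 0 \<le> h \<longrightarrow> h \<le> 1 \<longrightarrow> (\<forall>i\<in>I. \<bar>x i\<bar> \<le> R) \<longrightarrow>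
     (\<forall>i\<in>I. \<bar>S h x i - x i - h * f x i\<bar> \<le> C * h\<^sup>2)"
    using splitting_consistent[OF S, of R] by blast
  define T where "T = b - a"
  have T: "T \<ge> 0" using ab by (simp add: T_def)
  define n where "n = real (card I)"
  define K where "K = n * L"
  have n: "n \<ge> 0" and K: "K \<ge> 0" using L by (auto simp: n_def K_def)
  \<comment> \<open>The cap at 1 makes the target accuracy small enough to keep the scheme inside
    the ball of radius \<open>R\<close>.\<close>
  define e0 where "e0 = min \<eta> 1"
  \<comment> \<open>The Gronwall factor of the final estimate. Adding 1 to \<open>T\<close> and to
    \<open>n\<close> keeps it positive for a degenerate interval or an empty
    \<open>I\<close>.\<close>
  define M where "M = exp (K * T) * (T + 1) * (n + 1)"
  have M: "M > 0" using T n by (simp add: M_def)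
  define \<epsilon> where "\<epsilon> = e0 / (2 * M)"
  have e0: "e0 > 0" "e0 \<le> 1" "e0 \<le> \<eta>" using \<eta> by (auto simp: e0_def)
  have \<epsilon>: "\<epsilon> > 0" using e0 M by (simp add: \<epsilon>_def)
  have fc: "continuous_on {a..b} (\<lambda>t. f (x t) i)" if "i \<in> I" for i
    using field_continuous_on[OF f I xc that] .
  have "\<exists>\<delta>>0. \<forall>s\<in>{a..b}. \<forall>t\<in>{a..b}. \<bar>t - s\<bar> < \<delta> \<longrightarrow> \<bar>f (x t) i - f (x s) i\<bar> < \<epsilon>" if "i \<in> I" for i
  proof -
    have "uniformly_continuous_on {a..b} (\<lambda>t. f (x t) i)"
      using fc[OF that] by (intro compact_uniformly_continuous) auto
    then show ?thesis using \<epsilon> unfolding uniformly_continuous_on_def dist_real_def by blast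
  qed
  then obtain \<delta> where \<delta>: "\<And>i. i \<in> I \<Longrightarrow> \<delta> i > 0"
    "\<And>i s t. i \<in> I \<Longrightarrow> s \<in> {a..b} \<Longrightarrow> t \<in> {a..b} \<Longrightarrow> \<bar>t - s\<bar> < \<delta> i \<Longrightarrow> \<bar>f (x t) i - f (x s) i\<bar> < \<epsilon>"
    by metis
  \<comment> \<open>The step must be at most 1 for the consistency bound, make C h^2 \<le> h
    \<epsilon> (with C + 1 as a safe denominator), and stay below the moduli of continuity
    \<open>\<delta>\<close> of the field along the exact path.\<close>
  define h0 where "h0 = Min (insert 1 (insert (\<epsilon> / (C + 1)) (\<delta> ` I)))"
  have h0: "h0 > 0" "h0 \<le> 1" "h0 \<le> \<epsilon> / (C + 1)" "\<And>i. i \<in> I \<Longrightarrow> h0 \<le> \<delta> i"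
    using I \<delta>(1) \<epsilon> C(1) unfolding h0_def by (auto intro: Min_le simp del: Min_insert)
  obtain m0 :: nat where m0: "m0 > T / h0" using reals_Archimedean2 by blast
  show ?thesis
  proof (intro exI[of _ "Suc m0"] allI impI ballI)
    fix m i assume m: "m \<ge> Suc m0" and i: "i \<in> I"
    define h where "h = T / m"
    have mpos: "real m > 0" using m by simp
    have hm: "h * m = T" using mpos by (simp add: h_def)
    have h: "h \<ge> 0" "h < h0"
    proof -
      show "h \<ge> 0" using T by (simp add: h_def)
      have "T < h0 * m0" using m0 h0(1) by (simp add: divide_less_eq mult.commute)
      also have "\<dots> \<le> h0 * m" using m h0(1) by (intro mult_left_mono) auto
      finally show "h < h0" using mpos by (simp add: h_def divide_less_eq mult.commute)
    qed
    define \<tau> where "\<tau> j = a + real j * h" for j :: nat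
    have \<tau>: "\<tau> j \<in> {a..b}" if "j \<le> m" for j
    proof -
      have "real j * h \<le> real m * h" using that h by (intro mult_right_mono) auto
      then show ?thesis using hm h by (auto simp: \<tau>_def T_def mult.commute)
    qed
    have \<tau>Suc: "\<tau> (Suc j) = \<tau> j + h" for j by (simp add: \<tau>_def algebra_simps)
    have \<tau>0: "\<tau> 0 = a" and \<tau>m: "\<tau> m = b" using hm by (auto simp: \<tau>_def T_def mult.commute)
    let ?y = "split_scheme S h x0 (\<lambda>j n. w (\<tau> (Suc j)) n - w (\<tau> j) n)"
    define E where "E j = (\<Sum>i\<in>I. \<bar>?y j i - x (\<tau> j) i\<bar>)" for j
    \<comment> \<open>The solution and the scheme receive the same noise increments, so these
      cancel; what remains is the error of freezing the field at the left endpoint.\<close>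
    have incr: "\<bar>x (\<tau> (Suc j)) i - x (\<tau> j) i - h * f (x (\<tau> j)) i - (w (\<tau> (Suc j)) i - w (\<tau> j) i)\<bar> \<le> h * \<epsilon>"
      if j: "Suc j \<le> m" and i: "i \<in> I" for j i
    proof -
      let ?s = "\<tau> j" and ?t = "\<tau> (Suc j)"
      have st: "?s \<in> {a..b}" "?t \<in> {a..b}" "?s \<le> ?t" using \<tau>[of j] \<tau>[OF j] j h by (auto simp: \<tau>Suc)
      have int: "(\<lambda>r. f (x r) i) integrable_on {c..d}" if "a \<le> c" "d \<le> b" for c d
        using fc[OF i] that by (intro integrable_continuous_real) (auto elim: continuous_on_subset)
      have "integral {a..?s} (\<lambda>r. f (x r) i) + integral {?s..?t} (\<lambda>r. f (x r) i) = integral {a..?t} (\<lambda>r. f (x r) i)"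
        using st by (intro Henstock_Kurzweil_Integration.integral_combine int) auto
      then have "x ?t i - x ?s i - (w ?t i - w ?s i) = integral {?s..?t} (\<lambda>r. f (x r) i)"
        using xe[OF i st(1)] xe[OF i st(2)] by simp
      also have "\<dots> - h * f (x ?s) i = integral {?s..?t} (\<lambda>r. f (x r) i - f (x ?s) i)"
        using int[of ?s ?t] st by (subst Henstock_Kurzweil_Integration.integral_diff) (auto simp: \<tau>Suc h)
      finally have eq: "x ?t i - x ?s i - h * f (x ?s) i - (w ?t i - w ?s i) = integral {?s..?t} (\<lambda>r. f (x r) i - f (x ?s) i)"
        by simp
      have "norm (integral {?s..?t} (\<lambda>r. f (x r) i - f (x ?s) i)) \<le> \<epsilon> * (?t - ?s)"
      proof (rule integral_bound)
        show "continuous_on {?s..?t} (\<lambda>r. f (x r) i - f (x ?s) i)"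
          using fc[OF i] st by (intro continuous_intros) (auto elim: continuous_on_subset)
        fix r assume r: "r \<in> {?s..?t}"
        then have "\<bar>r - ?s\<bar> < \<delta> i" using h h0(4)[OF i] by (auto simp: \<tau>Suc)
        then show "norm (f (x r) i - f (x ?s) i) \<le> \<epsilon>"
          using \<delta>(2)[OF i st(1), of r] r st by auto
      qed (use st in auto)
      then show ?thesis unfolding eq by (simp add: \<tau>Suc mult.commute)
    qed
    have E0: "E 0 = 0" using xe[of _ a] ab by (simp add: E_def \<tau>0)
    \<comment> \<open>Discrete Gronwall, combined with confinement: the bound for step
      \<open>j\<close> is at most \<open>e0\<close> \<le> 1, so the scheme has not left the ball and
      the local Lipschitz and consistency constants are valid for the next step.\<close>
    have main: "E j \<le> exp (K * (j * h)) * (j * h) * (n * (2 * \<epsilon>))" if "j \<le> m" for j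
      using that
    proof (induction j)
      case 0
      then show ?case by (simp add: E0)
    next
      case (Suc j)
      let ?B = "exp (K * (j * h)) * (j * h) * (n * (2 * \<epsilon>))"
      have IH: "E j \<le> ?B" using Suc by simp
      have "j * h \<le> m * h" using Suc.prems h by (intro mult_right_mono) auto
      then have jh: "j * h \<le> T" "0 \<le> j * h" using hm h by (auto simp: mult.commute)
      have "?B \<le> exp (K * T) * (T + 1) * ((n + 1) * (2 * \<epsilon>))"
        using jh K n \<epsilon> T by (intro mult_mono) (auto intro: mult_left_mono)
      also have "\<dots> = 2 * (M * \<epsilon>)" by (simp add: M_def)
      also have "\<dots> = e0" using M by (simp add: \<epsilon>_def)
      finally have E1: "E j \<le> 1" using IH e0 by linarith
      have xR: "\<forall>i\<in>I. \<bar>x (\<tau> j) i\<bar> \<le> R" using R0 \<tau>[of j] Suc.prems by (auto simp: R_def intro: add_increasing2)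
      have yR: "\<forall>i\<in>I. \<bar>?y j i\<bar> \<le> R"
      proof
        fix i assume i: "i \<in> I"
        have "\<bar>?y j i - x (\<tau> j) i\<bar> \<le> E j" unfolding E_def using I i by (intro member_le_sum) auto
        moreover have "\<bar>x (\<tau> j) i\<bar> \<le> R0" using R0 i \<tau>[of j] Suc.prems by auto
        ultimately show "\<bar>?y j i\<bar> \<le> R" using E1 unfolding R_def by linarith
      qed
      have bnd: "\<bar>?y (Suc j) i - x (\<tau> (Suc j)) i\<bar> \<le> \<bar>?y j i - x (\<tau> j) i\<bar> + h * (L * E j) + h * (2 * \<epsilon>)"
        if i: "i \<in> I" for i
      proof -
        have 1: "\<bar>S h (?y j) i - ?y j i - h * f (?y j) i\<bar> \<le> C * h\<^sup>2"
          using C(2) h h0(2) yR i by auto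
        have "C * h\<^sup>2 = h * (C * h)" by (simp add: power2_eq_square)
        also have "\<dots> \<le> h * \<epsilon>"
        proof (intro mult_left_mono)
          have "C * h \<le> (C + 1) * (\<epsilon> / (C + 1))"
            using C(1) h h0(3) by (intro mult_mono) auto
          then show "C * h \<le> \<epsilon>" using C(1) by simp
        qed (use h in auto)
        finally have 2: "C * h\<^sup>2 \<le> h * \<epsilon>" .
        have "\<bar>f (?y j) i - f (x (\<tau> j)) i\<bar> \<le> L * E j"
          using L(2) xR yR i unfolding E_def by blast
        then have 3: "\<bar>h * f (?y j) i - h * f (x (\<tau> j)) i\<bar> \<le> h * (L * E j)"
          using h by (simp add: right_diff_distrib[symmetric] abs_mult mult_left_mono)
        show ?thesis
          using 1 2 3 incr[OF Suc.prems i] by simp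
      qed
      have "E (Suc j) \<le> (\<Sum>i\<in>I. \<bar>?y j i - x (\<tau> j) i\<bar> + h * (L * E j) + h * (2 * \<epsilon>))"
        unfolding E_def[of "Suc j"] by (intro sum_mono bnd)
      also have "\<dots> = (1 + K * h) * E j + h * (n * (2 * \<epsilon>))"
        by (simp add: sum.distrib E_def[symmetric] K_def n_def algebra_simps)
      also have "\<dots> \<le> (1 + K * h) * ?B + h * (n * (2 * \<epsilon>))"
        using IH K h n \<epsilon> by (intro add_mono mult_left_mono) auto
      also have "\<dots> \<le> exp (K * h) * ?B + exp (K * (Suc j * h)) * (h * (n * (2 * \<epsilon>)))"
      proof (intro add_mono mult_right_mono)
        show "1 + K * h \<le> exp (K * h)" by (rule exp_ge_add_one_self)
        show "0 \<le> ?B" using jh n \<epsilon> by simp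
        have "1 \<le> exp (K * (Suc j * h))" using K h by simp
        then show "h * (n * (2 * \<epsilon>)) \<le> exp (K * (Suc j * h)) * (h * (n * (2 * \<epsilon>)))"
          using h n \<epsilon> mult_right_mono[of 1 "exp (K * (Suc j * h))" "h * (n * (2 * \<epsilon>))"] by simp
      qed
      also have "\<dots> = exp (K * (Suc j * h)) * (Suc j * h) * (n * (2 * \<epsilon>))"
      proof -
        have "exp (K * h) * exp (K * (j * h)) = exp (K * (Suc j * h))"
          by (simp add: exp_add[symmetric] algebra_simps)
        then have "exp (K * h) * ?B = exp (K * (Suc j * h)) * ((j * h) * (n * (2 * \<epsilon>)))"
          by (metis mult.assoc)
        then show ?thesis by (simp add: algebra_simps)
      qed
      finally show ?case .
    qed
    have "\<bar>?y m i - x b i\<bar> \<le> E m" unfolding E_def \<tau>m using I i by (intro member_le_sum) auto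
    also have "\<dots> \<le> exp (K * T) * T * (n * (2 * \<epsilon>))" using main[of m] hm by (simp add: mult.commute)
    also have "\<dots> \<le> exp (K * T) * (T + 1) * ((n + 1) * (2 * \<epsilon>))"
      using n \<epsilon> T by (intro mult_mono) auto
    also have "\<dots> = 2 * (M * \<epsilon>)" by (simp add: M_def)
    also have "\<dots> = e0" using M by (simp add: \<epsilon>_def)
    also note e0(3)
    finally show "\<bar>split_scheme S ((b - a) / m) x0
      (\<lambda>j n. w (a + Suc j * ((b - a) / m)) n - w (a + j * ((b - a) / m)) n) m i - x b i\<bar> \<le> \<eta>"
      by (simp only: \<tau>_def h_def T_def)
  qed
qed

lemma split_scheme_tendsto:
  assumes I: "finite I" and S: "splitting I f S" and ab: "a \<le> b"
    and x: "drift_solution I f w a b x0 x" and i: "i \<in> I"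
  shows "(\<lambda>m. split_scheme S ((b - a) / m) x0
      (\<lambda>j n. w (a + Suc j * ((b - a) / m)) n - w (a + j * ((b - a) / m)) n) m i) \<longlonglongrightarrow> x b i"
proof (rule LIMSEQ_I)
  fix r :: real assume "r > 0"
  then have "r / 2 > 0" by simp
  from split_scheme_error[OF I S ab x this] i
  obtain m0 where "\<forall>m\<ge>m0. \<bar>split_scheme S ((b - a) / m) x0
      (\<lambda>j n. w (a + Suc j * ((b - a) / m)) n - w (a + j * ((b - a) / m)) n) m i - x b i\<bar> \<le> r / 2"
    by blast
  moreover have "r / 2 < r" using \<open>r > 0\<close> by simp
  ultimately show "\<exists>no. \<forall>m\<ge>no. norm (split_scheme S ((b - a) / m) x0
      (\<lambda>j n. w (a + Suc j * ((b - a) / m)) n - w (a + j * ((b - a) / m)) n) m i - x b i) < r"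
    unfolding real_norm_def by (meson order.strict_trans1)
qed

lemma drift_solution_unique:
  assumes "finite I" "splitting I f S" "a \<le> b"
    and "drift_solution I f w a b x0 x" "drift_solution I f w a b x0 y" "i \<in> I"
  shows "x b i = y b i"
  using split_scheme_tendsto[OF assms(1-3) assms(4,6)] split_scheme_tendsto[OF assms(1-3) assms(5,6)]
  by (rule LIMSEQ_unique)

section \<open>Existence of solutions\<close>

lemma Lipschitz_continuous_on:
  fixes F :: "(int \<Rightarrow> real) \<Rightarrow> int \<Rightarrow> real" and x :: "real \<Rightarrow> int \<Rightarrow> real"
  assumes F: "\<And>x y i. i \<in> I \<Longrightarrow> \<bar>F x i - F y i\<bar> \<le> L * (\<Sum>k\<in>I. \<bar>x k - y k\<bar>)"
    and x: "\<And>i. i \<in> I \<Longrightarrow> continuous_on A (\<lambda>t. x t i)" and i: "i \<in> I"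
  shows "continuous_on A (\<lambda>t. F (x t) i)"
  unfolding continuous_on_def
proof
  fix t assume t: "t \<in> A"
  have "((\<lambda>s. L * (\<Sum>k\<in>I. \<bar>x s k - x t k\<bar>)) \<longlongrightarrow> L * (\<Sum>k\<in>I. \<bar>x t k - x t k\<bar>)) (at t within A)"
    using x t by (intro tendsto_intros) (auto simp: continuous_on_def)
  then have lim: "((\<lambda>s. L * (\<Sum>k\<in>I. \<bar>x s k - x t k\<bar>)) \<longlongrightarrow> 0) (at t within A)" by simp
  have ev: "\<forall>\<^sub>F s in at t within A. norm (F (x s) i - F (x t) i) \<le> L * (\<Sum>k\<in>I. \<bar>x s k - x t k\<bar>)"
    using F[OF i] by (simp add: always_eventually)
  have "((\<lambda>s. F (x s) i - F (x t) i) \<longlongrightarrow> 0) (at t within A)"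
    by (rule Lim_null_comparison[OF ev lim])
  then show "((\<lambda>s. F (x s) i) \<longlongrightarrow> F (x t) i) (at t within A)"
    by (simp add: LIM_zero_iff)
qed

text \<open>Picard iteration measured with the weight exp (2 K (t - a)). In that weight the
  iteration contracts by 1/2 on the whole interval, so no concatenation of short time steps is
  needed.\<close>

lemma Picard_Lindelof_global:
  fixes F :: "(int \<Rightarrow> real) \<Rightarrow> int \<Rightarrow> real" and p :: "real \<Rightarrow> int \<Rightarrow> real"
  assumes I: "finite I" and L: "L \<ge> 0"
    and F: "\<And>x y i. i \<in> I \<Longrightarrow> \<bar>F x i - F y i\<bar> \<le> L * (\<Sum>k\<in>I. \<bar>x k - y k\<bar>)"
    and p: "\<And>i. i \<in> I \<Longrightarrow> continuous_on {a..b} (\<lambda>t. p t i)"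
  shows "\<exists>x. (\<forall>i\<in>I. continuous_on {a..b} (\<lambda>t. x t i)) \<and>
    (\<forall>i\<in>I. \<forall>t\<in>{a..b}. x t i = p t i + integral {a..t} (\<lambda>r. F (x r) i))"
proof -
  define y where "y = rec_nat p (\<lambda>_ u t i. p t i + integral {a..t} (\<lambda>r. F (u r) i))"
  have y0: "y 0 = p" and ySuc: "y (Suc k) t i = p t i + integral {a..t} (\<lambda>r. F (y k r) i)" for k t i
    by (simp_all add: y_def)
  have yc: "\<forall>i\<in>I. continuous_on {a..b} (\<lambda>t. y k t i)" for k
  proof (induction k)
    case 0
    then show ?case using p by (simp add: y0)
  next
    case (Suc k)
    show ?case
    proof
      fix i assume i: "i \<in> I"
      have "continuous_on {a..b} (\<lambda>r. F (y k r) i)"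
        by (rule Lipschitz_continuous_on[OF F _ i]) (use Suc in auto)
      then have "continuous_on {a..b} (\<lambda>t. integral {a..t} (\<lambda>r. F (y k r) i))"
        by (intro indefinite_integral_continuous_1 integrable_continuous_real)
      then show "continuous_on {a..b} (\<lambda>t. y (Suc k) t i)"
        unfolding ySuc using p[OF i] by (intro continuous_intros)
    qed
  qed
  have Fy: "continuous_on {a..b} (\<lambda>r. F (y k r) i)" if "i \<in> I" for k i
    by (rule Lipschitz_continuous_on[OF F _ that]) (use yc in auto)
  have Fyi: "(\<lambda>r. F (y k r) i) integrable_on {a..t}" if "i \<in> I" "t \<in> {a..b}" for k i t
    by (rule integrable_continuous_real, rule continuous_on_subset[OF Fy[OF that(1)]]) (use that(2) in auto)
  define n where "n = real (card I)"
  \<comment> \<open>The added 1 makes \<open>K\<close> a legitimate divisor and gives the strict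
    inequality n L < K used for the uniform convergence of the field.\<close>
  define K where "K = n * L + 1"
  have n: "n \<ge> 0" and K: "K > 0" "n * L \<le> K" using L by (auto simp: n_def K_def add_nonneg_pos)
  have "continuous_on {a..b} (\<lambda>t. y 1 t i - y 0 t i)" if "i \<in> I" for i
    by (rule continuous_on_diff) (use yc that in blast)+
  then obtain R where R: "R \<ge> 0" "\<forall>t\<in>{a..b}. \<forall>i\<in>I. \<bar>y 1 t i - y 0 t i\<bar> \<le> R"
    by (rule paths_bounded[OF I])
  define d where "d k t = (\<Sum>i\<in>I. \<bar>y (Suc k) t i - y k t i\<bar>)" for k t
  \<comment> \<open>Integrating the weight gains a factor 1 / (2 K), while the Lipschitz bound
    summed over \<open>I\<close> costs n L \<le> K.\<close>
  have d: "d k t \<le> n * R * (1/2) ^ k * exp (2 * K * (t - a))" if t: "t \<in> {a..b}" for k t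
    using t
  proof (induction k arbitrary: t)
    case 0
    have "d 0 t \<le> (\<Sum>i\<in>I. R)" unfolding d_def using R(2) 0 by (intro sum_mono) auto
    also have "\<dots> = n * R * 1" by (simp add: n_def)
    also have "\<dots> \<le> n * R * exp (2 * K * (t - a))"
      using 0 n R K by (intro mult_left_mono) auto
    finally show ?case by simp
  next
    case (Suc k)
    let ?c = "n * R * (1/2) ^ k"
    have c: "?c \<ge> 0" using n R by simp
    have int: "((\<lambda>r. L * (?c * exp (2 * K * (r - a)))) has_integral
        L * (?c * exp (2 * K * (t - a))) / (2 * K) - L * (?c * exp (2 * K * (a - a))) / (2 * K)) {a..t}"
      using Suc.prems K
      by (intro fundamental_theorem_of_calculus)
         (auto intro!: derivative_eq_intros simp: has_real_derivative_iff_has_vector_derivative[symmetric])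
    have bnd: "\<bar>y (Suc (Suc k)) t i - y (Suc k) t i\<bar> \<le> L * (?c * exp (2 * K * (t - a))) / (2 * K)" if i: "i \<in> I" for i
    proof -
      have "y (Suc (Suc k)) t i - y (Suc k) t i = integral {a..t} (\<lambda>r. F (y (Suc k) r) i) - integral {a..t} (\<lambda>r. F (y k r) i)"
        by (simp only: ySuc)
      also have "\<dots> = integral {a..t} (\<lambda>r. F (y (Suc k) r) i - F (y k r) i)"
        by (intro Henstock_Kurzweil_Integration.integral_diff[symmetric] Fyi i Suc.prems)
      also have "norm \<dots> \<le> integral {a..t} (\<lambda>r. L * (?c * exp (2 * K * (r - a))))"
      proof (rule integral_norm_bound_integral)
        show "(\<lambda>r. F (y (Suc k) r) i - F (y k r) i) integrable_on {a..t}"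
          by (intro integrable_diff Fyi i Suc.prems)
        show "(\<lambda>r. L * (?c * exp (2 * K * (r - a)))) integrable_on {a..t}"
          using int by (rule has_integral_integrable)
        fix r assume r: "r \<in> {a..t}"
        have "norm (F (y (Suc k) r) i - F (y k r) i) \<le> L * d k r"
          unfolding d_def using F[OF i] by simp
        also have "\<dots> \<le> L * (?c * exp (2 * K * (r - a)))"
          using Suc.IH[of r] r Suc.prems L by (intro mult_left_mono) auto
        finally show "norm (F (y (Suc k) r) i - F (y k r) i) \<le> L * (?c * exp (2 * K * (r - a)))" .
      qed
      also have "\<dots> = L * (?c * exp (2 * K * (t - a))) / (2 * K) - L * (?c * exp (2 * K * (a - a))) / (2 * K)"
        using int by (rule integral_unique)
      also have "\<dots> \<le> L * (?c * exp (2 * K * (t - a))) / (2 * K)"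
        using L c K by simp
      finally show ?thesis by simp
    qed
    have "d (Suc k) t \<le> (\<Sum>i\<in>I. L * (?c * exp (2 * K * (t - a))) / (2 * K))"
      unfolding d_def[of "Suc k"] by (intro sum_mono bnd)
    also have "\<dots> = (n * L / (2 * K)) * (?c * exp (2 * K * (t - a)))"
      by (simp add: n_def)
    also have "\<dots> \<le> 1/2 * (?c * exp (2 * K * (t - a)))"
      using K c by (intro mult_right_mono) (auto simp: divide_simps)
    finally show ?case by simp
  qed
  define B where "B = n * R * exp (2 * K * (b - a))"
  have step: "norm (y (Suc k) t i - y k t i) \<le> B * (1/2) ^ k" if i: "i \<in> I" and t: "t \<in> {a..b}" for k i t
  proof -
    have "\<bar>y (Suc k) t i - y k t i\<bar> \<le> d k t" unfolding d_def using I i by (intro member_le_sum) auto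
    also have "\<dots> \<le> n * R * (1/2) ^ k * exp (2 * K * (t - a))" by (rule d[OF t])
    also have "\<dots> \<le> n * R * (1/2) ^ k * exp (2 * K * (b - a))"
      using t n R K by (intro mult_left_mono) auto
    finally show ?thesis by (simp add: B_def mult_ac)
  qed
  define x where "x t i = p t i + (\<Sum>k. y (Suc k) t i - y k t i)" for t i
  have ul: "uniform_limit {a..b} (\<lambda>m t. y m t i) (\<lambda>t. x t i) sequentially" if i: "i \<in> I" for i
  proof -
    have "uniform_limit {a..b} (\<lambda>m t. \<Sum>k<m. y (Suc k) t i - y k t i) (\<lambda>t. \<Sum>k. y (Suc k) t i - y k t i) sequentially"
      by (rule Weierstrass_m_test[OF step[OF i]]) (auto intro!: summable_mult)
    then have "uniform_limit {a..b} (\<lambda>m t. p t i + (\<Sum>k<m. y (Suc k) t i - y k t i)) (\<lambda>t. x t i) sequentially"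
      unfolding x_def by (intro uniform_limit_add uniform_limit_const)
    moreover have "p t i + (\<Sum>k<m. y (Suc k) t i - y k t i) = y m t i" for m t
      using sum_lessThan_telescope[of "\<lambda>k. y k t i" m] by (simp add: y0)
    ultimately show ?thesis by simp
  qed
  have xc: "continuous_on {a..b} (\<lambda>t. x t i)" if i: "i \<in> I" for i
    by (rule uniform_limit_theorem[OF _ ul[OF i]]) (use yc i in auto)
  have Ful: "uniform_limit {a..b} (\<lambda>m t. F (y m t) i) (\<lambda>t. F (x t) i) sequentially" if i: "i \<in> I" for i
  proof (rule uniform_limitI)
    fix e :: real assume e: "e > 0"
    have "e / K > 0" using e K by simp
    then have "\<forall>k\<in>I. \<forall>\<^sub>F m in sequentially. \<forall>t\<in>{a..b}. dist (y m t k) (x t k) < e / K"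
      using ul uniform_limitD by blast
    then have "\<forall>\<^sub>F m in sequentially. \<forall>k\<in>I. \<forall>t\<in>{a..b}. dist (y m t k) (x t k) < e / K"
      using I by (intro eventually_ball_finite) auto
    then show "\<forall>\<^sub>F m in sequentially. \<forall>t\<in>{a..b}. dist (F (y m t) i) (F (x t) i) < e"
    proof eventually_elim
      case (elim m)
      show ?case
      proof
        fix t assume t: "t \<in> {a..b}"
        have "dist (F (y m t) i) (F (x t) i) \<le> L * (\<Sum>k\<in>I. \<bar>y m t k - x t k\<bar>)"
          using F[OF i] by (simp add: dist_real_def)
        also have "\<dots> \<le> L * (\<Sum>k\<in>I. e / K)"
          using elim t L by (intro mult_left_mono sum_mono) (auto simp: dist_real_def intro: less_imp_le)
        also have "\<dots> = (n * L) * (e / K)" by (simp add: n_def)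
        also have "\<dots> < K * (e / K)" using e K by (intro mult_strict_right_mono) (auto simp: K_def)
        also have "\<dots> = e" using K by simp
        finally show "dist (F (y m t) i) (F (x t) i) < e" .
      qed
    qed
  qed
  show ?thesis
  proof (intro exI[of _ x] conjI ballI)
    fix i t assume i: "i \<in> I" and t: "t \<in> {a..b}"
    have sub: "{a..t} \<subseteq> {a..b}" using t by auto
    have "(\<lambda>m. integral {a..t} (\<lambda>r. F (y m r) i)) \<longlonglongrightarrow> integral {a..t} (\<lambda>r. F (x r) i)"
    proof (rule uniform_limit_integral[OF uniform_limit_on_subset[OF Ful[OF i] sub]])
      show "continuous_on {a..t} (\<lambda>r. F (y m r) i)" for m
        by (rule continuous_on_subset[OF Fy[OF i] sub])
      fix J Z assume J: "\<And>m. ((\<lambda>r. F (y m r) i) has_integral J m) {a..t}"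
        "((\<lambda>r. F (x r) i) has_integral Z) {a..t}" "J \<longlonglongrightarrow> Z"
      show ?thesis unfolding integral_unique[OF J(1)] integral_unique[OF J(2)] by (rule J(3))
    qed simp
    then have "(\<lambda>m. y (Suc m) t i) \<longlonglongrightarrow> p t i + integral {a..t} (\<lambda>r. F (x r) i)"
      unfolding ySuc by (intro tendsto_add tendsto_const)
    moreover have "(\<lambda>m. y (Suc m) t i) \<longlonglongrightarrow> x t i"
      using tendsto_uniform_limitI[OF ul[OF i] t] by (rule LIMSEQ_Suc)
    ultimately show "x t i = p t i + integral {a..t} (\<lambda>r. F (x r) i)"
      by (rule LIMSEQ_unique[rotated])
  qed (rule xc)
qed

text \<open>The differential inequality is available only below the level M + 1. Up to the first
  time at which this level could be reached, Gronwall gives 1 + u \<le> M, which is strictly below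
  it, so by continuity the level is never attained.\<close>

lemma Gronwall_bootstrap:
  fixes u :: "real \<Rightarrow> real"
  assumes ab: "a \<le> b" and D: "D \<ge> 0" and ua: "u a \<ge> 0" and M: "M = (1 + u a) * exp (D * (b - a))"
    and ud: "\<And>t. t \<in> {a..b} \<Longrightarrow> (u has_real_derivative u' t) (at t within {a..b})"
    and rate: "\<And>t. t \<in> {a..b} \<Longrightarrow> u t \<le> M + 1 \<Longrightarrow> u' t \<le> D * (1 + u t)"
    and t: "t \<in> {a..b}"
  shows "u t \<le> M + 1"
proof -
  have uc: "continuous_on {a..b} u"
    using ud by (rule DERIV_continuous_on)
  \<comment> \<open>Gronwall on the interval before \<open>\<tau>\<close>, through the integrating
    factor \<open>G\<close>; the value at \<open>\<tau>\<close> itself comes from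
    continuity.\<close>
  have claim: "u \<tau> < M + 1" if \<tau>: "\<tau> \<in> {a..b}" and before: "\<And>t. a \<le> t \<Longrightarrow> t < \<tau> \<Longrightarrow> u t \<le> M + 1" for \<tau>
  proof (cases "a = \<tau>")
    case True
    have "1 \<le> exp (D * (b - a))" using D ab by simp
    then have "(1 + u a) * 1 \<le> M" unfolding M using ua by (intro mult_left_mono) simp_all
    then show ?thesis using True by simp
  next
    case False
    then have a\<tau>: "a < \<tau>" using \<tau> by simp
    define G where "G t = (1 + u t) * exp (- D * (t - a))" for t
    have "G \<tau> \<le> G a"
    proof (rule DERIV_nonpos_imp_decreasing_open[OF less_imp_le[OF a\<tau>]])
      fix t assume t: "a < t" "t < \<tau>"
      have tab: "t \<in> {a..b}" using t \<tau> by simp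
      have u': "(u has_real_derivative u' t) (at t)"
        using ud[OF tab] t \<tau> by (simp add: at_within_Icc_at)
      have "((\<lambda>t. exp (- D * (t - a))) has_real_derivative exp (- D * (t - a)) * (- D)) (at t)"
        by (auto intro!: derivative_eq_intros)
      from DERIV_mult[OF DERIV_add[OF DERIV_const u'] this]
      have "(G has_real_derivative (u' t - D * (1 + u t)) * exp (- D * (t - a))) (at t)"
        unfolding G_def by (rule DERIV_cong) (simp add: algebra_simps)
      moreover have "(u' t - D * (1 + u t)) * exp (- D * (t - a)) \<le> 0"
        using rate[OF tab before[of t]] t by (intro mult_nonpos_nonneg) simp_all
      ultimately show "\<exists>y. (G has_real_derivative y) (at t) \<and> y \<le> 0" by blast
    next
      show "continuous_on {a..\<tau>} G"
        unfolding G_def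
      proof (intro continuous_intros)
        show "continuous_on {a..\<tau>} u" by (rule continuous_on_subset[OF uc]) (use \<tau> in simp)
      qed
    qed
    then have "(1 + u \<tau>) * exp (- D * (\<tau> - a)) \<le> 1 + u a" by (simp add: G_def)
    then have "(1 + u \<tau>) * exp (- D * (\<tau> - a)) * exp (D * (\<tau> - a)) \<le> (1 + u a) * exp (D * (\<tau> - a))"
      by (intro mult_right_mono) simp_all
    then have "1 + u \<tau> \<le> (1 + u a) * exp (D * (\<tau> - a))"
      unfolding mult.assoc exp_add[symmetric] by simp
    also have "\<dots> \<le> M"
    proof -
      have "D * (\<tau> - a) \<le> D * (b - a)" using D \<tau> by (intro mult_left_mono) simp_all
      then show ?thesis unfolding M using ua by (intro mult_left_mono) simp_all
    qed
    finally show ?thesis by simp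
  qed
  show ?thesis
  proof (rule ccontr)
    assume big: "\<not> u t \<le> M + 1"
    \<comment> \<open>The times at which the barrier is attained or exceeded. Compactness provides a
      first one, to which \<open>claim\<close> applies.\<close>
    define A where "A = {a..b} \<inter> u -` {M + 1..}"
    have "closed A" unfolding A_def using uc by (intro continuous_closed_preimage) simp_all
    moreover have "bounded A" unfolding A_def by (rule bounded_subset[OF bounded_closed_interval Int_lower1])
    ultimately have "compact A" by (simp add: compact_eq_bounded_closed)
    moreover have "t \<in> A" using t big by (simp add: A_def)
    ultimately obtain \<tau> where \<tau>: "\<tau> \<in> A" "\<forall>s\<in>A. \<tau> \<le> s" using compact_attains_inf[of A] by blast
    have "u \<tau> < M + 1"
    proof (rule claim)
      show "\<tau> \<in> {a..b}" using \<tau> by (simp add: A_def)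
      fix s assume s: "a \<le> s" "s < \<tau>"
      then have "s \<notin> A" using \<tau>(2) by auto
      then show "u s \<le> M + 1" using s \<tau>(1) by (simp add: A_def)
    qed
    then show False using \<tau>(1) by (simp add: A_def)
  qed
qed

text \<open>Since x . f(x) = 0, only the noise part works: z . f(x) = - v . f(x). This is linear in
  the bounded v and at most quadratic in x, hence linear in the energy of z, although z . f(x) could
  be cubic. The constants come from |x|^2 \<le> 2 |z|^2 + 2 n W^2.\<close>

lemma energy_rate:
  fixes x v z :: "int \<Rightarrow> real" and W C :: real
  assumes I: "finite I" and f: "conservative_field I f" and W: "W \<ge> 0" "\<And>i. i \<in> I \<Longrightarrow> \<bar>v i\<bar> \<le> W"
    and C: "C \<ge> 0" "\<And>i. i \<in> I \<Longrightarrow> \<bar>f x i\<bar> \<le> C * (1 + (\<Sum>k\<in>I. (x k)\<^sup>2))"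
    and xz: "\<And>i. i \<in> I \<Longrightarrow> x i = z i + v i"
  shows "(\<Sum>i\<in>I. 2 * z i * f x i) \<le> 2 * real (card I) * W * C * (2 + 2 * real (card I) * W\<^sup>2) * (1 + (\<Sum>i\<in>I. (z i)\<^sup>2))"
proof -
  define n where "n = real (card I)"
  define u where "u = (\<Sum>i\<in>I. (z i)\<^sup>2)"
  define Q where "Q = (\<Sum>k\<in>I. (x k)\<^sup>2)"
  have u: "u \<ge> 0" and n: "n \<ge> 0" by (simp_all add: u_def n_def sum_nonneg)
  have Q: "Q \<le> 2 * u + 2 * n * W\<^sup>2"
  proof -
    have "(x i)\<^sup>2 \<le> 2 * (z i)\<^sup>2 + 2 * W\<^sup>2" if i: "i \<in> I" for i
    proof -
      have "(z i + v i)\<^sup>2 \<le> 2 * (z i)\<^sup>2 + 2 * (v i)\<^sup>2"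
        using sum_squares_bound[of "z i" "v i"] by (simp add: power2_sum)
      moreover have "(v i)\<^sup>2 \<le> W\<^sup>2" using W(1) W(2)[OF i] by (intro abs_le_square_iff[THEN iffD1]) simp
      ultimately show ?thesis unfolding xz[OF i] by linarith
    qed
    then have "Q \<le> (\<Sum>i\<in>I. 2 * (z i)\<^sup>2 + 2 * W\<^sup>2)" unfolding Q_def by (rule sum_mono)
    also have "\<dots> = 2 * u + 2 * n * W\<^sup>2" by (simp add: sum.distrib u_def sum_distrib_left n_def)
    finally show ?thesis .
  qed
  have "2 * z i * f x i = 2 * (x i * f x i) - 2 * (v i * f x i)" if "i \<in> I" for i
  proof -
    have "z i = x i - v i" using xz[OF that] by simp
    then show ?thesis by (simp add: left_diff_distrib)
  qed
  then have "(\<Sum>i\<in>I. 2 * z i * f x i) = (\<Sum>i\<in>I. 2 * (x i * f x i) - 2 * (v i * f x i))"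
    by (rule sum.cong[OF refl])
  also have "\<dots> = - 2 * (\<Sum>i\<in>I. v i * f x i)"
    using conservative_field_energy[OF f, of x]
    by (simp add: sum_subtractf sum_distrib_left[symmetric])
  also have "\<dots> = 2 * (\<Sum>i\<in>I. - (v i * f x i))" by (simp add: sum_negf)
  also have "\<dots> \<le> 2 * (\<Sum>i\<in>I. W * (C * (1 + Q)))"
  proof -
    have "- (v i * f x i) \<le> W * (C * (1 + Q))" if i: "i \<in> I" for i
    proof -
      have "- (v i * f x i) \<le> \<bar>v i\<bar> * \<bar>f x i\<bar>"
        unfolding abs_mult[symmetric] by (rule abs_ge_minus_self)
      also have "\<dots> \<le> W * (C * (1 + Q))"
        by (rule mult_mono) (use W(1) W(2)[OF i] C(2)[OF i] in \<open>simp_all add: Q_def\<close>)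
      finally show ?thesis .
    qed
    then have "(\<Sum>i\<in>I. - (v i * f x i)) \<le> (\<Sum>i\<in>I. W * (C * (1 + Q)))" by (rule sum_mono)
    then show ?thesis by simp
  qed
  also have "\<dots> = 2 * n * W * C * (1 + Q)" by (simp add: n_def)
  also have "\<dots> \<le> 2 * n * W * C * ((2 + 2 * n * W\<^sup>2) * (1 + u))"
  proof (rule mult_left_mono)
    have "0 \<le> 2 * n * W\<^sup>2 * u" using n u by simp
    then show "1 + Q \<le> (2 + 2 * n * W\<^sup>2) * (1 + u)"
      unfolding distrib_left distrib_right using Q by linarith
    show "0 \<le> 2 * n * W * C" using n W(1) C(1) by simp
  qed
  finally show ?thesis unfolding n_def u_def mult.assoc .
qed

text \<open>Picard iteration for the field with clamped arguments; the clamp is invisible because the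
  energy of x - w grows at most exponentially, the field doing no work.\<close>

lemma drift_solution_exists:
  assumes I: "finite I" and f: "conservative_field I f" and ab: "a \<le> b"
    and w: "\<And>i. i \<in> I \<Longrightarrow> continuous_on {a..b} (\<lambda>t. w t i)"
  shows "\<exists>x. drift_solution I f w a b x0 x"
proof -
  define v where "v t i = w t i - w a i" for t i
  have vc: "continuous_on {a..b} (\<lambda>t. v t i)" if "i \<in> I" for i
    unfolding v_def by (rule continuous_on_diff[OF w[OF that] continuous_on_const])
  then obtain W where W: "W \<ge> 0" "\<forall>t\<in>{a..b}. \<forall>i\<in>I. \<bar>v t i\<bar> \<le> W"
    by (rule paths_bounded[OF I])
  obtain C where C: "C \<ge> 0" "\<forall>x. \<forall>i\<in>I. \<bar>f x i\<bar> \<le> C * (1 + (\<Sum>k\<in>I. (x k)\<^sup>2))"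
    using conservative_field_growth[OF f] by blast
  define n where "n = real (card I)"
  define D where "D = 2 * n * W * C * (2 + 2 * n * W\<^sup>2)"
  define E0 where "E0 = (\<Sum>i\<in>I. (x0 i)\<^sup>2)"
  define M where "M = (1 + E0) * exp (D * (b - a))"
  have n: "n \<ge> 0" and D: "D \<ge> 0" and E0: "E0 \<ge> 0" using W C by (auto simp: n_def D_def E0_def sum_nonneg)
  have M: "M \<ge> 0" using E0 by (simp add: M_def)
  \<comment> \<open>If the energy of \<open>z\<close> is at most M + 1, every coordinate of
    \<open>z\<close> is at most sqrt (M + 1) \<le> M + 1, and the noise adds at most
    \<open>W\<close>. So the clamp at this radius is inactive.\<close>
  define R where "R = M + 1 + W"
  have R: "R \<ge> 0" using M W by (simp add: R_def)
  define cl where "cl u = max (- R) (min R u)" for u :: real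
  have cl: "\<bar>cl u\<bar> \<le> R" "\<bar>cl u - cl u'\<bar> \<le> \<bar>u - u'\<bar>" "\<bar>u\<bar> \<le> R \<Longrightarrow> cl u = u" for u u'
    using R by (auto simp: cl_def max_def min_def)
  define F where "F x i = f (\<lambda>k. cl (x k)) i" for x i
  obtain L where L: "L \<ge> 0" "\<forall>x y. (\<forall>i\<in>I. \<bar>x i\<bar> \<le> R) \<longrightarrow> (\<forall>i\<in>I. \<bar>y i\<bar> \<le> R) \<longrightarrow>
    (\<forall>i\<in>I. \<bar>f x i - f y i\<bar> \<le> L * (\<Sum>k\<in>I. \<bar>x k - y k\<bar>))"
    using conservative_field_Lipschitz[OF f, of R] by blast
  have F: "\<bar>F x i - F y i\<bar> \<le> L * (\<Sum>k\<in>I. \<bar>x k - y k\<bar>)" if "i \<in> I" for x y i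
  proof -
    have "\<bar>F x i - F y i\<bar> \<le> L * (\<Sum>k\<in>I. \<bar>cl (x k) - cl (y k)\<bar>)"
      unfolding F_def using L(2)[rule_format, of "\<lambda>k. cl (x k)" "\<lambda>k. cl (y k)" i] cl(1) that by simp
    also have "\<dots> \<le> L * (\<Sum>k\<in>I. \<bar>x k - y k\<bar>)" using L cl(2) by (intro mult_left_mono sum_mono)
    finally show ?thesis .
  qed
  have Ff: "F x i = f x i" if "\<forall>k\<in>I. \<bar>x k\<bar> \<le> R" "i \<in> I" for x i
  proof -
    have "\<bar>f (\<lambda>k. cl (x k)) i - f x i\<bar> \<le> L * (\<Sum>k\<in>I. \<bar>cl (x k) - x k\<bar>)"
      using L(2)[rule_format, of "\<lambda>k. cl (x k)" x i] cl(1) that by simp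
    also have "\<dots> = 0" using that cl(3) by simp
    finally show ?thesis by (simp add: F_def)
  qed
  have pc: "continuous_on {a..b} (\<lambda>t. x0 i + v t i)" if "i \<in> I" for i
    by (rule continuous_on_add[OF continuous_on_const vc[OF that]])
  obtain x where x: "\<forall>i\<in>I. continuous_on {a..b} (\<lambda>t. x t i)"
    "\<forall>i\<in>I. \<forall>t\<in>{a..b}. x t i = (x0 i + v t i) + integral {a..t} (\<lambda>r. F (x r) i)"
    using Picard_Lindelof_global[where F=F and p="\<lambda>t i. x0 i + v t i" and a=a and b=b, OF I L(1) F pc] by blast
  note xc = x(1)[rule_format] and xe = x(2)[rule_format]
  have Fc: "continuous_on {a..b} (\<lambda>r. F (x r) i)" if "i \<in> I" for i
    by (rule Lipschitz_continuous_on[OF F xc that])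
  \<comment> \<open>Without the noise the path is differentiable in time, so its energy can be
    differentiated even though that of \<open>x\<close> cannot in general.\<close>
  define z where "z t i = x0 i + integral {a..t} (\<lambda>r. F (x r) i)" for t i
  have xz: "x t i = z t i + v t i" if "i \<in> I" "t \<in> {a..b}" for t i
    using xe[OF that] by (simp add: z_def)
  have zd: "((\<lambda>t. z t i) has_real_derivative F (x t) i) (at t within {a..b})" if "i \<in> I" "t \<in> {a..b}" for t i
    unfolding z_def
    by (rule DERIV_cong[OF DERIV_add[OF DERIV_const integral_has_real_derivative[OF Fc[OF that(1)] that(2)]]]) simp
  define E where "E t = (\<Sum>i\<in>I. (z t i)\<^sup>2)" for t
  have Ed: "(E has_real_derivative (\<Sum>i\<in>I. 2 * z t i * F (x t) i)) (at t within {a..b})" if "t \<in> {a..b}" for t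
    unfolding E_def
  proof (rule DERIV_sum)
    fix i assume "i \<in> I"
    from DERIV_power[OF zd[OF this that], of 2]
    show "((\<lambda>t. (z t i)\<^sup>2) has_real_derivative 2 * z t i * F (x t) i) (at t within {a..b})"
      by (rule DERIV_cong) simp
  qed
  have Ea: "E a = E0" by (simp add: E_def E0_def z_def)
  have xR: "\<forall>i\<in>I. \<bar>x t i\<bar> \<le> R" if t: "t \<in> {a..b}" and Et: "E t \<le> M + 1" for t
  proof
    fix i assume i: "i \<in> I"
    have "(z t i)\<^sup>2 \<le> E t" unfolding E_def using I i by (intro member_le_sum) auto
    also have "\<dots> \<le> (M + 1) * 1" using Et by simp
    also have "\<dots> \<le> (M + 1) * (M + 1)" using M by (intro mult_left_mono) auto
    finally have "\<bar>z t i\<bar>\<^sup>2 \<le> (M + 1)\<^sup>2" by (simp add: power2_eq_square)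
    then have "\<bar>z t i\<bar> \<le> M + 1" by (rule power2_le_imp_le) (use M in simp)
    moreover have "\<bar>v t i\<bar> \<le> W" using W i t by blast
    ultimately show "\<bar>x t i\<bar> \<le> R" using xz[OF i t] unfolding R_def by linarith
  qed
  have small: "E t \<le> M + 1" if t: "t \<in> {a..b}" for t
  proof (rule Gronwall_bootstrap[OF ab D _ _ Ed _ t])
    show "0 \<le> E a" using E0 by (simp add: Ea)
    show "M = (1 + E a) * exp (D * (b - a))" by (simp add: M_def Ea)
    fix t assume t: "t \<in> {a..b}" and Et: "E t \<le> M + 1"
    have "(\<Sum>i\<in>I. 2 * z t i * f (x t) i) \<le> D * (1 + E t)"
      unfolding D_def n_def E_def
    proof (rule energy_rate[OF I f W(1) _ C(1)])
      show "\<bar>v t i\<bar> \<le> W" if "i \<in> I" for i using W(2) that t by blast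
      show "\<bar>f (x t) i\<bar> \<le> C * (1 + (\<Sum>k\<in>I. (x t k)\<^sup>2))" if "i \<in> I" for i using C(2) that by blast
      show "x t i = z t i + v t i" if "i \<in> I" for i by (rule xz[OF that t])
    qed
    moreover have "(\<Sum>i\<in>I. 2 * z t i * F (x t) i) = (\<Sum>i\<in>I. 2 * z t i * f (x t) i)"
      by (rule sum.cong[OF refl]) (simp only: Ff[OF xR[OF t Et]])
    ultimately show "(\<Sum>i\<in>I. 2 * z t i * F (x t) i) \<le> D * (1 + E t)" by simp
  qed
  have "drift_solution I f w a b x0 x"
    unfolding drift_solution_def
  proof (intro conjI ballI)
    fix i t assume i: "i \<in> I" and t: "t \<in> {a..b}"
    have "integral {a..t} (\<lambda>r. F (x r) i) = integral {a..t} (\<lambda>r. f (x r) i)"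
    proof (rule integral_cong)
      fix r assume "r \<in> {a..t}"
      then have r: "r \<in> {a..b}" using t by auto
      show "F (x r) i = f (x r) i" by (rule Ff[OF xR[OF r small[OF r]] i])
    qed
    then show "x t i = x0 i + integral {a..t} (\<lambda>r. f (x r) i) + (w t i - w a i)"
      using xe[OF i t] by (simp add: v_def)
  qed (rule xc)
  then show ?thesis by (rule exI[of _ x])
qed

section \<open>The KdV field in real coordinates\<close>

text \<open>A positive index holds the real part of a mode, the negative index its imaginary part.
  The factor \<open>sqrt 2\<close> offsets the variance 1/2 of these parts, so that white noise has
  equal variances in all coordinates; it also makes the sum of squares equal to the squared L2
  norm.\<close>

definition real_coords :: "coeffs \<Rightarrow> int \<Rightarrow> real" where
  "real_coords a n =
     (if n = 0 then Re (a 0) else if n > 0 then sqrt 2 * Re (a n) else sqrt 2 * Im (a (- n)))"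

definition of_real_coords :: "(int \<Rightarrow> real) \<Rightarrow> coeffs" where
  "of_real_coords x n =
     (if n = 0 then complex_of_real (x 0)
      else if n > 0 then Complex (x n / sqrt 2) (x (- n) / sqrt 2)
      else Complex (x (- n) / sqrt 2) (- x n / sqrt 2))"

lemma real_coords_of_real_coords [simp]: "real_coords (of_real_coords x) = x"
  by (auto simp: real_coords_def of_real_coords_def fun_eq_iff)

lemma real_valued_of_real_coords: "real_valued (of_real_coords x)"
  by (auto simp: real_valued_def of_real_coords_def complex_eq_iff)

lemma of_real_coords_real_coords:
  assumes "real_valued a"
  shows "of_real_coords (real_coords a) = a"
proof
  fix n
  have c: "a (- k) = cnj (a k)" for k using assms by (simp add: real_valued_def)
  have "Im (a 0) = 0" using c[of 0] by (simp add: complex_eq_iff)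
  then show "of_real_coords (real_coords a) n = a n"
    using c[of n] by (auto simp: of_real_coords_def real_coords_def complex_eq_iff)
qed

lemma real_coords_diff: "real_coords (\<lambda>n. a n - b n) n = real_coords a n - real_coords b n"
  by (simp add: real_coords_def algebra_simps)

lemma real_coords_add: "real_coords (\<lambda>n. a n + b n) n = real_coords a n + real_coords b n"
  by (simp add: real_coords_def algebra_simps)

section \<open>Fourier modes of the drift\<close>

lemma mult_proj_eq_sum:
  "mult (proj N a) b n = (\<Sum>k\<in>{- int N..int N}. proj N a k * b (n - k))"
proof -
  have "mult (proj N a) b n = infsum (\<lambda>k. proj N a k * b (n - k)) {- int N..int N}"
    unfolding mult_def by (rule infsum_cong_neutral) (auto simp: proj_def)
  then show ?thesis by simp
qed

lemma mult_proj_finite: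
  assumes "0 \<le> n" "n \<le> int N"
  shows "mult (proj N a) (dx (proj N a)) n = (\<Sum>j\<in>{n - int N..int N}. a (n - j) * (\<i> * of_int j * a j))"
proof -
  let ?A = "{n - int N..int N}"
  have "mult (proj N a) (dx (proj N a)) n = infsum (\<lambda>k. proj N a k * dx (proj N a) (n - k)) ?A"
    unfolding mult_def by (rule infsum_cong_neutral) (auto simp: proj_def dx_def)
  also have "\<dots> = (\<Sum>k\<in>?A. proj N a k * dx (proj N a) (n - k))" by simp
  also have "\<dots> = (\<Sum>k\<in>?A. a k * (\<i> * of_int (n - k) * a (n - k)))"
    using assms by (intro sum.cong) (auto simp: proj_def dx_def)
  also have "\<dots> = (\<Sum>j\<in>?A. a (n - j) * (\<i> * of_int j * a j))"
    by (rule sum.reindex_bij_witness[of _ "\<lambda>j. n - j" "\<lambda>j. n - j"]) auto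
  finally show ?thesis .
qed

text \<open>The convolution is sorted by the sign of both frequencies. The index 0 drops out because
  of the derivative, and the index n leaves the mean. The negative index -l is paired with n + l:
  the same product of modes occurs twice, with derivative factors -l and n + l, which add up to
  n.\<close>

lemma mult_proj_pos:
  assumes n: "0 < n" "n \<le> int N"
  shows "mult (proj N a) (dx (proj N a)) n = \<i> * (of_int n * a 0 * a n + (\<Sum>k\<in>{1..n - 1}. of_int k * a k * a (n - k))
    + (\<Sum>l\<in>{1..int N - n}. of_int n * a (n + l) * a (- l)))"
proof -
  let ?g = "\<lambda>j. a (n - j) * (\<i> * of_int j * a j)"
  have "{n - int N..int N} = {n - int N..-1} \<union> ({0} \<union> ({1..n - 1} \<union> ({n} \<union> {n + 1..int N})))"
    using n by auto
  then have "mult (proj N a) (dx (proj N a)) n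
      = sum ?g ({n - int N..-1} \<union> ({0} \<union> ({1..n - 1} \<union> ({n} \<union> {n + 1..int N}))))"
    using mult_proj_finite[of n N a] n by simp
  also have "\<dots> = sum ?g {n - int N..-1} + (?g 0 + (sum ?g {1..n - 1} + (?g n + sum ?g {n + 1..int N})))"
    using n by (subst sum.union_disjoint; (auto)?)+
  also have "sum ?g {n - int N..-1} = (\<Sum>l\<in>{1..int N - n}. a (n + l) * (\<i> * of_int (- l) * a (- l)))"
    by (rule sum.reindex_bij_witness[of _ uminus uminus]) auto
  also have "sum ?g {n + 1..int N} = (\<Sum>l\<in>{1..int N - n}. a (- l) * (\<i> * of_int (n + l) * a (n + l)))"
    by (rule sum.reindex_bij_witness[of _ "\<lambda>l. n + l" "\<lambda>j. j - n"]) auto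
  finally have "mult (proj N a) (dx (proj N a)) n = ?g n + sum ?g {1..n - 1} +
      ((\<Sum>l\<in>{1..int N - n}. a (n + l) * (\<i> * of_int (- l) * a (- l))) +
       (\<Sum>l\<in>{1..int N - n}. a (- l) * (\<i> * of_int (n + l) * a (n + l))))"
    by simp
  also have "(\<Sum>l\<in>{1..int N - n}. a (n + l) * (\<i> * of_int (- l) * a (- l))) +
       (\<Sum>l\<in>{1..int N - n}. a (- l) * (\<i> * of_int (n + l) * a (n + l)))
      = (\<Sum>l\<in>{1..int N - n}. \<i> * (of_int n * a (n + l) * a (- l)))"
    unfolding sum.distrib[symmetric] by (rule sum.cong) (simp_all add: algebra_simps)
  also have "sum ?g {1..n - 1} = (\<Sum>k\<in>{1..n - 1}. \<i> * (of_int k * a k * a (n - k)))"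
    by (rule sum.cong) (simp_all add: algebra_simps)
  finally show ?thesis
    by (simp add: sum_distrib_left[symmetric] algebra_simps)
qed

text \<open>The nonlinearity is a total derivative: the summands are odd under j \<mapsto>
  -j.\<close>

lemma mult_proj_zero:
  assumes "real_valued a"
  shows "mult (proj N a) (dx (proj N a)) 0 = 0"
proof -
  let ?g = "\<lambda>j. a (- j) * (\<i> * of_int j * a j)"
  have m: "mult (proj N a) (dx (proj N a)) 0 = (\<Sum>j\<in>{- int N..int N}. ?g j)"
    using mult_proj_finite[of 0 N a] by simp
  have "(\<Sum>j\<in>{- int N..int N}. ?g j) = (\<Sum>j\<in>{- int N..int N}. - ?g j)"
    by (rule sum.reindex_bij_witness[of _ uminus uminus]) auto
  then have "(\<Sum>j\<in>{- int N..int N}. ?g j) = - (\<Sum>j\<in>{- int N..int N}. ?g j)"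
    by (simp add: sum_negf)
  moreover have "z = - z \<Longrightarrow> z = 0" for z :: complex by (simp add: complex_eq_iff)
  ultimately show ?thesis unfolding m by blast
qed

lemma kdv_drift_pos:
  assumes "0 < n"
  shows "kdv_drift N a n = \<i> * of_int (n ^ 3) * a n -
    (if n \<le> int N then \<i> * (of_int n * a 0 * a n + (\<Sum>k\<in>{1..n - 1}. of_int k * a k * a (n - k))
      + (\<Sum>l\<in>{1..int N - n}. of_int n * a (n + l) * a (- l))) else 0)"
proof -
  have "- dx (dx (dx a)) n = \<i> * of_int (n ^ 3) * a n"
    by (simp add: dx_def power3_eq_cube complex_eq_iff algebra_simps)
  then show ?thesis
    using assms mult_proj_pos[of n N a] by (simp add: kdv_drift_def proj_def[of N "mult _ _"])
qed

lemma kdv_drift_zero: "real_valued a \<Longrightarrow> kdv_drift N a 0 = 0"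
  using mult_proj_zero[of a N] by (simp add: kdv_drift_def proj_def[of N "mult _ _"] dx_def)

section \<open>Decomposition of the drift into rotations\<close>

definition kdv_field :: "nat \<Rightarrow> (int \<Rightarrow> real) \<Rightarrow> int \<Rightarrow> real" where
  "kdv_field N x = real_coords (kdv_drift N (of_real_coords x))"

text \<open>The interaction of the modes k, l and k + l in which l only acts as a parameter:
  u(k+l)' = - i k u(k) u(l) and u(k)' = - i k u(k+l) cnj (u(l)).\<close>

definition triad_field :: "int \<Rightarrow> int \<Rightarrow> (int \<Rightarrow> real) \<Rightarrow> int \<Rightarrow> real" where
  "triad_field k l x j = of_int k / sqrt 2 *
     ((if j = k + l then x (- l) * x k + x l * x (- k) else 0) +
      (if j = - (k + l) then x (- l) * x (- k) - x l * x k else 0) +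
      (if j = k then x l * x (- (k + l)) - x (- l) * x (k + l) else 0) +
      (if j = - k then - (x l * x (k + l) + x (- l) * x (- (k + l))) else 0))"

text \<open>The linear dispersion turns mode n in its own plane with constant speed, and the mean
  \<open>x 0\<close> adds a transport term for the modes that the nonlinearity sees. The mean is a
  constant of the drift, which is why it can act as the parameter.\<close>

definition dispersion_field :: "nat \<Rightarrow> int \<Rightarrow> (int \<Rightarrow> real) \<Rightarrow> int \<Rightarrow> real" where
  "dispersion_field N n = rotation_field n (- n) 0 (- of_int (n ^ 3)) (if n \<le> int N then of_int n else 0)"

text \<open>The complex exchange between modes k and k + l consists of four real rotations with
  \<open>x l\<close> or \<open>x (- l)\<close> as speed. Two of them have k or -k in their plane and
  the parameter of the same sign, and there k \<noteq> l keeps the parameter outside the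
  plane.\<close>

lemma splitting_triad_distinct:
  assumes k: "1 \<le> k" "1 \<le> l" "k + l \<le> K" "k \<noteq> l"
  shows "\<exists>S. splitting {-K..K} (triad_field k l) S"
proof -
  let ?I = "{-K..K}" and ?c = "of_int k / sqrt 2" and ?n = "k + l"
  have 1: "splitting ?I (rotation_field ?n k (- l) 0 ?c) (rotation_step ?n k (- l) 0 ?c)"
    using k by (intro splitting_rotation) auto
  have 2: "splitting ?I (rotation_field ?n (- k) l 0 ?c) (rotation_step ?n (- k) l 0 ?c)"
    using k by (intro splitting_rotation) auto
  have 3: "splitting ?I (rotation_field k (- ?n) l 0 ?c) (rotation_step k (- ?n) l 0 ?c)"
    using k by (intro splitting_rotation) auto
  have 4: "splitting ?I (rotation_field (- ?n) (- k) (- l) 0 ?c) (rotation_step (- ?n) (- k) (- l) 0 ?c)"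
    using k by (intro splitting_rotation) auto
  have eq: "rotation_field ?n k (- l) 0 ?c x n + rotation_field ?n (- k) l 0 ?c x n +
      (rotation_field k (- ?n) l 0 ?c x n + rotation_field (- ?n) (- k) (- l) 0 ?c x n) = triad_field k l x n" for x n
  proof -
    consider "n = k + l" | "n = - (k + l)" | "n = k" | "n = - k"
      | "n \<noteq> k + l" "n \<noteq> - (k + l)" "n \<noteq> k" "n \<noteq> - k" by blast
    then show ?thesis
      by cases (use k in \<open>simp_all add: rotation_field_def triad_field_def algebra_simps\<close>)
  qed
  have fin: "finite ?I" by simp
  from splitting_cong[OF eq splitting_add[OF fin splitting_add[OF fin 1 2] splitting_add[OF fin 3 4]]]
  show ?thesis by blast
qed

text \<open>For k = l two of the rotations lose their independent parameter: what is left is x_k' =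
  c x_k x_(-2k), x_(-k)' = - c x_(-k) x_(-2k) and x_(-2k)' = - c (x_k^2 - x_(-k)^2). In the diagonal
  axes y, z of the plane of k and -k the difference of squares becomes 2 y z, and the field is the
  sum of a rotation of y and x_(-2k) with speed c z and one of z and x_(-2k) with speed c y.\<close>

lemma splitting_triad_diagonal:
  assumes k: "1 \<le> k" "k + k \<le> K"
  shows "\<exists>S. splitting {-K..K} (triad_field k k) S"
proof -
  let ?I = "{-K..K}" and ?c = "of_int k / sqrt 2" and ?n = "k + k"
  have 1: "splitting ?I (rotation_field ?n k (- k) 0 ?c) (rotation_step ?n k (- k) 0 ?c)"
    using k by (intro splitting_rotation) auto
  have 2: "splitting ?I (rotation_field ?n (- k) k 0 ?c) (rotation_step ?n (- k) k 0 ?c)"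
    using k by (intro splitting_rotation) auto
  have 3: "splitting ?I (rotation_field k (- ?n) (- k) 0 ?c) (rotation_step k (- ?n) (- k) 0 ?c)"
    using k by (intro splitting_rotation) auto
  have 4: "splitting ?I (rotation_field (- k) (- ?n) k 0 ?c) (rotation_step (- k) (- ?n) k 0 ?c)"
    using k by (intro splitting_rotation) auto
  let ?g = "\<lambda>x n. rotation_field k (- ?n) (- k) 0 ?c x n + rotation_field (- k) (- ?n) k 0 ?c x n"
  have g: "?g x = (\<lambda>n. if n = k then ?c * x (- k) * x (- ?n) else if n = - k then ?c * x k * x (- ?n)
      else if n = - ?n then - 2 * ?c * x k * x (- k) else 0)" for x
    using k by (auto simp: rotation_field_def fun_eq_iff)
  have sq: "((u + v) / sqrt 2) * ((u - v) / sqrt 2) = (u * u - v * v) / 2" for u v :: real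
    by (simp add: field_simps)
  have eq: "rotation_field ?n k (- k) 0 ?c x n + rotation_field ?n (- k) k 0 ?c x n +
      diagonal_reflection k (- k) (?g (diagonal_reflection k (- k) x)) n = triad_field k k x n" for x n
  proof -
    have h: "diagonal_reflection k (- k) (?g (diagonal_reflection k (- k) x)) n =
      (if n = k then ?c * x k * x (- ?n) else if n = - k then - ?c * x (- k) * x (- ?n)
        else if n = - ?n then - ?c * (x k * x k - x (- k) * x (- k)) else 0)"
    proof -
      have n: "diagonal_reflection k (- k) x (- ?n) = x (- ?n)" using k by (simp add: diagonal_reflection_def)
      have p: "diagonal_reflection k (- k) x k = (x k + x (- k)) / sqrt 2" "diagonal_reflection k (- k) x (- k) = (x k - x (- k)) / sqrt 2"
        using k by (simp_all add: diagonal_reflection_def)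
      have s2: "sqrt 2 * (sqrt 2 * u) = 2 * u" for u :: real
        by (simp add: mult.assoc[symmetric])
      consider "n = k" | "n = - k" | "n = - ?n" | "n \<noteq> k" "n \<noteq> - k" "n \<noteq> - ?n" by blast
      then show ?thesis
      proof cases
        case 1
        then show ?thesis using k unfolding g diagonal_reflection_def[of k "- k" "\<lambda>n. _ n"] p n
          by (simp add: field_simps)
      next
        case 2
        then show ?thesis using k unfolding g diagonal_reflection_def[of k "- k" "\<lambda>n. _ n"] p n
          by (simp add: field_simps)
      next
        case 3
        have "diagonal_reflection k (- k) (?g (diagonal_reflection k (- k) x)) n = - 2 * ?c * (diagonal_reflection k (- k) x k * diagonal_reflection k (- k) x (- k))"
          using 3 k unfolding g by (simp add: diagonal_reflection_def[of k "- k" "\<lambda>n. _ n"] mult.assoc)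
        also have "\<dots> = - ?c * (x k * x k - x (- k) * x (- k))" unfolding p sq by simp
        finally show ?thesis using 3 k by simp
      next
        case 4
        then show ?thesis using k unfolding g by (simp add: diagonal_reflection_def[of k "- k" "\<lambda>n. _ n"])
      qed
    qed
    consider "n = k + k" | "n = - (k + k)" | "n = k" | "n = - k"
      | "n \<noteq> k + k" "n \<noteq> - (k + k)" "n \<noteq> k" "n \<noteq> - k" by blast
    then show ?thesis unfolding h
      by cases (use k in \<open>simp_all add: rotation_field_def triad_field_def algebra_simps\<close>)
  qed
  have "splitting ?I (\<lambda>x. diagonal_reflection k (- k) (?g (diagonal_reflection k (- k) x)))
      (\<lambda>h x. diagonal_reflection k (- k) (rotation_step k (- ?n) (- k) 0 ?c h (rotation_step (- k) (- ?n) k 0 ?c h (diagonal_reflection k (- k) x))))"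
    using k by (intro splitting_conj[OF _ _ _ _ splitting_add[OF _ 3 4]]) auto
  then have 5: "splitting ?I (\<lambda>x n. diagonal_reflection k (- k) (?g (diagonal_reflection k (- k) x)) n)
      (\<lambda>h x. diagonal_reflection k (- k) (rotation_step k (- ?n) (- k) 0 ?c h (rotation_step (- k) (- ?n) k 0 ?c h (diagonal_reflection k (- k) x))))" .
  have fin: "finite ?I" by simp
  from splitting_cong[OF eq splitting_add[OF fin splitting_add[OF fin 1 2] 5]]
  show ?thesis by blast
qed

text \<open>Mode n can take part as the sum k + l or as the factor k; since l \<ge> 1 it is never
  both. The conjugate of \<open>u l\<close> appears as \<open>u (- l)\<close>.\<close>

lemma triad_field_complex:
  assumes "1 \<le> k" "1 \<le> l" "0 < n" and u: "u = of_real_coords x"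
  shows "Complex (triad_field k l x n) (triad_field k l x (- n)) =
    sqrt 2 * ((if l = n - k then - \<i> * of_int k * u k * u (n - k) else 0) +
              (if k = n then - \<i> * of_int k * u (n + l) * u (- l) else 0))"
proof -
  have s2: "sqrt 2 * sqrt 2 = 2" "sqrt 2 * (sqrt 2 * y) = 2 * y" for y :: real
    by (simp_all add: mult.assoc[symmetric])
  consider "l = n - k" | "k = n" | "l \<noteq> n - k" "k \<noteq> n" by blast
  then show ?thesis
  proof cases
    case 1
    then have n: "n = k + l" by simp
    have "Complex (triad_field k l x n) (triad_field k l x (- n)) = sqrt 2 * (- \<i> * of_int k * u k * u l)"
      using assms(1-3) unfolding n triad_field_def u
      by (simp add: of_real_coords_def complex_eq_iff field_simps s2)
    then show ?thesis using assms(1-3) unfolding n by simp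
  next
    case 2
    have "Complex (triad_field k l x k) (triad_field k l x (- k)) = sqrt 2 * (- \<i> * of_int k * u (k + l) * u (- l))"
      using assms(1-3) unfolding triad_field_def u
      by (simp add: of_real_coords_def complex_eq_iff field_simps s2)
    then show ?thesis using assms(1-3) 2 by simp
  next
    case 3
    then show ?thesis using assms(1-3) by (auto simp: triad_field_def complex_eq_iff)
  qed
qed

lemma dispersion_field_complex:
  assumes "0 < n" "0 < m" and u: "u = of_real_coords x"
  shows "Complex (dispersion_field N m x n) (dispersion_field N m x (- n)) =
    (if m = n then sqrt 2 * (\<i> * of_int (n ^ 3) * u n - (if n \<le> int N then \<i> * of_int n * u 0 * u n else 0)) else 0)"
proof -
  have s2: "sqrt 2 * sqrt 2 = 2" "sqrt 2 * (sqrt 2 * y) = 2 * y" for y :: real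
    by (simp_all add: mult.assoc[symmetric])
  show ?thesis
    using assms(1,2) unfolding u dispersion_field_def rotation_field_def
    by (simp add: of_real_coords_def complex_eq_iff field_simps s2)
qed

text \<open>Pairs are ordered: (k, l) and (l, k) carry the factors k and l of one interaction.
  Separating them is what makes each piece conserve energy with one mode held as a
  parameter.\<close>

definition kdv_pairs :: "nat \<Rightarrow> (int \<times> int) set" where
  "kdv_pairs N = (SIGMA k:{1..int N}. {1..int N - k})"

text \<open>Coordinates n and -n together form \<open>sqrt 2\<close> times the complex mode n, so it
  suffices to compare positive modes and to see that both sides vanish at 0. Pairs with k + l = n
  reproduce the sum over smaller frequencies, pairs with k = n the sum over larger ones.\<close>

lemma kdv_field_decomposition:
  assumes j: "\<bar>j\<bar> \<le> int K"
  shows "(\<Sum>n\<in>{1..int K}. dispersion_field N n x j) + (\<Sum>e\<in>kdv_pairs N. triad_field (fst e) (snd e) x j)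
    = kdv_field N x j"
proof -
  define u where "u = of_real_coords x"
  define \<Delta> where "\<Delta> j = (\<Sum>n\<in>{1..int K}. dispersion_field N n x j) + (\<Sum>e\<in>kdv_pairs N. triad_field (fst e) (snd e) x j)" for j
  have pos: "Complex (\<Delta> n) (\<Delta> (- n)) = sqrt 2 * kdv_drift N u n" if n: "0 < n" "n \<le> int K" for n
  proof -
    have "Complex (\<Delta> n) (\<Delta> (- n)) =
       (\<Sum>m\<in>{1..int K}. Complex (dispersion_field N m x n) (dispersion_field N m x (- n))) +
       (\<Sum>e\<in>kdv_pairs N. Complex (triad_field (fst e) (snd e) x n) (triad_field (fst e) (snd e) x (- n)))"
      unfolding \<Delta>_def by (simp add: complex_eq_iff)
    also have "(\<Sum>m\<in>{1..int K}. Complex (dispersion_field N m x n) (dispersion_field N m x (- n)))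
      = (\<Sum>m\<in>{1..int K}. if m = n then sqrt 2 * (\<i> * of_int (n ^ 3) * u n - (if n \<le> int N then \<i> * of_int n * u 0 * u n else 0)) else 0)"
      using n by (intro sum.cong dispersion_field_complex u_def) auto
    also have "\<dots> = sqrt 2 * (\<i> * of_int (n ^ 3) * u n - (if n \<le> int N then \<i> * of_int n * u 0 * u n else 0))"
      using n by (subst sum.delta) auto
    also have "(\<Sum>e\<in>kdv_pairs N. Complex (triad_field (fst e) (snd e) x n) (triad_field (fst e) (snd e) x (- n)))
      = (\<Sum>(k, l)\<in>kdv_pairs N. sqrt 2 * ((if l = n - k then - \<i> * of_int k * u k * u (n - k) else 0) +
              (if k = n then - \<i> * of_int k * u (n + l) * u (- l) else 0)))"
    proof (rule sum.cong[OF refl])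
      fix e assume e: "e \<in> kdv_pairs N"
      obtain k l where kl: "e = (k, l)" by (cases e)
      have "1 \<le> k" "1 \<le> l" using e by (auto simp: kl kdv_pairs_def)
      from triad_field_complex[OF this n(1) u_def]
      show "Complex (triad_field (fst e) (snd e) x n) (triad_field (fst e) (snd e) x (- n)) =
        (case e of (k, l) \<Rightarrow> sqrt 2 * ((if l = n - k then - \<i> * of_int k * u k * u (n - k) else 0) +
              (if k = n then - \<i> * of_int k * u (n + l) * u (- l) else 0)))"
        by (simp only: kl fst_conv snd_conv prod.case)
    qed
    also have "\<dots> = sqrt 2 * ((\<Sum>(k, l)\<in>kdv_pairs N. if l = n - k then - \<i> * of_int k * u k * u (n - k) else 0) +
        (\<Sum>(k, l)\<in>kdv_pairs N. if k = n then - \<i> * of_int k * u (n + l) * u (- l) else 0))"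
      by (simp only: sum_distrib_left[symmetric] sum.distrib case_prod_unfold)
    also have "(\<Sum>(k, l)\<in>kdv_pairs N. if l = n - k then - \<i> * of_int k * u k * u (n - k) else 0)
      = (if n \<le> int N then - \<i> * (\<Sum>k\<in>{1..n - 1}. of_int k * u k * u (n - k)) else 0)"
    proof -
      have "(\<Sum>(k, l)\<in>kdv_pairs N. if l = n - k then - \<i> * of_int k * u k * u (n - k) else 0)
        = (\<Sum>k\<in>{1..int N}. \<Sum>l\<in>{1..int N - k}. if l = n - k then - \<i> * of_int k * u k * u (n - k) else 0)"
        unfolding kdv_pairs_def by (rule sum.Sigma[symmetric]) auto
      also have "\<dots> = (\<Sum>k\<in>{1..int N}. if k \<le> n - 1 \<and> n \<le> int N then - \<i> * of_int k * u k * u (n - k) else 0)"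
        by (intro sum.cong refl, subst sum.delta) auto
      also have "\<dots> = (\<Sum>k\<in>{k \<in> {1..int N}. k \<le> n - 1 \<and> n \<le> int N}. - \<i> * of_int k * u k * u (n - k))"
        by (rule sum.inter_filter[symmetric]) simp
      also have "{k \<in> {1..int N}. k \<le> n - 1 \<and> n \<le> int N} = (if n \<le> int N then {1..n - 1} else {})"
        by auto
      finally show ?thesis by (simp add: sum_distrib_left mult.assoc sum_negf)
    qed
    also have "(\<Sum>(k, l)\<in>kdv_pairs N. if k = n then - \<i> * of_int k * u (n + l) * u (- l) else 0)
      = (if n \<le> int N then - \<i> * (\<Sum>l\<in>{1..int N - n}. of_int n * u (n + l) * u (- l)) else 0)"
    proof -
      have "(\<Sum>(k, l)\<in>kdv_pairs N. if k = n then - \<i> * of_int k * u (n + l) * u (- l) else 0)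
        = (\<Sum>k\<in>{1..int N}. \<Sum>l\<in>{1..int N - k}. if k = n then - \<i> * of_int k * u (n + l) * u (- l) else 0)"
        unfolding kdv_pairs_def by (rule sum.Sigma[symmetric]) auto
      also have "\<dots> = (\<Sum>k\<in>{1..int N}. if k = n then (\<Sum>l\<in>{1..int N - n}. - \<i> * of_int n * u (n + l) * u (- l)) else 0)"
        by (intro sum.cong refl) auto
      also have "\<dots> = (if n \<le> int N then (\<Sum>l\<in>{1..int N - n}. - \<i> * of_int n * u (n + l) * u (- l)) else 0)"
        using n by (subst sum.delta) auto
      finally show ?thesis by (simp add: sum_distrib_left mult.assoc sum_negf)
    qed
    finally have "Complex (\<Delta> n) (\<Delta> (- n)) = sqrt 2 * (\<i> * of_int (n ^ 3) * u n - (if n \<le> int N then \<i> * of_int n * u 0 * u n else 0))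
        + sqrt 2 * ((if n \<le> int N then - \<i> * (\<Sum>k\<in>{1..n - 1}. of_int k * u k * u (n - k)) else 0)
        + (if n \<le> int N then - \<i> * (\<Sum>l\<in>{1..int N - n}. of_int n * u (n + l) * u (- l)) else 0))" .
    \<comment> \<open>The remaining identity is pure algebra; it is stated with free variables so
      that the sums remain opaque.\<close>
    moreover have "r * (a - (if c then \<i> * b * u0 * un else 0)) + r * ((if c then - \<i> * p else 0) + (if c then - \<i> * q else 0))
        = r * (a - (if c then \<i> * (b * u0 * un + p + q) else 0))" for r a b u0 un p q :: complex and c
      by (cases c) (simp_all add: algebra_simps)
    ultimately show ?thesis
      unfolding kdv_drift_pos[OF n(1)] by (simp only:)
  qed
  have "\<Delta> j = kdv_field N x j"
  proof -
    consider "j = 0" | "j > 0" | "j < 0" by linarith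
    then show ?thesis
    proof cases
      case 1
      have "\<Delta> 0 = 0"
        unfolding \<Delta>_def by (auto simp: dispersion_field_def rotation_field_def triad_field_def kdv_pairs_def intro!: sum.neutral)
      moreover have "kdv_field N x 0 = 0"
        using kdv_drift_zero[OF real_valued_of_real_coords, of N x] by (simp add: kdv_field_def real_coords_def)
      ultimately show ?thesis using 1 by simp
    next
      case 2
      then have "Re (Complex (\<Delta> j) (\<Delta> (- j))) = Re (sqrt 2 * kdv_drift N u j)" using pos[of j] j by simp
      then show ?thesis using 2 by (simp add: kdv_field_def real_coords_def u_def)
    next
      case 3
      then have "Im (Complex (\<Delta> (- j)) (\<Delta> (- (- j)))) = Im (sqrt 2 * kdv_drift N u (- j))"
        using pos[of "- j"] j by simp
      then show ?thesis using 3 by (simp add: kdv_field_def real_coords_def u_def)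
    qed
  qed
  then show ?thesis by (simp add: \<Delta>_def)
qed

text \<open>A window with K \<ge> N contains every interacting triad, and higher modes only turn in
  their own plane. The map \<open>S\<close> depends on \<open>K\<close>, as more planes have to be
  turned in a larger window.\<close>

lemma kdv_splitting:
  assumes "N \<le> K"
  shows "\<exists>S. splitting {- int K..int K} (kdv_field N) S"
proof -
  let ?I = "{- int K..int K}"
  have "\<exists>S. splitting ?I (\<lambda>x j. \<Sum>n\<in>{1..int K}. dispersion_field N n x j) S"
  proof (rule splitting_sum)
    fix n assume "n \<in> {1..int K}"
    then have "splitting ?I (rotation_field n (- n) 0 a b) (rotation_step n (- n) 0 a b)" for a b
      by (intro splitting_rotation) auto
    then show "\<exists>S. splitting ?I (dispersion_field N n) S"
      unfolding dispersion_field_def by blast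
  qed auto
  then obtain S where S: "splitting ?I (\<lambda>x j. \<Sum>n\<in>{1..int K}. dispersion_field N n x j) S" ..
  have "\<exists>S. splitting ?I (\<lambda>x j. \<Sum>e\<in>kdv_pairs N. triad_field (fst e) (snd e) x j) S"
  proof (rule splitting_sum)
    fix e assume "e \<in> kdv_pairs N"
    then have "1 \<le> fst e" "1 \<le> snd e" "fst e + snd e \<le> int K"
      using assms by (auto simp: kdv_pairs_def)
    then show "\<exists>S. splitting ?I (triad_field (fst e) (snd e)) S"
      using splitting_triad_distinct[of "fst e" "snd e" "int K"] splitting_triad_diagonal[of "fst e" "int K"]
      by (cases "fst e = snd e") auto
  qed (auto simp: kdv_pairs_def)
  then obtain T where T: "splitting ?I (\<lambda>x j. \<Sum>e\<in>kdv_pairs N. triad_field (fst e) (snd e) x j) T" ..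
  have "splitting ?I (kdv_field N) (\<lambda>h x. S h (T h x))"
    by (rule splitting_cong[OF kdv_field_decomposition splitting_add[OF _ S T]]) auto
  then show ?thesis by blast
qed

section \<open>Independence of the noise increments and law of the scheme\<close>

lemma (in prob_space) indep_vars_subsingleton:
  assumes "\<And>t. t \<in> T \<Longrightarrow> X t \<in> measurable M (M' t)" "\<And>s t. s \<in> T \<Longrightarrow> t \<in> T \<Longrightarrow> s = t"
  shows "indep_vars M' X T"
  unfolding indep_vars_def2
proof (intro conjI ballI indep_setsI)
  fix A J assume J: "J \<noteq> {}" "J \<subseteq> T" "finite J"
  then obtain t where "J = {t}" using assms(2) by blast
  then show "prob (\<Inter>j\<in>J. A j) = (\<Prod>j\<in>J. prob (A j))" by simp
qed (use assms(1) in auto)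

text \<open>Independence by grouping: \<open>p t\<close> names the block of \<open>X t\<close>,
  distinct blocks are independent since they are functions of distinct \<open>Y i\<close>, and
  inside a block independence is assumed. It is nested below to pass from modes to real and
  imaginary parts and to time increments.\<close>

lemma (in prob_space) indep_vars_blocks:
  assumes Y: "indep_vars N Y I"
    and p: "\<And>t. t \<in> T \<Longrightarrow> p t \<in> I"
    and \<phi>: "\<And>t. t \<in> T \<Longrightarrow> \<phi> t \<in> measurable (N (p t)) (M' t)"
    and X: "\<And>t \<omega>. t \<in> T \<Longrightarrow> \<omega> \<in> space M \<Longrightarrow> X t \<omega> = \<phi> t (Y (p t) \<omega>)"
    and blk: "\<And>i. i \<in> I \<Longrightarrow> indep_vars M' X {t \<in> T. p t = i}"
  shows "indep_vars M' X T"
  unfolding indep_vars_def2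
proof (intro conjI ballI indep_setsI)
  show rv: "X t \<in> measurable M (M' t)" if "t \<in> T" for t
    using blk[OF p[OF that]] that by (auto simp: indep_vars_def2)
  then show "{X t -` A \<inter> space M |A. A \<in> sets (M' t)} \<subseteq> events" if "t \<in> T" for t
    using that by (auto intro: measurable_sets)
  fix A J assume J: "J \<noteq> {}" "J \<subseteq> T" "finite J"
    and A: "\<forall>j\<in>J. A j \<in> {X j -` A \<inter> space M |A. A \<in> sets (M' j)}"
  then have "\<forall>j\<in>J. \<exists>B. A j = X j -` B \<inter> space M \<and> B \<in> sets (M' j)" by blast
  then obtain B where B: "\<And>j. j \<in> J \<Longrightarrow> A j = X j -` B j \<inter> space M" "\<And>j. j \<in> J \<Longrightarrow> B j \<in> sets (M' j)"
    by metis
  have pJ: "p ` J \<subseteq> I" using J(2) p by blast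
  define J' where "J' i = {t \<in> J. p t = i}" for i
  \<comment> \<open>The requirements on all members of block \<open>i\<close>, expressed as one
    event for the single variable \<open>Y i\<close>.\<close>
  define C where "C i = {y \<in> space (N i). \<forall>t\<in>J' i. \<phi> t y \<in> B t}" for i
  have Yrv: "Y i \<in> measurable M (N i)" if "i \<in> I" for i
    using Y that by (auto simp: indep_vars_def2)
  have C: "C i \<in> sets (N i)" for i
    unfolding C_def
  proof (rule sets.sets_Collect_finite_All)
    show "finite (J' i)" using J by (simp add: J'_def)
    fix t assume t: "t \<in> J' i"
    then have "\<phi> t -` B t \<inter> space (N i) \<in> sets (N i)"
      using \<phi>[of t] B(2)[of t] J by (intro measurable_sets) (auto simp: J'_def)
    moreover have "\<phi> t -` B t \<inter> space (N i) = {y \<in> space (N i). \<phi> t y \<in> B t}" by auto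
    ultimately show "{y \<in> space (N i). \<phi> t y \<in> B t} \<in> sets (N i)" by simp
  qed
  have YC: "Y i -` C i \<inter> space M = (\<Inter>t\<in>J' i. A t)" if i: "i \<in> p ` J" for i
  proof -
    have iI: "i \<in> I" using i J p by auto
    have "\<omega> \<in> Y i -` C i \<longleftrightarrow> \<omega> \<in> (\<Inter>t\<in>J' i. A t)" if \<omega>: "\<omega> \<in> space M" for \<omega>
    proof -
      have "Y i \<omega> \<in> space (N i)" using Yrv[OF iI] \<omega> by (rule measurable_space)
      moreover have "\<phi> t (Y i \<omega>) = X t \<omega>" if "t \<in> J' i" for t
        using that J X[OF _ \<omega>, of t] by (auto simp: J'_def)
      ultimately show ?thesis using B(1) \<omega> by (auto simp: C_def J'_def)
    qed
    moreover have "(\<Inter>t\<in>J' i. A t) \<subseteq> space M" using i B(1) by (auto simp: J'_def)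
    ultimately show ?thesis by blast
  qed
  have "(\<Inter>t\<in>J. A t) = (\<Inter>i\<in>p ` J. Y i -` C i \<inter> space M)"
    using YC by (auto simp: J'_def)
  then have "prob (\<Inter>t\<in>J. A t) = (\<Prod>i\<in>p ` J. prob (Y i -` C i \<inter> space M))"
    using indep_varsD[OF Y, of "p ` J" C] J C pJ by simp
  also have "\<dots> = (\<Prod>i\<in>p ` J. \<Prod>t\<in>J' i. prob (A t))"
  proof (rule prod.cong[OF refl])
    fix i assume i: "i \<in> p ` J"
    then have iI: "i \<in> I" using J p by auto
    have J'A: "(\<Inter>t\<in>J' i. A t) = (\<Inter>t\<in>J' i. X t -` B t \<inter> space M)"
      using B(1) by (intro INF_cong) (auto simp: J'_def)
    have "prob (\<Inter>t\<in>J' i. X t -` B t \<inter> space M) = (\<Prod>t\<in>J' i. prob (X t -` B t \<inter> space M))"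
      using J B(2) i by (intro indep_varsD[OF blk[OF iI]]) (auto simp: J'_def)
    also have "\<dots> = (\<Prod>t\<in>J' i. prob (A t))" using B(1) by (intro prod.cong) (auto simp: J'_def)
    finally show "prob (Y i -` C i \<inter> space M) = (\<Prod>t\<in>J' i. prob (A t))"
      unfolding YC[OF i] J'A .
  qed
  also have "\<dots> = (\<Prod>t\<in>J. prob (A t))"
    unfolding J'_def using J by (intro prod.group) auto
  finally show "prob (\<Inter>t\<in>J. A t) = (\<Prod>t\<in>J. prob (A t))" .
qed

lemma (in prob_space) indep_vars_reindex:
  assumes X: "indep_vars M' X I" and f: "inj_on f J" "f ` J \<subseteq> I"
  shows "indep_vars (\<lambda>j. M' (f j)) (\<lambda>j. X (f j)) J"
proof (rule indep_vars_blocks[OF X, of J f "\<lambda>_ x. x"])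
  fix i assume "i \<in> I"
  show "indep_vars (\<lambda>j. M' (f j)) (\<lambda>j. X (f j)) {t \<in> J. f t = i}"
    using X f by (intro indep_vars_subsingleton) (auto simp: indep_vars_def2 dest: inj_onD)
qed (use f in auto)

lemma (in prob_space) distr_eq_gauss_seq:
  assumes X: "indep_vars (\<lambda>_. borel) X (UNIV :: int set)" and g: "\<And>n. distr M borel (X n) = gauss v"
  shows "distr M borel (\<lambda>\<omega> n. X n \<omega>) = gauss_seq v"
proof -
  have rv: "X n \<in> borel_measurable M" for n using X by (auto simp: indep_vars_def2)
  have "distr M borel (\<lambda>\<omega> n. X n \<omega>) = distr M (Pi\<^sub>M UNIV (\<lambda>_. borel)) (\<lambda>\<omega>. \<lambda>n\<in>UNIV. X n \<omega>)"
    by (rule distr_cong) (auto simp: sets_PiM_equal_borel)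
  also have "\<dots> = (\<Pi>\<^sub>M n\<in>UNIV. distr M borel (X n))"
    using indep_vars_iff_distr_eq_PiM[of UNIV X "\<lambda>_. borel"] X rv by auto
  finally show ?thesis by (simp add: g gauss_seq_def)
qed

lemma real_gaussian_distr:
  assumes "prob_space M" "real_gaussian M v X" "v > 0" "c > 0"
  shows "distr M borel (\<lambda>\<omega>. c * X \<omega>) = gauss (c\<^sup>2 * v)" "X \<in> borel_measurable M"
proof -
  interpret prob_space M by fact
  have d: "distributed M lborel X (\<lambda>x. ennreal (normal_density 0 (sqrt v) x))"
    using assms(2) by (simp add: real_gaussian_def)
  then show "X \<in> borel_measurable M" by (auto simp: distributed_def)
  have "distributed M lborel (\<lambda>\<omega>. 0 + c * X \<omega>) (normal_density (0 + c * 0) (\<bar>c\<bar> * sqrt v))"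
    using d assms by (intro normal_density_affine) auto
  moreover have "\<bar>c\<bar> * sqrt v = sqrt (c\<^sup>2 * v)" using assms(4) by (simp add: real_sqrt_mult)
  ultimately have "distributed M lborel (\<lambda>\<omega>. c * X \<omega>) (normal_density 0 (sqrt (c\<^sup>2 * v)))" by simp
  then have "distr M lborel (\<lambda>\<omega>. c * X \<omega>) = gauss (c\<^sup>2 * v)"
    by (simp add: distributed_def gauss_def)
  moreover have "distr M borel (\<lambda>\<omega>. c * X \<omega>) = distr M lborel (\<lambda>\<omega>. c * X \<omega>)"
    by (rule distr_cong) auto
  ultimately show "distr M borel (\<lambda>\<omega>. c * X \<omega>) = gauss (c\<^sup>2 * v)" by simp
qed

text \<open>Independence is assembled in two layers, by the modulus of the index (distinct complex
  modes) and then by its sign (real against imaginary part). The factors \<open>c n\<close> turn the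
  variances 1 and 1/2 into \<open>\<alpha>\<close>.\<close>

lemma white_noise_coords:
  assumes g: "gaussian_coeffs M g" and \<alpha>: "\<alpha> > 0"
  shows "distr M borel (\<lambda>\<omega>. real_coords (\<lambda>n. complex_of_real (sqrt \<alpha>) * g n \<omega>)) = gauss_seq \<alpha>"
    and "(\<lambda>\<omega>. real_coords (\<lambda>n. complex_of_real (sqrt \<alpha>) * g n \<omega>)) \<in> borel_measurable M"
proof -
  have P: "prob_space M" using g by (simp add: gaussian_coeffs_def)
  interpret prob_space M by fact
  define c :: "int \<Rightarrow> real" where "c n = sqrt \<alpha> * (if n = 0 then 1 else sqrt 2)" for n
  define B where "B n \<omega> = (if n \<ge> 0 then Re (g n \<omega>) else Im (g (- n) \<omega>))" for n \<omega>
  have X: "real_coords (\<lambda>n. complex_of_real (sqrt \<alpha>) * g n \<omega>) n = c n * B n \<omega>" for n \<omega>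
    by (auto simp: real_coords_def c_def B_def)
  have cpos: "c n > 0" for n using \<alpha> by (simp add: c_def)
  have Bg: "real_gaussian M (if n = 0 then 1 else 1 / 2) (B n)" for n
    using g unfolding gaussian_coeffs_def B_def by (cases "n = 0"; cases "n > 0") auto
  have Bd: "distr M borel (\<lambda>\<omega>. c n * B n \<omega>) = gauss \<alpha>" and Brv: "B n \<in> borel_measurable M" for n
  proof -
    have "(c n)\<^sup>2 * (if n = 0 then 1 else 1 / 2) = \<alpha>"
      using \<alpha> by (auto simp: c_def power_mult_distrib)
    then show "distr M borel (\<lambda>\<omega>. c n * B n \<omega>) = gauss \<alpha>"
      using real_gaussian_distr(1)[OF P Bg[of n] _ cpos[of n]] by auto
    show "B n \<in> borel_measurable M"
      using real_gaussian_distr(2)[OF P Bg[of n] _ cpos[of n]] by auto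
  qed
  have "indep_vars (\<lambda>_. borel) (\<lambda>n \<omega>. c n * B n \<omega>) UNIV"
  proof (rule indep_vars_blocks[where I="{0..}" and Y=g and N="\<lambda>_. borel" and p=abs
        and \<phi>="\<lambda>n z. c n * (if n \<ge> 0 then Re z else Im z)"])
    show "indep_vars (\<lambda>_. borel) g {0..}" using g by (simp add: gaussian_coeffs_def)
    show "(\<lambda>z. c n * (if n \<ge> 0 then Re z else Im z)) \<in> borel_measurable borel" for n
      by (cases "n \<ge> 0") auto
    show "c n * B n \<omega> = c n * (if n \<ge> 0 then Re (g \<bar>n\<bar> \<omega>) else Im (g \<bar>n\<bar> \<omega>))" for n \<omega>
      by (auto simp: B_def)
    fix k :: int assume k: "k \<in> {0..}"
    show "indep_vars (\<lambda>_. borel) (\<lambda>n \<omega>. c n * B n \<omega>) {n \<in> UNIV. \<bar>n\<bar> = k}"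
    proof (cases "k = 0")
      case True
      then show ?thesis using Brv by (intro indep_vars_subsingleton) auto
    next
      case False
      have "indep_var borel (\<lambda>\<omega>. Re (g k \<omega>)) borel (\<lambda>\<omega>. Im (g k \<omega>))"
        using g False by (simp add: gaussian_coeffs_def)
      then have iv: "indep_vars (case_bool borel borel) (case_bool (\<lambda>\<omega>. Re (g k \<omega>)) (\<lambda>\<omega>. Im (g k \<omega>))) UNIV"
        by (simp add: indep_var_def)
      show ?thesis
      proof (rule indep_vars_blocks[OF iv, where p="\<lambda>n. n > 0" and \<phi>="\<lambda>n x. c n * x"])
        show "(*) (c n) \<in> case_bool borel borel (0 < n) \<rightarrow>\<^sub>M borel" for n by (cases "n > 0") auto
        show "c n * B n \<omega> = c n * case_bool (\<lambda>\<omega>. Re (g k \<omega>)) (\<lambda>\<omega>. Im (g k \<omega>)) (0 < n) \<omega>"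
          if "n \<in> {n \<in> UNIV. \<bar>n\<bar> = k}" for n \<omega>
          using that False by (auto simp: B_def)
        show "indep_vars (\<lambda>_. borel) (\<lambda>n \<omega>. c n * B n \<omega>) {n \<in> {n \<in> UNIV. \<bar>n\<bar> = k}. (0 < n) = b}" for b
          using Brv by (intro indep_vars_subsingleton) auto
      qed auto
    qed
  qed auto
  from distr_eq_gauss_seq[OF this Bd]
  show "distr M borel (\<lambda>\<omega>. real_coords (\<lambda>n. complex_of_real (sqrt \<alpha>) * g n \<omega>)) = gauss_seq \<alpha>"
    unfolding X[symmetric] .
  show "(\<lambda>\<omega>. real_coords (\<lambda>n. complex_of_real (sqrt \<alpha>) * g n \<omega>)) \<in> borel_measurable M"
    by (rule measurable_coordinatewise_then_product)
       (unfold X, intro borel_measurable_times borel_measurable_const Brv)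
qed

definition noise_increment ::
  "(int \<Rightarrow> real \<Rightarrow> 'b \<Rightarrow> complex) \<Rightarrow> real \<Rightarrow> real \<Rightarrow> 'b \<Rightarrow> nat \<Rightarrow> int \<Rightarrow> real" where
  "noise_increment \<beta> a h \<omega> j n =
     real_coords (\<lambda>n. \<beta> n (a + real (Suc j) * h) \<omega>) n - real_coords (\<lambda>n. \<beta> n (a + real j * h) \<omega>) n"

text \<open>Three layers of grouping: distinct modes, real against imaginary paths of one mode,
  disjoint time intervals of one real path. The first two use independence of whole paths, of which
  an increment is a function of two evaluations.\<close>

lemma noise_increments:
  assumes \<beta>: "brownian_coeffs P \<beta>" and a: "a \<ge> 0" and h: "h > 0"
  shows "prob_space.indep_vars P (\<lambda>_. borel) (\<lambda>(n, j) \<omega>. noise_increment \<beta> a h \<omega> j n) (UNIV \<times> {..<m})"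
    and "distr P borel (\<lambda>\<omega>. noise_increment \<beta> a h \<omega> j n) = gauss h"
    and "(\<lambda>\<omega>. noise_increment \<beta> a h \<omega> j n) \<in> borel_measurable P"
proof -
  have P: "prob_space P" using \<beta> by (simp add: brownian_coeffs_def)
  interpret prob_space P by fact
  define c :: "int \<Rightarrow> real" where "c n = (if n = 0 then 1 else sqrt 2)" for n
  define v :: "int \<Rightarrow> real" where "v n = (if n = 0 then 1 else 1/2)" for n
  define B where "B n t \<omega> = (if n \<ge> 0 then Re (\<beta> n t \<omega>) else Im (\<beta> (- n) t \<omega>))" for n t \<omega>
  define \<tau> where "\<tau> j = a + real j * h" for j :: nat
  have \<tau>: "\<tau> j \<ge> 0" "\<tau> j < \<tau> (Suc j)" "\<tau> (Suc j) - \<tau> j = h" for j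
    using a h by (auto simp: \<tau>_def algebra_simps)
  have mono: "mono \<tau>" using h by (auto simp: mono_def \<tau>_def intro: mult_right_mono)
  have X: "noise_increment \<beta> a h \<omega> j n = c n * (B n (\<tau> (Suc j)) \<omega> - B n (\<tau> j) \<omega>)" for n j \<omega>
    by (auto simp: noise_increment_def real_coords_def c_def B_def \<tau>_def algebra_simps)
  have cpos: "c n > 0" and vpos: "v n > 0" and cv: "(c n)\<^sup>2 * (v n * h) = h" for n
    by (auto simp: c_def v_def)
  have BM: "real_brownian P (v n) (B n)" for n
    using \<beta> unfolding brownian_coeffs_def B_def v_def by (cases "n = 0"; cases "n > 0") auto
  have gi: "real_gaussian P (v n * h) (\<lambda>\<omega>. B n (\<tau> (Suc j)) \<omega> - B n (\<tau> j) \<omega>)" for n j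
    using BM[of n] \<tau>[of j] unfolding real_brownian_def by metis
  have vh: "v n * h > 0" for n using vpos h by simp
  show "distr P borel (\<lambda>\<omega>. noise_increment \<beta> a h \<omega> j n) = gauss h" for j n
    unfolding X using real_gaussian_distr(1)[OF P gi[of n j] vh cpos[of n]] unfolding cv .
  have Brv: "(\<lambda>\<omega>. B n (\<tau> (Suc j)) \<omega> - B n (\<tau> j) \<omega>) \<in> borel_measurable P" for n j
    using real_gaussian_distr(2)[OF P gi vh cpos] .
  then show rv: "(\<lambda>\<omega>. noise_increment \<beta> a h \<omega> j n) \<in> borel_measurable P" for j n
    unfolding X by measurable
  let ?X = "\<lambda>(n, j) \<omega>. noise_increment \<beta> a h \<omega> j n"
  let ?N = "Pi\<^sub>M {0..} (\<lambda>_::real. borel)"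
  \<comment> \<open>The innermost layer, where the independent increments of one real Brownian
    motion are used.\<close>
  have line: "indep_vars (\<lambda>_. borel) ?X ({n} \<times> {..<m})" for n
  proof (rule indep_vars_blocks[where I="{..<m}" and Y="\<lambda>j \<omega>. B n (\<tau> (Suc j)) \<omega> - B n (\<tau> j) \<omega>"
        and N="\<lambda>_. borel" and p=snd and \<phi>="\<lambda>_ x. c n * x"])
    show "indep_vars (\<lambda>_. borel) (\<lambda>j \<omega>. B n (\<tau> (Suc j)) \<omega> - B n (\<tau> j) \<omega>) {..<m}"
      using BM[of n] mono \<tau>(1)[of 0] unfolding real_brownian_def by blast
    show "indep_vars (\<lambda>_. borel) ?X {t \<in> {n} \<times> {..<m}. snd t = j}" for j
      using rv by (intro indep_vars_subsingleton) auto
  qed (auto simp: X)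
  show "indep_vars (\<lambda>_. borel) ?X (UNIV \<times> {..<m})"
  proof (rule indep_vars_blocks[where I="{0..}" and Y="\<lambda>n \<omega>. \<lambda>t\<in>{0..}. \<beta> n t \<omega>"
        and N="\<lambda>_. Pi\<^sub>M {0..} (\<lambda>_. borel)" and p="\<lambda>t. \<bar>fst t\<bar>"
        and \<phi>="\<lambda>(n, j) y. c n * (if n \<ge> 0 then Re (y (\<tau> (Suc j)) - y (\<tau> j)) else Im (y (\<tau> (Suc j)) - y (\<tau> j)))"])
    show "indep_vars (\<lambda>_. Pi\<^sub>M {0..} (\<lambda>_. borel)) (\<lambda>n \<omega>. \<lambda>t\<in>{0..}. \<beta> n t \<omega>) {0..}"
      using \<beta> by (simp add: brownian_coeffs_def)
    show "(case t of (n, j) \<Rightarrow> \<lambda>y. c n * (if n \<ge> 0 then Re (y (\<tau> (Suc j)) - y (\<tau> j)) else Im (y (\<tau> (Suc j)) - y (\<tau> j))))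
        \<in> borel_measurable (Pi\<^sub>M {0..} (\<lambda>_. borel))" for t
    proof (cases t)
      case (Pair n j)
      have m: "(\<lambda>y. y (\<tau> (Suc j)) - y (\<tau> j)) \<in> measurable (Pi\<^sub>M {0..} (\<lambda>_::real. borel)) (borel :: complex measure)"
        using \<tau>(1) by (intro borel_measurable_diff measurable_component_singleton) auto
      have "(\<lambda>y. Re (y (\<tau> (Suc j)) - y (\<tau> j))) \<in> borel_measurable (Pi\<^sub>M {0..} (\<lambda>_::real. borel))"
        "(\<lambda>y. Im (y (\<tau> (Suc j)) - y (\<tau> j))) \<in> borel_measurable (Pi\<^sub>M {0..} (\<lambda>_::real. borel))"
        by (rule measurable_compose[OF m]; measurable)+
      then show ?thesis unfolding Pair by (cases "n \<ge> 0") (auto intro!: borel_measurable_times)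
    qed
    show "?X t \<omega> = (case t of (n, j) \<Rightarrow> \<lambda>y. c n * (if n \<ge> 0 then Re (y (\<tau> (Suc j)) - y (\<tau> j)) else Im (y (\<tau> (Suc j)) - y (\<tau> j))))
        (\<lambda>s\<in>{0..}. \<beta> \<bar>fst t\<bar> s \<omega>)" for t \<omega>
      using \<tau>(1) by (cases t) (auto simp: X B_def)
    fix k :: int assume k: "k \<in> {0..}"
    show "indep_vars (\<lambda>_. borel) ?X {t \<in> UNIV \<times> {..<m}. \<bar>fst t\<bar> = k}"
    proof (cases "k = 0")
      case True
      then have "{t \<in> UNIV \<times> {..<m}. \<bar>fst t\<bar> = k} = {0} \<times> {..<m}" by auto
      then show ?thesis using line by simp
    next
      case False
      let ?Y = "case_bool (\<lambda>\<omega>. \<lambda>t\<in>{0..}. Re (\<beta> k t \<omega>)) (\<lambda>\<omega>. \<lambda>t\<in>{0..}. Im (\<beta> k t \<omega>))"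
      have "indep_var ?N (\<lambda>\<omega>. \<lambda>t\<in>{0..}. Re (\<beta> k t \<omega>)) ?N (\<lambda>\<omega>. \<lambda>t\<in>{0..}. Im (\<beta> k t \<omega>))"
        using \<beta> False by (simp add: brownian_coeffs_def)
      then have iv: "indep_vars (case_bool ?N ?N) ?Y UNIV"
        by (simp add: indep_var_def)
      show ?thesis
      proof (rule indep_vars_blocks[OF iv, where p="\<lambda>t. fst t > 0"
            and \<phi>="\<lambda>t y. c (fst t) * (y (\<tau> (Suc (snd t))) - y (\<tau> (snd t)))"])
        have "(\<lambda>y. c (fst t) * (y (\<tau> (Suc (snd t))) - y (\<tau> (snd t)))) \<in> borel_measurable ?N" for t
          using \<tau>(1) by (intro borel_measurable_times borel_measurable_diff measurable_component_singleton) auto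
        then show "(\<lambda>y. c (fst t) * (y (\<tau> (Suc (snd t))) - y (\<tau> (snd t)))) \<in> case_bool ?N ?N (0 < fst t) \<rightarrow>\<^sub>M borel" for t
          by (cases "fst t > 0") auto
        show "?X t \<omega> = c (fst t) * (?Y (0 < fst t) \<omega> (\<tau> (Suc (snd t))) - ?Y (0 < fst t) \<omega> (\<tau> (snd t)))"
          if "t \<in> {t \<in> UNIV \<times> {..<m}. \<bar>fst t\<bar> = k}" for t \<omega>
          using that False \<tau>(1) by (cases t) (auto simp: X B_def)
        fix b :: bool
        have "{t \<in> {t \<in> UNIV \<times> {..<m}. \<bar>fst t\<bar> = k}. (0 < fst t) = b} = {if b then k else - k} \<times> {..<m}"
          using False k by auto
        then show "indep_vars (\<lambda>_. borel) ?X {t \<in> {t \<in> UNIV \<times> {..<m}. \<bar>fst t\<bar> = k}. (0 < fst t) = b}"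
          using line by simp
      qed auto
    qed
  qed auto
qed

section \<open>Law of the discrete scheme\<close>

lemma measurable_split_scheme:
  assumes S: "\<And>h. S h \<in> borel_measurable borel"
    and x: "x \<in> borel_measurable M" and d: "\<And>i. i < j \<Longrightarrow> (\<lambda>\<omega>. d \<omega> i) \<in> borel_measurable M"
  shows "(\<lambda>\<omega>. split_scheme S h (x \<omega>) (d \<omega>) j) \<in> borel_measurable M"
  using d
proof (induction j)
  case 0
  then show ?case using x by simp
next
  case (Suc j)
  then have "(\<lambda>\<omega>. S h (split_scheme S h (x \<omega>) (d \<omega>) j)) \<in> borel_measurable M"
    by (intro measurable_compose[OF _ S]) auto
  note 1 = measurable_compose[OF this measurable_product_coordinates]
  note 2 = measurable_compose[OF Suc.prems[of j] measurable_product_coordinates]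
  show ?case
    unfolding split_scheme.simps
    by (rule measurable_coordinatewise_then_product, rule borel_measurable_add[OF 1 2]) simp
qed

lemma split_scheme_cong:
  "(\<And>i. i < j \<Longrightarrow> d i = d' i) \<Longrightarrow> split_scheme S h x d j = split_scheme S h x d' j"
  by (induction j) auto

text \<open>Induction over the steps: the drift map keeps the variance, and the next increment,
  independent of the start and of all earlier increments, adds \<open>h\<close> by convolution. The
  start \<open>x\<close> is integrated last, so independence is needed only for fixed
  \<open>x\<close>.\<close>

lemma split_scheme_law:
  assumes S: "\<And>h. measure_preserving_seq (S h)" and v: "v > 0" and h: "h > 0" and P: "prob_space P"
    and ind: "prob_space.indep_vars P (\<lambda>_. borel) (\<lambda>(n, j) \<omega>. d \<omega> j n) (UNIV \<times> {..<m})"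
    and g: "\<And>j n. j < m \<Longrightarrow> distr P borel (\<lambda>\<omega>. d \<omega> j n) = gauss h"
    and j: "j \<le> m"
  shows "distr (gauss_seq v \<Otimes>\<^sub>M P) borel (\<lambda>(x, \<omega>). split_scheme S h x (d \<omega>) j) = gauss_seq (v + j * h)"
proof -
  interpret prob_space P by fact
  interpret gv: prob_space "gauss_seq v" by (rule prob_space_gauss_seq[OF v])
  interpret gh: prob_space "gauss_seq h" by (rule prob_space_gauss_seq[OF h])
  interpret gP: pair_prob_space "gauss_seq v" P ..
  have Sm: "S k \<in> borel_measurable borel" for k using S by (simp add: measure_preserving_seq_def)
  have rv: "(\<lambda>\<omega>. d \<omega> i n) \<in> borel_measurable P" if "i < m" for i n
    using ind that by (auto simp: indep_vars_def2)
  have dm: "(\<lambda>\<omega>. d \<omega> i) \<in> borel_measurable P" if "i < m" for i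
    by (rule measurable_coordinatewise_then_product) (rule rv[OF that])
  have dlaw: "distr P borel (\<lambda>\<omega>. d \<omega> i) = gauss_seq h" if i: "i < m" for i
  proof (rule distr_eq_gauss_seq[of "\<lambda>n \<omega>. d \<omega> i n"])
    show "indep_vars (\<lambda>_. borel) (\<lambda>n \<omega>. d \<omega> i n) UNIV"
      using indep_vars_reindex[OF ind, of "\<lambda>n. (n, i)" UNIV] i by (auto simp: inj_on_def)
  qed (rule g[OF i])
  \<comment> \<open>The state after \<open>i\<close> steps depends on the increments with index
    strictly below \<open>i\<close>, hence not on increment \<open>i\<close>, which is the next one
    to be added.\<close>
  have past: "indep_var borel (\<lambda>\<omega>. split_scheme S h x (d \<omega>) i) borel (\<lambda>\<omega>. d \<omega> i)" if i: "i < m" for i x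
  proof -
    let ?A = "(UNIV :: int set) \<times> {..<i}" and ?B = "(UNIV :: int set) \<times> {i}"
    have "indep_var (PiM ?A (\<lambda>_. borel)) (\<lambda>\<omega>. \<lambda>t\<in>?A. (\<lambda>(n, j) \<omega>. d \<omega> j n) t \<omega>)
        (PiM ?B (\<lambda>_. borel)) (\<lambda>\<omega>. \<lambda>t\<in>?B. (\<lambda>(n, j) \<omega>. d \<omega> j n) t \<omega>)"
      using i by (intro indep_var_restrict[OF ind]) auto
    then have iv: "indep_var borel ((\<lambda>r. split_scheme S h x (\<lambda>k n. r (n, k)) i) \<circ> (\<lambda>\<omega>. \<lambda>t\<in>?A. (\<lambda>(n, j) \<omega>. d \<omega> j n) t \<omega>))
        borel ((\<lambda>r n. r (n, i)) \<circ> (\<lambda>\<omega>. \<lambda>t\<in>?B. (\<lambda>(n, j) \<omega>. d \<omega> j n) t \<omega>))"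
    proof (rule indep_var_compose)
      show "(\<lambda>r. split_scheme S h x (\<lambda>k n. r (n, k)) i) \<in> borel_measurable (PiM ?A (\<lambda>_. borel))"
        by (rule measurable_split_scheme[OF Sm])
           (auto intro!: measurable_coordinatewise_then_product measurable_component_singleton)
      show "(\<lambda>r n. r (n, i) :: real) \<in> borel_measurable (PiM ?B (\<lambda>_. borel))"
        by (rule measurable_coordinatewise_then_product, rule measurable_component_singleton) simp
    qed
    have "(\<lambda>r. split_scheme S h x (\<lambda>k n. r (n, k)) i) \<circ> (\<lambda>\<omega>. \<lambda>t\<in>?A. (\<lambda>(n, j) \<omega>. d \<omega> j n) t \<omega>)
        = (\<lambda>\<omega>. split_scheme S h x (d \<omega>) i)"
      by (auto simp: fun_eq_iff intro!: fun_cong[OF split_scheme_cong])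
    moreover have "(\<lambda>r n. r (n, i)) \<circ> (\<lambda>\<omega>. \<lambda>t\<in>?B. (\<lambda>(n, j) \<omega>. d \<omega> j n) t \<omega>) = (\<lambda>\<omega>. d \<omega> i)"
      by (auto simp: fun_eq_iff)
    ultimately show ?thesis using iv by simp
  qed
  have Xm: "(\<lambda>(x, \<omega>). split_scheme S h x (d \<omega>) i) \<in> borel_measurable (gauss_seq v \<Otimes>\<^sub>M P)" if "i \<le> m" for i
    unfolding case_prod_unfold
    using that by (intro measurable_split_scheme[OF Sm]) (auto intro!: measurable_compose[OF measurable_snd dm])
  have addm: "(\<lambda>(y, z). \<lambda>n. y n + z n) \<in> borel_measurable (borel \<Otimes>\<^sub>M (borel :: (int \<Rightarrow> real) measure))"
    by (rule measurable_coordinatewise_then_product)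
       (unfold case_prod_unfold, rule borel_measurable_add;
         rule measurable_compose[OF _ measurable_product_coordinates], simp)
  show ?thesis
    using j
  proof (induction j)
    case 0
    have "distr (gauss_seq v \<Otimes>\<^sub>M P) borel (\<lambda>(x, \<omega>). x) = distr (gauss_seq v \<Otimes>\<^sub>M P) (gauss_seq v) fst"
      by (rule distr_cong) auto
    also have "\<dots> = gauss_seq v" by (rule distr_pair_fst)
    finally show ?case by simp
  next
    case (Suc i)
    let ?w = "v + i * h"
    have w: "?w > 0" using v h by (simp add: add_pos_nonneg)
    interpret gw: prob_space "gauss_seq ?w" by (rule prob_space_gauss_seq[OF w])
    interpret gwh: pair_prob_space "gauss_seq ?w" "gauss_seq h" ..
    have i: "i < m" using Suc.prems by simp
    note IH = Suc.IH[OF less_imp_le[OF i]]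
    show ?case
    proof (rule measure_eqI)
      fix A assume "A \<in> sets (distr (gauss_seq v \<Otimes>\<^sub>M P) borel (\<lambda>(x, \<omega>). split_scheme S h x (d \<omega>) (Suc i)))"
      then have A: "A \<in> sets borel" by simp
      define f :: "(int \<Rightarrow> real) \<times> (int \<Rightarrow> real) \<Rightarrow> ennreal" where "f = (\<lambda>p. indicator A (\<lambda>n. fst p n + snd p n))"
      have fm: "f \<in> borel_measurable (borel \<Otimes>\<^sub>M borel)"
        unfolding f_def using measurable_compose[OF addm borel_measurable_indicator[OF A]] by (simp add: case_prod_unfold)
      have fS: "(\<lambda>p. f (S h (fst p), snd p)) \<in> borel_measurable (borel \<Otimes>\<^sub>M borel)"
        by (rule measurable_compose[OF _ fm]) (intro measurable_Pair measurable_compose[OF measurable_fst Sm] measurable_snd)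
      \<comment> \<open>The last increment integrated out, as a function of the state just before it
        is added.\<close>
      define H where "H y = (\<integral>\<^sup>+z. f (y, z) \<partial>gauss_seq h)" for y
      have Hm: "H \<in> borel_measurable borel"
        unfolding H_def using fm by (intro gh.borel_measurable_nn_integral) (simp add: case_prod_unfold)
      have "emeasure (distr (gauss_seq v \<Otimes>\<^sub>M P) borel (\<lambda>(x, \<omega>). split_scheme S h x (d \<omega>) (Suc i))) A
          = (\<integral>\<^sup>+p. indicator A (split_scheme S h (fst p) (d (snd p)) (Suc i)) \<partial>(gauss_seq v \<Otimes>\<^sub>M P))"
        using nn_integral_distr[OF Xm[OF Suc.prems], of "indicator A"] A
        by (simp add: case_prod_unfold)
      also have "\<dots> = (\<integral>\<^sup>+x. \<integral>\<^sup>+\<omega>. indicator A (split_scheme S h x (d \<omega>) (Suc i)) \<partial>P \<partial>gauss_seq v)"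
        using measurable_compose[OF Xm[OF Suc.prems] borel_measurable_indicator[OF A]]
        by (subst nn_integral_fst[symmetric]) (auto simp: case_prod_unfold)
      also have "\<dots> = (\<integral>\<^sup>+x. \<integral>\<^sup>+\<omega>. H (S h (split_scheme S h x (d \<omega>) i)) \<partial>P \<partial>gauss_seq v)"
      proof (rule nn_integral_cong)
        fix x
        let ?Y = "\<lambda>\<omega>. split_scheme S h x (d \<omega>) i"
        have Ym: "?Y \<in> borel_measurable P"
          using i by (intro measurable_split_scheme[OF Sm] dm) auto
        have pair: "distr P borel ?Y \<Otimes>\<^sub>M gauss_seq h = distr P (borel \<Otimes>\<^sub>M borel) (\<lambda>\<omega>. (?Y \<omega>, d \<omega> i))"
          using past[OF i, of x] unfolding indep_var_distribution_eq dlaw[OF i] by blast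
        interpret dY: prob_space "distr P borel ?Y" by (rule prob_space_distr[OF Ym])
        interpret q: pair_prob_space "distr P borel ?Y" "gauss_seq h" ..
        have "(\<integral>\<^sup>+\<omega>. indicator A (split_scheme S h x (d \<omega>) (Suc i)) \<partial>P)
          = (\<integral>\<^sup>+\<omega>. (\<lambda>p. f (S h (fst p), snd p)) (?Y \<omega>, d \<omega> i) \<partial>P)"
          by (simp add: f_def)
        also have "\<dots> = (\<integral>\<^sup>+p. f (S h (fst p), snd p) \<partial>(distr P (borel \<Otimes>\<^sub>M borel) (\<lambda>\<omega>. (?Y \<omega>, d \<omega> i))))"
          using Ym dm[OF i] fS by (subst nn_integral_distr) auto
        also have "\<dots> = (\<integral>\<^sup>+y. \<integral>\<^sup>+z. f (S h y, z) \<partial>gauss_seq h \<partial>distr P borel ?Y)"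
          unfolding pair[symmetric] using fS by (subst gh.nn_integral_fst[symmetric]) auto
        also have "\<dots> = (\<integral>\<^sup>+y. H (S h y) \<partial>distr P borel ?Y)" by (simp add: H_def)
        also have "\<dots> = (\<integral>\<^sup>+\<omega>. H (S h (?Y \<omega>)) \<partial>P)"
          using Ym measurable_compose[OF Sm Hm] by (subst nn_integral_distr) auto
        finally show "(\<integral>\<^sup>+\<omega>. indicator A (split_scheme S h x (d \<omega>) (Suc i)) \<partial>P) = (\<integral>\<^sup>+\<omega>. H (S h (?Y \<omega>)) \<partial>P)" .
      qed
      also have "\<dots> = (\<integral>\<^sup>+p. H (S h (split_scheme S h (fst p) (d (snd p)) i)) \<partial>(gauss_seq v \<Otimes>\<^sub>M P))"
        using measurable_compose[OF Xm[OF less_imp_le[OF i]] measurable_compose[OF Sm Hm]]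
        by (subst nn_integral_fst[symmetric]) (auto simp: case_prod_unfold)
      also have "\<dots> = (\<integral>\<^sup>+y. H (S h y) \<partial>distr (gauss_seq v \<Otimes>\<^sub>M P) borel (\<lambda>(x, \<omega>). split_scheme S h x (d \<omega>) i))"
        using nn_integral_distr[OF Xm[OF less_imp_le[OF i]], of "\<lambda>y. H (S h y)"] measurable_compose[OF Sm Hm]
        by (simp add: case_prod_unfold)
      also have "\<dots> = (\<integral>\<^sup>+y. H (S h y) \<partial>gauss_seq ?w)" unfolding IH ..
      also have "\<dots> = (\<integral>\<^sup>+y. H y \<partial>distr (gauss_seq ?w) borel (S h))"
        using Sm Hm by (subst nn_integral_distr) auto
      also have "\<dots> = (\<integral>\<^sup>+y. H y \<partial>gauss_seq ?w)"
        using S[of h] w by (simp add: measure_preserving_seq_def)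
      also have "\<dots> = (\<integral>\<^sup>+p. f p \<partial>(gauss_seq ?w \<Otimes>\<^sub>M gauss_seq h))"
        unfolding H_def using fm by (subst gh.nn_integral_fst[symmetric]) auto
      also have "\<dots> = (\<integral>\<^sup>+y. indicator A y \<partial>distr (gauss_seq ?w \<Otimes>\<^sub>M gauss_seq h) borel (\<lambda>(y, z). \<lambda>n. y n + z n))"
        using addm A by (subst nn_integral_distr) (auto simp: f_def case_prod_unfold)
      also have "\<dots> = emeasure (gauss_seq (v + Suc i * h)) A"
        unfolding gauss_seq_convolution[OF w h] using A by (simp add: algebra_simps)
      finally show "emeasure (distr (gauss_seq v \<Otimes>\<^sub>M P) borel (\<lambda>(x, \<omega>). split_scheme S h x (d \<omega>) (Suc i))) A
        = emeasure (gauss_seq (v + Suc i * h)) A" .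
    qed simp
  qed
qed

section \<open>The flow and its law\<close>

text \<open>Pointwise limits of random sequences carry over only to continuous observables, so the
  law of the limit has to be recognised from these. Closed sets generate the Borel sets and are
  stable under intersection.\<close>

lemma measure_eqI_bounded_continuous:
  fixes M N :: "'a::metric_space measure"
  assumes M: "prob_space M" "sets M = sets borel" and N: "prob_space N" "sets N = sets borel"
    and eq: "\<And>f :: 'a \<Rightarrow> real. continuous_on UNIV f \<Longrightarrow> (\<And>x. 0 \<le> f x \<and> f x \<le> 1) \<Longrightarrow> integral\<^sup>L M f = integral\<^sup>L N f"
  shows "M = N"
proof -
  interpret M: prob_space M by fact
  interpret N: prob_space N by fact
  have spM: "space M = UNIV" and spN: "space N = UNIV"
    using sets_eq_imp_space_eq[OF M(2)] sets_eq_imp_space_eq[OF N(2)] by simp_all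
  have closed_eq: "emeasure M C = emeasure N C" if C: "closed C" for C
  proof (cases "C = {}")
    case False
    \<comment> \<open>Continuous, equal to 1 on \<open>C\<close>, and eventually 0 at each point off
      \<open>C\<close> because a closed set has positive distance from such a point.\<close>
    define f where "f m x = max 0 (1 - real m * infdist x C)" for m x
    have fc: "continuous_on UNIV (f m)" for m
      unfolding f_def by (intro continuous_intros)
    have f01: "0 \<le> f m x \<and> f m x \<le> 1" for m x
      unfolding f_def by (auto simp: infdist_nonneg)
    have flim: "(\<lambda>m. f m x) \<longlonglongrightarrow> indicator C x" for x
    proof (cases "x \<in> C")
      case True
      then show ?thesis by (simp add: f_def)
    next
      case False
      then have pos: "infdist x C > 0"
        using C \<open>C \<noteq> {}\<close> by (metis in_closed_iff_infdist_zero infdist_nonneg less_eq_real_def)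
      obtain k :: nat where k: "1 / infdist x C < real k" using reals_Archimedean2 by blast
      have "f m x = 0" if "m \<ge> k" for m
      proof -
        have "1 < real k * infdist x C" using k pos by (simp add: divide_less_eq)
        also have "\<dots> \<le> real m * infdist x C" using that pos by (intro mult_right_mono) auto
        finally show ?thesis by (simp add: f_def)
      qed
      then have "\<forall>\<^sub>F m in sequentially. f m x = 0" by (rule eventually_sequentiallyI)
      then show ?thesis using False by (simp add: tendsto_eventually)
    qed
    have lim: "(\<lambda>m. integral\<^sup>L Q (f m)) \<longlonglongrightarrow> measure Q C" if Q: "prob_space Q" "sets Q = sets borel" for Q
    proof -
      interpret Q: prob_space Q by fact
      have fm: "f m \<in> borel_measurable Q" for m
        using borel_measurable_continuous_onI[OF fc] by (simp add: measurable_cong_sets[OF Q(2) refl])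
      have CQ: "C \<in> sets Q" using C Q(2) by simp
      have "(\<lambda>m. integral\<^sup>L Q (f m)) \<longlonglongrightarrow> integral\<^sup>L Q (indicator C)"
      proof (rule integral_dominated_convergence[where w="\<lambda>_. 1"])
        show "indicator C \<in> borel_measurable Q" using CQ by (rule borel_measurable_indicator)
        show "AE x in Q. norm (f m x) \<le> 1" for m using f01 by simp
      qed (use fm flim in auto)
      then show ?thesis using CQ sets.sets_into_space[OF CQ] by (simp add: Int_absorb2)
    qed
    have "(\<lambda>m. integral\<^sup>L M (f m)) = (\<lambda>m. integral\<^sup>L N (f m))"
      using eq[OF fc f01] by blast
    then have "measure M C = measure N C"
      using lim[OF M] lim[OF N] by (metis LIMSEQ_unique)
    then show ?thesis by (simp add: M.emeasure_eq_measure N.emeasure_eq_measure)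
  qed simp
  show ?thesis
  proof (rule measure_eqI_generator_eq[of "Collect closed" UNIV M N "\<lambda>_. UNIV"])
    show "Int_stable (Collect closed)" by (auto simp: Int_stable_def)
    show "sets M = sigma_sets UNIV (Collect closed)" "sets N = sigma_sets UNIV (Collect closed)"
      unfolding M(2) N(2) borel_eq_closed by (simp_all add: sets_measure_of)
    show "emeasure M UNIV \<noteq> \<infinity>" using M.emeasure_space_1 spM by simp
  qed (use closed_eq in auto)
qed

lemma tendsto_fun_coordinatewise:
  fixes Y :: "nat \<Rightarrow> 'i \<Rightarrow> 'b::topological_space"
  assumes "\<And>i. (\<lambda>m. Y m i) \<longlonglongrightarrow> y i"
  shows "Y \<longlonglongrightarrow> y"
proof -
  have "limitin (product_topology (\<lambda>i. euclidean) UNIV) Y y sequentially"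
    using assms by (simp add: limitin_componentwise)
  then show ?thesis by (simp add: euclidean_product_topology)
qed

section \<open>Pathwise solutions and the flow\<close>

lemma kdv_drift_cnj:
  assumes "real_valued a"
  shows "kdv_drift N a (- n) = cnj (kdv_drift N a n)"
proof -
  have c: "a (- k) = cnj (a k)" for k using assms by (simp add: real_valued_def)
  define p where "p = proj N a"
  have pc: "p (- k) = cnj (p k)" for k by (simp add: p_def proj_def c)
  have pd: "dx p (- k) = cnj (dx p k)" for k by (simp add: dx_def pc)
  have fin: "mult p (dx p) m = (\<Sum>k\<in>{- int N..int N}. p k * dx p (m - k))" for m
    unfolding p_def by (rule mult_proj_eq_sum)
  have "mult p (dx p) (- n) = (\<Sum>k\<in>{- int N..int N}. p (- k) * dx p (- (n - k)))"
    unfolding fin by (rule sum.reindex_bij_witness[of _ uminus uminus]) auto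
  also have "\<dots> = cnj (mult p (dx p) n)"
    unfolding fin pc pd by simp
  finally have "proj N (mult p (dx p)) (- n) = cnj (proj N (mult p (dx p)) n)"
    by (simp add: proj_def[of N "mult p (dx p)"])
  moreover have "dx (dx (dx a)) (- n) = cnj (dx (dx (dx a)) n)" by (simp add: dx_def c)
  ultimately show ?thesis
    unfolding kdv_drift_def p_def[symmetric] by (simp only: complex_cnj_diff complex_cnj_minus)
qed

text \<open>Low modes form a closed system, and each high mode evolves on its own. This decoupling
  allows solutions from different windows to be glued.\<close>

lemma kdv_drift_cong:
  assumes "a n = b n" "\<bar>n\<bar> \<le> int N \<Longrightarrow> (\<And>k. \<bar>k\<bar> \<le> int N \<Longrightarrow> a k = b k)"
  shows "kdv_drift N a n = kdv_drift N b n"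
proof (cases "\<bar>n\<bar> \<le> int N")
  case True
  then have "proj N a = proj N b" using assms(2) by (auto simp: proj_def)
  then show ?thesis using assms(1) by (simp add: kdv_drift_def dx_def)
next
  case False
  then show ?thesis using assms(1) by (simp add: kdv_drift_def dx_def proj_def[of N "mult _ _"])
qed

lemma kdv_drift_continuous_on:
  assumes u: "\<And>n. continuous_on A (\<lambda>t. u t n)"
  shows "continuous_on A (\<lambda>t. kdv_drift N (u t) n)"
proof -
  have p: "continuous_on A (\<lambda>t. proj N (u t) k)" for k
    using u[of k] by (cases "\<bar>k\<bar> \<le> int N") (simp_all add: proj_def)
  have d: "continuous_on A (\<lambda>t. dx (proj N (u t)) k)" for k
    unfolding dx_def by (intro continuous_on_mult p continuous_on_const)
  have m: "continuous_on A (\<lambda>t. mult (proj N (u t)) (dx (proj N (u t))) n)"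
    unfolding mult_proj_eq_sum by (intro continuous_on_sum continuous_on_mult p d)
  have "continuous_on A (\<lambda>t. proj N (mult (proj N (u t)) (dx (proj N (u t)))) n)"
    unfolding proj_def[of N "mult _ _"] using m by (cases "\<bar>n\<bar> \<le> int N") simp_all
  moreover have "continuous_on A (\<lambda>t. dx (dx (dx (u t))) n)"
    unfolding dx_def by (intro continuous_on_mult u continuous_on_const)
  ultimately show ?thesis
    unfolding kdv_drift_def by (intro continuous_on_diff continuous_on_minus)
qed

lemma real_coords_continuous_on:
  assumes "\<And>n. continuous_on A (\<lambda>t. u t n)"
  shows "continuous_on A (\<lambda>t. real_coords (u t) n)"
proof -
  have "continuous_on A (\<lambda>t. Re (u t k))" "continuous_on A (\<lambda>t. Im (u t k))" for k
    using assms[of k] by (auto intro: continuous_on_Re continuous_on_Im)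
  then show ?thesis
    unfolding real_coords_def by (cases "n = 0"; cases "n > 0") (auto intro!: continuous_on_mult continuous_on_const)
qed

lemma of_real_coords_continuous_on:
  assumes "\<And>n. continuous_on A (\<lambda>t. x t n)"
  shows "continuous_on A (\<lambda>t. of_real_coords (x t) n)"
proof -
  have "of_real_coords (x t) n = complex_of_real (if n = 0 then x t 0 else x t \<bar>n\<bar> / sqrt 2)
      + \<i> * complex_of_real (if n = 0 then 0 else sgn (real_of_int n) * x t (- \<bar>n\<bar>) / sqrt 2)" for t
    by (auto simp: of_real_coords_def complex_eq_iff)
  moreover have "continuous_on A (\<lambda>t. if n = 0 then x t 0 else x t \<bar>n\<bar> / sqrt 2)"
    "continuous_on A (\<lambda>t. if n = 0 then 0 else sgn (real_of_int n) * x t (- \<bar>n\<bar>) / sqrt 2)"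
    using assms by (cases "n = 0"; auto intro!: continuous_on_divide continuous_on_mult continuous_on_const)+
  ultimately show ?thesis
    by (simp only:) (intro continuous_on_add continuous_on_mult continuous_on_const continuous_on_of_real)
qed

lemma real_coords_integral:
  fixes g :: "real \<Rightarrow> coeffs"
  assumes "\<And>n. (\<lambda>r. g r n) integrable_on A"
  shows "real_coords (\<lambda>n. integral A (\<lambda>r. g r n)) n = integral A (\<lambda>r. real_coords (g r) n)"
proof -
  have R: "Re (integral A (\<lambda>r. g r k)) = integral A (\<lambda>r. Re (g r k))" for k
    using integral_linear[OF assms[of k] bounded_linear_Re] by (simp add: comp_def)
  have I: "Im (integral A (\<lambda>r. g r k)) = integral A (\<lambda>r. Im (g r k))" for k
    using integral_linear[OF assms[of k] bounded_linear_Im] by (simp add: comp_def)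
  show ?thesis
    unfolding real_coords_def by (cases "n = 0"; cases "n > 0") (simp_all add: R I)
qed

lemma solves_kdv_drift_solution:
  assumes u: "solves_kdv N w t1 t2 \<phi> u"
  shows "drift_solution I (kdv_field N) (\<lambda>t. real_coords (\<lambda>n. w n t)) t1 t2 (real_coords \<phi>) (\<lambda>t. real_coords (u t))"
proof -
  have rv: "\<And>t. t \<in> {t1..t2} \<Longrightarrow> real_valued (u t)" and uc: "\<And>n. continuous_on {t1..t2} (\<lambda>t. u t n)"
    and ue: "\<And>n t. t \<in> {t1..t2} \<Longrightarrow> u t n = \<phi> n + integral {t1..t} (\<lambda>r. kdv_drift N (u r) n) + (w n t - w n t1)"
    using u unfolding solves_kdv_def by auto
  show ?thesis
    unfolding drift_solution_def
  proof (intro conjI ballI)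
    show "continuous_on {t1..t2} (\<lambda>t. real_coords (u t) i)" for i
      by (rule real_coords_continuous_on[OF uc])
    fix i t assume t: "t \<in> {t1..t2}"
    have int: "(\<lambda>r. kdv_drift N (u r) n) integrable_on {t1..t}" for n
      by (rule integrable_continuous_real, rule continuous_on_subset[OF kdv_drift_continuous_on[OF uc]]) (use t in auto)
    have "u t = (\<lambda>n. \<phi> n + integral {t1..t} (\<lambda>r. kdv_drift N (u r) n) + (w n t - w n t1))"
      using ue[OF t] by auto
    then have "real_coords (u t) i = real_coords \<phi> i + real_coords (\<lambda>n. integral {t1..t} (\<lambda>r. kdv_drift N (u r) n)) i
        + (real_coords (\<lambda>n. w n t) i - real_coords (\<lambda>n. w n t1) i)"
      by (simp only: real_coords_add real_coords_diff)
    also have "real_coords (\<lambda>n. integral {t1..t} (\<lambda>r. kdv_drift N (u r) n)) i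
        = integral {t1..t} (\<lambda>r. real_coords (kdv_drift N (u r)) i)"
      by (rule real_coords_integral[OF int])
    also have "\<dots> = integral {t1..t} (\<lambda>r. kdv_field N (real_coords (u r)) i)"
      using t by (intro integral_cong) (auto simp: kdv_field_def of_real_coords_real_coords[OF rv])
    finally show "real_coords (u t) i = real_coords \<phi> i + integral {t1..t} (\<lambda>r. kdv_field N (real_coords (u r)) i)
        + (real_coords (\<lambda>n. w n t) i - real_coords (\<lambda>n. w n t1) i)" .
  qed
qed

text \<open>The infinite system is solved window by window, and coordinate \<open>i\<close> is read
  off in a window chosen for it. All low coordinates share the window \<open>N\<close>, so they come
  from one solution; a high coordinate only needs its mirror index, which has the same window. Hence
  the glued path solves the system without any comparison of solutions.\<close>

lemma solves_kdv_exists: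
  assumes t12: "t1 \<le> t2" and \<phi>: "real_valued \<phi>"
    and wc: "\<And>n. continuous_on {t1..t2} (w n)" and wr: "\<And>t. t \<in> {t1..t2} \<Longrightarrow> real_valued (\<lambda>n. w n t)"
  shows "\<exists>u. solves_kdv N w t1 t2 \<phi> u"
proof -
  let ?w = "\<lambda>t. real_coords (\<lambda>n. w n t)" and ?x0 = "real_coords \<phi>"
  have "\<exists>x. drift_solution {- int K..int K} (kdv_field N) ?w t1 t2 ?x0 x" if "N \<le> K" for K
  proof (rule drift_solution_exists[OF _ _ t12])
    show "conservative_field {- int K..int K} (kdv_field N)"
      using kdv_splitting[OF that] splitting_field by blast
    show "continuous_on {t1..t2} (\<lambda>t. ?w t i)" for i
      by (rule real_coords_continuous_on) (rule wc)
  qed simp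
  then obtain x where x: "\<And>K. N \<le> K \<Longrightarrow> drift_solution {- int K..int K} (kdv_field N) ?w t1 t2 ?x0 (x K)"
    by metis
  \<comment> \<open>\<open>N\<close> for every low index and |i| for a high one; in particular the
    same for \<open>i\<close> and \<open>- i\<close>.\<close>
  define \<kappa> where "\<kappa> i = max N (nat \<bar>i\<bar>)" for i :: int
  have \<kappa>: "N \<le> \<kappa> i" "i \<in> {- int (\<kappa> i)..int (\<kappa> i)}" for i by (auto simp: \<kappa>_def)
  define X where "X t i = x (\<kappa> i) t i" for t i
  define u where "u t = of_real_coords (X t)" for t
  have Xc: "continuous_on {t1..t2} (\<lambda>t. X t i)" for i
    using x[OF \<kappa>(1)[of i]] \<kappa>(2)[of i] unfolding X_def drift_solution_def by blast
  have uc: "continuous_on {t1..t2} (\<lambda>t. u t n)" for n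
    unfolding u_def by (rule of_real_coords_continuous_on[OF Xc])
  have ur: "real_valued (u t)" for t by (simp add: u_def real_valued_of_real_coords)
  have field: "kdv_field N (X t) i = kdv_field N (x (\<kappa> i) t) i" for t i
  proof -
    have "of_real_coords (X t) \<bar>i\<bar> = of_real_coords (x (\<kappa> i) t) \<bar>i\<bar>"
      by (auto simp: of_real_coords_def X_def \<kappa>_def)
    moreover have "of_real_coords (X t) k = of_real_coords (x (\<kappa> i) t) k" if "\<bar>i\<bar> \<le> int N" "\<bar>k\<bar> \<le> int N" for k
      using that by (simp add: of_real_coords_def X_def \<kappa>_def)
    ultimately have "kdv_drift N (of_real_coords (X t)) \<bar>i\<bar> = kdv_drift N (of_real_coords (x (\<kappa> i) t)) \<bar>i\<bar>"
      by (intro kdv_drift_cong) auto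
    then show ?thesis by (auto simp: kdv_field_def real_coords_def)
  qed
  have "solves_kdv N w t1 t2 \<phi> u"
    unfolding solves_kdv_def
  proof (intro conjI ballI allI)
    fix n t assume t: "t \<in> {t1..t2}"
    let ?rhs = "\<lambda>n. \<phi> n + integral {t1..t} (\<lambda>r. kdv_drift N (u r) n) + (w n t - w n t1)"
    have int: "(\<lambda>r. kdv_drift N (u r) n) integrable_on {t1..t}" for n
      by (rule integrable_continuous_real, rule continuous_on_subset[OF kdv_drift_continuous_on[OF uc]]) (use t in auto)
    have rv: "real_valued ?rhs"
      unfolding real_valued_def
    proof
      fix n
      have "integral {t1..t} (\<lambda>r. kdv_drift N (u r) (- n)) = cnj (integral {t1..t} (\<lambda>r. kdv_drift N (u r) n))"
        using integral_linear[OF int[of n] bounded_linear_cnj] by (simp add: comp_def kdv_drift_cnj[OF ur])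
      moreover have "\<phi> (- n) = cnj (\<phi> n)" using \<phi> by (simp add: real_valued_def)
      moreover have "w (- n) t = cnj (w n t)" "w (- n) t1 = cnj (w n t1)"
        using wr[OF t] wr[of t1] t12 by (auto simp: real_valued_def)
      ultimately show "?rhs (- n) = cnj (?rhs n)" by simp
    qed
    have rc: "real_coords ?rhs i = X t i" for i
    proof -
      have "real_coords ?rhs i = ?x0 i + real_coords (\<lambda>n. integral {t1..t} (\<lambda>r. kdv_drift N (u r) n)) i + (?w t i - ?w t1 i)"
        by (simp only: real_coords_add real_coords_diff)
      also have "real_coords (\<lambda>n. integral {t1..t} (\<lambda>r. kdv_drift N (u r) n)) i = integral {t1..t} (\<lambda>r. real_coords (kdv_drift N (u r)) i)"
        by (rule real_coords_integral[OF int])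
      also have "\<dots> = integral {t1..t} (\<lambda>r. kdv_field N (x (\<kappa> i) r) i)"
        unfolding field[symmetric] by (simp add: kdv_field_def u_def)
      also have "?x0 i + \<dots> + (?w t i - ?w t1 i) = x (\<kappa> i) t i"
        using x[OF \<kappa>(1)[of i]] \<kappa>(2)[of i] t unfolding drift_solution_def by simp
      finally show ?thesis by (simp add: X_def)
    qed
    \<comment> \<open>Both sides of the equation are real-valued coefficient families, so equality
      of their real coordinates is enough.\<close>
    have e: "real_coords ?rhs = X t" by (rule ext) (rule rc)
    have "u t = of_real_coords (X t)" by (rule u_def)
    also have "\<dots> = of_real_coords (real_coords ?rhs)" by (rule arg_cong[OF e[symmetric]])
    also have "\<dots> = ?rhs" by (rule of_real_coords_real_coords[OF rv])
    finally have "u t = ?rhs" .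
    then show "u t n = \<phi> n + integral {t1..t} (\<lambda>r. kdv_drift N (u r) n) + (w n t - w n t1)"
      by (rule fun_cong)
  qed (use ur uc in auto)
  then show ?thesis by blast
qed

text \<open>This discharges the definite description. Given any solution, uniqueness at the final
  time is checked coordinate by coordinate, each in a window that contains it.\<close>

lemma kdv_flow_eq:
  assumes t12: "t1 \<le> t2" and u: "solves_kdv N w t1 t2 \<phi> u"
  shows "kdv_flow N w t1 t2 \<phi> = u t2"
  unfolding kdv_flow_def
proof (rule the_equality)
  show "\<exists>v. solves_kdv N w t1 t2 \<phi> v \<and> u t2 = v t2" using u by blast
  fix z assume "\<exists>v. solves_kdv N w t1 t2 \<phi> v \<and> z = v t2"
  then obtain v where v: "solves_kdv N w t1 t2 \<phi> v" and z: "z = v t2" by blast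
  have "real_coords (v t2) i = real_coords (u t2) i" for i
  proof -
    define K where "K = max N (nat \<bar>i\<bar>)"
    have K: "N \<le> K" "i \<in> {- int K..int K}" by (auto simp: K_def)
    obtain S where S: "splitting {- int K..int K} (kdv_field N) S" using kdv_splitting[OF K(1)] by blast
    show ?thesis
      by (rule drift_solution_unique[OF _ S t12 solves_kdv_drift_solution[OF v] solves_kdv_drift_solution[OF u] K(2)]) simp
  qed
  then have "of_real_coords (real_coords (v t2)) = of_real_coords (real_coords (u t2))" by presburger
  moreover have "real_valued (v t2)" "real_valued (u t2)" using u v t12 by (auto simp: solves_kdv_def)
  ultimately show "z = u t2" by (simp add: z of_real_coords_real_coords)
qed

lemma kdv_flow_scheme:
  assumes t12: "t1 \<le> t2" and \<phi>: "real_valued \<phi>"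
    and wc: "\<And>n. continuous_on {t1..t2} (w n)" and wr: "\<And>t. t \<in> {t1..t2} \<Longrightarrow> real_valued (\<lambda>n. w n t)"
  shows "real_valued (kdv_flow N w t1 t2 \<phi>)"
    and "splitting {- int K..int K} (kdv_field N) S \<Longrightarrow> \<bar>i\<bar> \<le> int K \<Longrightarrow>
      (\<lambda>m. split_scheme S ((t2 - t1) / m) (real_coords \<phi>)
        (\<lambda>j n. real_coords (\<lambda>n. w n (t1 + Suc j * ((t2 - t1) / m))) n - real_coords (\<lambda>n. w n (t1 + j * ((t2 - t1) / m))) n) m i)
      \<longlonglongrightarrow> real_coords (kdv_flow N w t1 t2 \<phi>) i"
proof -
  obtain u where u: "solves_kdv N w t1 t2 \<phi> u" using solves_kdv_exists[OF t12 \<phi> wc wr] by blast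
  note flow = kdv_flow_eq[OF t12 u]
  show "real_valued (kdv_flow N w t1 t2 \<phi>)" using u t12 by (simp add: flow solves_kdv_def)
  assume S: "splitting {- int K..int K} (kdv_field N) S" and i: "\<bar>i\<bar> \<le> int K"
  have "i \<in> {- int K..int K}" using i by auto
  from split_scheme_tendsto[OF _ S t12 solves_kdv_drift_solution[OF u] this]
  show "(\<lambda>m. split_scheme S ((t2 - t1) / m) (real_coords \<phi>)
        (\<lambda>j n. real_coords (\<lambda>n. w n (t1 + Suc j * ((t2 - t1) / m))) n - real_coords (\<lambda>n. w n (t1 + j * ((t2 - t1) / m))) n) m i)
      \<longlonglongrightarrow> real_coords (kdv_flow N w t1 t2 \<phi>) i"
    by (simp add: flow)
qed

lemma kdv_flow_same_time:
  assumes "solves_kdv N w t t \<phi> u"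
  shows "u t = \<phi>"
  using assms by (auto simp: solves_kdv_def fun_eq_iff)

lemma brownian_paths:
  assumes \<beta>: "brownian_coeffs P \<beta>" and \<omega>: "\<omega> \<in> space P" and t1: "0 \<le> t1"
  shows "continuous_on {t1..t2} (\<lambda>t. \<beta> n t \<omega>)" and "t \<in> {t1..t2} \<Longrightarrow> real_valued (\<lambda>n. \<beta> n t \<omega>)"
proof -
  have sub: "{t1..t2} \<subseteq> {0..}" using t1 by auto
  have c: "continuous_on {t1..t2} (\<lambda>t. B t \<omega>)" if B: "real_brownian P v B" for v B
  proof -
    have "continuous_on {0..} (\<lambda>t. B t \<omega>)" using B \<omega> by (simp add: real_brownian_def)
    then show ?thesis by (rule continuous_on_subset[OF _ sub])
  qed
  have re: "real_brownian P (if n = 0 then 1 else 1 / 2) (\<lambda>t \<omega>. Re (\<beta> n t \<omega>))"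
    and im: "n \<noteq> 0 \<Longrightarrow> real_brownian P (1 / 2) (\<lambda>t \<omega>. Im (\<beta> n t \<omega>))"
    and im0: "\<And>t. 0 \<le> t \<Longrightarrow> Im (\<beta> 0 t \<omega>) = 0"
    using \<beta> \<omega> by (simp_all add: brownian_coeffs_def)
  have "continuous_on {t1..t2} (\<lambda>t. Re (\<beta> n t \<omega>))" by (rule c[OF re])
  moreover have "continuous_on {t1..t2} (\<lambda>t. Im (\<beta> n t \<omega>))"
  proof (cases "n = 0")
    case True
    have "continuous_on {t1..t2} (\<lambda>t. Im (\<beta> 0 t \<omega>)) \<longleftrightarrow> continuous_on {t1..t2} (\<lambda>t. 0 :: real)"
      by (rule continuous_on_cong[OF refl]) (use im0 t1 in simp)
    then show ?thesis using True by simp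
  next
    case False
    then show ?thesis by (intro c[OF im])
  qed
  ultimately have "continuous_on {t1..t2} (\<lambda>t. Complex (Re (\<beta> n t \<omega>)) (Im (\<beta> n t \<omega>)))"
    by (intro continuous_on_Complex)
  then show "continuous_on {t1..t2} (\<lambda>t. \<beta> n t \<omega>)" by simp
  assume "t \<in> {t1..t2}"
  then show "real_valued (\<lambda>n. \<beta> n t \<omega>)"
    using \<beta> \<omega> t1 by (simp add: brownian_coeffs_def real_valued_def)
qed

section \<open>Law of the flow\<close>

definition kdv_flow_coords ::
  "nat \<Rightarrow> (int \<Rightarrow> real \<Rightarrow> 'b \<Rightarrow> complex) \<Rightarrow> real \<Rightarrow> real \<Rightarrow> (int \<Rightarrow> real) \<Rightarrow> 'b \<Rightarrow> int \<Rightarrow> real" where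
  "kdv_flow_coords N \<beta> t1 t2 x \<omega> = real_coords (kdv_flow N (\<lambda>n t. \<beta> n t \<omega>) t1 t2 (of_real_coords x))"

lemma kdv_flow_coords_tendsto:
  assumes \<beta>: "brownian_coeffs P \<beta>" and \<omega>: "\<omega> \<in> space P" and t: "0 \<le> t1" "t1 \<le> t2"
    and S: "splitting {- int K..int K} (kdv_field N) S" and i: "\<bar>i\<bar> \<le> int K"
  shows "(\<lambda>m. split_scheme S ((t2 - t1) / m) x (noise_increment \<beta> t1 ((t2 - t1) / m) \<omega>) m i)
    \<longlonglongrightarrow> kdv_flow_coords N \<beta> t1 t2 x \<omega> i"
  using kdv_flow_scheme(2)[where \<phi>="of_real_coords x", OF t(2) real_valued_of_real_coords brownian_paths[where ?t2.0=t2, OF \<beta> \<omega> t(1)] S i]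
  by (simp add: kdv_flow_coords_def noise_increment_def[abs_def])

lemma measurable_noise_scheme:
  assumes \<beta>: "brownian_coeffs P \<beta>" and t: "0 \<le> t1" "0 < h" and S: "splitting I f S"
  shows "(\<lambda>p. split_scheme S h (fst p) (noise_increment \<beta> t1 h (snd p)) m) \<in> borel_measurable (gauss_seq v \<Otimes>\<^sub>M P)"
proof (rule measurable_split_scheme)
  show "S k \<in> borel_measurable borel" for k
    using splitting_measure_preserving[OF S] by (simp add: measure_preserving_seq_def)
  have "(\<lambda>\<omega>. noise_increment \<beta> t1 h \<omega> j) \<in> borel_measurable P" for j
    by (rule measurable_coordinatewise_then_product) (rule noise_increments(3)[OF \<beta> t])
  then show "(\<lambda>p. noise_increment \<beta> t1 h (snd p) j) \<in> borel_measurable (gauss_seq v \<Otimes>\<^sub>M P)" for j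
    by (rule measurable_compose[OF measurable_snd])
qed simp

text \<open>The definite description gives no measurability by itself; it is inherited from the
  scheme, of which every coordinate of the flow is a pointwise limit.\<close>

lemma measurable_kdv_flow_coords:
  assumes \<beta>: "brownian_coeffs P \<beta>" and t: "0 \<le> t1" "t1 < t2"
  shows "(\<lambda>p. kdv_flow_coords N \<beta> t1 t2 (fst p) (snd p)) \<in> borel_measurable (gauss_seq v \<Otimes>\<^sub>M P)"
proof (rule measurable_coordinatewise_then_product)
  fix i
  define K where "K = max N (nat \<bar>i\<bar>)"
  have K: "N \<le> K" "\<bar>i\<bar> \<le> int K" by (auto simp: K_def)
  obtain S where S: "splitting {- int K..int K} (kdv_field N) S" using kdv_splitting[OF K(1)] by blast
  \<comment> \<open>\<open>Suc m\<close> because the mesh must be positive: division by 0 steps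
    would give 0, for which no increment law is available.\<close>
  let ?h = "\<lambda>m. (t2 - t1) / real (Suc m)"
  show "(\<lambda>p. kdv_flow_coords N \<beta> t1 t2 (fst p) (snd p) i) \<in> borel_measurable (gauss_seq v \<Otimes>\<^sub>M P)"
  proof (rule borel_measurable_LIMSEQ_real)
    fix p assume "p \<in> space (gauss_seq v \<Otimes>\<^sub>M P)"
    then have "snd p \<in> space P" by (auto simp: space_pair_measure)
    from LIMSEQ_Suc[OF kdv_flow_coords_tendsto[OF \<beta> this t(1) less_imp_le[OF t(2)] S K(2)]]
    show "(\<lambda>m. split_scheme S (?h m) (fst p) (noise_increment \<beta> t1 (?h m) (snd p)) (Suc m) i)
      \<longlonglongrightarrow> kdv_flow_coords N \<beta> t1 t2 (fst p) (snd p) i" .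
  next
    show "(\<lambda>p. split_scheme S (?h m) (fst p) (noise_increment \<beta> t1 (?h m) (snd p)) (Suc m) i)
      \<in> borel_measurable (gauss_seq v \<Otimes>\<^sub>M P)" for m
      using t by (intro measurable_compose[OF measurable_noise_scheme[OF \<beta> t(1) _ S] measurable_product_coordinates]) simp
  qed
qed

text \<open>Two limits in succession. For a fixed window the scheme has the right law exactly but
  converges only on that window, so the test function is applied to the truncated sequence.
  Afterwards the window grows, and truncations converge to the full sequence in the product
  topology.\<close>

lemma kdv_flow_coords_law:
  assumes \<beta>: "brownian_coeffs P \<beta>" and t: "0 \<le> t1" "t1 < t2" and v: "v > 0"
  shows "distr (gauss_seq v \<Otimes>\<^sub>M P) borel (\<lambda>p. kdv_flow_coords N \<beta> t1 t2 (fst p) (snd p)) = gauss_seq (v + (t2 - t1))"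
    (is "distr ?M _ ?X = _")
proof -
  have P: "prob_space P" using \<beta> by (simp add: brownian_coeffs_def)
  interpret PP: prob_space P by fact
  interpret G: prob_space "gauss_seq v" by (rule prob_space_gauss_seq[OF v])
  interpret GP: pair_prob_space "gauss_seq v" P ..
  let ?v = "v + (t2 - t1)"
  have v': "?v > 0" using v t by simp
  interpret G': prob_space "gauss_seq ?v" by (rule prob_space_gauss_seq[OF v'])
  have Xm: "?X \<in> borel_measurable ?M" by (rule measurable_kdv_flow_coords[OF \<beta> t])
  \<comment> \<open>Cutting to the window hides the coordinates on which the scheme is not claimed
    to converge.\<close>
  define tr where "tr K x = (\<lambda>i. if \<bar>i\<bar> \<le> int K then x i else 0)" for K and x :: "int \<Rightarrow> real"
  have trc: "continuous_on UNIV (tr K)" for K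
  proof (rule continuous_on_coordinatewise_then_product)
    show "continuous_on UNIV (\<lambda>x. tr K x i)" for i
      unfolding tr_def by (cases "\<bar>i\<bar> \<le> int K") (simp_all add: continuous_on_product_coordinates)
  qed
  have trl: "(\<lambda>K. tr K x) \<longlonglongrightarrow> x" for x
  proof (rule tendsto_fun_coordinatewise)
    fix i
    have "tr K x i = x i" if "K \<ge> nat \<bar>i\<bar>" for K using that by (simp add: tr_def)
    then have "\<forall>\<^sub>F K in sequentially. tr K x i = x i" by (rule eventually_sequentiallyI)
    then show "(\<lambda>K. tr K x i) \<longlonglongrightarrow> x i" by (rule tendsto_eventually)
  qed
  show ?thesis
  proof (rule measure_eqI_bounded_continuous)
    show "prob_space (distr ?M borel ?X)" by (rule GP.P.prob_space_distr[OF Xm])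
    show "prob_space (gauss_seq ?v)" by (rule G'.prob_space_axioms)
    fix f :: "(int \<Rightarrow> real) \<Rightarrow> real" assume fc: "continuous_on UNIV f" and f01: "\<And>x. 0 \<le> f x \<and> f x \<le> 1"
    have fm: "f \<in> borel_measurable borel" using fc by (rule borel_measurable_continuous_onI)
    have flim: "(\<lambda>m. f (y m)) \<longlonglongrightarrow> f z" if "y \<longlonglongrightarrow> z" for y z
      using continuous_on_tendsto_compose[OF fc that] by simp
    have ftr: "(\<lambda>x. f (tr K x)) \<in> borel_measurable borel" for K
      by (rule measurable_compose[OF borel_measurable_continuous_onI[OF trc] fm])
    \<comment> \<open>The integrals of the scheme form a constant sequence, since every mesh gives
      the same law; their limit is the integral for the flow.\<close>
    have trunc: "(\<integral>p. f (tr K (?X p)) \<partial>?M) = (\<integral>x. f (tr K x) \<partial>gauss_seq ?v)" if K: "N \<le> K" for K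
    proof -
      obtain S where S: "splitting {- int K..int K} (kdv_field N) S" using kdv_splitting[OF K] by blast
      define h where "h m = (t2 - t1) / real (Suc m)" for m
      have h: "h m > 0" "v + real (Suc m) * h m = ?v" for m using t by (auto simp: h_def)
      define Y where "Y m p = split_scheme S (h m) (fst p) (noise_increment \<beta> t1 (h m) (snd p)) (Suc m)" for m p
      have Ym: "Y m \<in> borel_measurable ?M" for m
        unfolding Y_def by (rule measurable_noise_scheme[OF \<beta> t(1) h(1) S])
      have Ylaw: "distr ?M borel (Y m) = gauss_seq ?v" for m
      proof -
        have "distr ?M borel (\<lambda>(x, \<omega>). split_scheme S (h m) x (noise_increment \<beta> t1 (h m) \<omega>) (Suc m))
          = gauss_seq (v + real (Suc m) * h m)"
          by (rule split_scheme_law[OF splitting_measure_preserving[OF S] v h(1) P noise_increments(1)[OF \<beta> t(1) h(1)]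
              noise_increments(2)[OF \<beta> t(1) h(1)] order_refl])
        then show ?thesis unfolding h(2) by (simp add: Y_def[abs_def] case_prod_unfold)
      qed
      have "(\<lambda>m. \<integral>p. f (tr K (Y m p)) \<partial>?M) \<longlonglongrightarrow> (\<integral>p. f (tr K (?X p)) \<partial>?M)"
      proof (rule integral_dominated_convergence[where w="\<lambda>_. 1"])
        show "(\<lambda>p. f (tr K (?X p))) \<in> borel_measurable ?M" by (rule measurable_compose[OF Xm ftr])
        show "(\<lambda>p. f (tr K (Y m p))) \<in> borel_measurable ?M" for m by (rule measurable_compose[OF Ym ftr])
        show "AE p in ?M. (\<lambda>m. f (tr K (Y m p))) \<longlonglongrightarrow> f (tr K (?X p))"
        proof (rule AE_I2)
          fix p assume "p \<in> space ?M"
          then have \<omega>: "snd p \<in> space P" by (auto simp: space_pair_measure)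
          show "(\<lambda>m. f (tr K (Y m p))) \<longlonglongrightarrow> f (tr K (?X p))"
          proof (rule flim, rule tendsto_fun_coordinatewise)
            fix i
            show "(\<lambda>m. tr K (Y m p) i) \<longlonglongrightarrow> tr K (?X p) i"
            proof (cases "\<bar>i\<bar> \<le> int K")
              case True
              from LIMSEQ_Suc[OF kdv_flow_coords_tendsto[OF \<beta> \<omega> t(1) less_imp_le[OF t(2)] S True]]
              show ?thesis using True by (simp add: tr_def Y_def h_def)
            qed (simp add: tr_def)
          qed
        qed
        show "AE p in ?M. norm (f (tr K (Y m p))) \<le> 1" for m using f01 by simp
      qed simp
      moreover have "(\<integral>p. f (tr K (Y m p)) \<partial>?M) = (\<integral>x. f (tr K x) \<partial>gauss_seq ?v)" for m
        unfolding Ylaw[of m, symmetric] using Ym ftr by (subst integral_distr) auto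
      ultimately show ?thesis by (simp add: LIMSEQ_const_iff)
    qed
    have lim1: "(\<lambda>K. \<integral>p. f (tr K (?X p)) \<partial>?M) \<longlonglongrightarrow> (\<integral>p. f (?X p) \<partial>?M)"
    proof (rule integral_dominated_convergence[where w="\<lambda>_. 1"])
      show "(\<lambda>p. f (?X p)) \<in> borel_measurable ?M" by (rule measurable_compose[OF Xm fm])
      show "(\<lambda>p. f (tr K (?X p))) \<in> borel_measurable ?M" for K by (rule measurable_compose[OF Xm ftr])
      show "AE p in ?M. (\<lambda>K. f (tr K (?X p))) \<longlonglongrightarrow> f (?X p)" by (rule AE_I2, rule flim, rule trl)
      show "AE p in ?M. norm (f (tr K (?X p))) \<le> 1" for K using f01 by simp
    qed simp
    have lim2: "(\<lambda>K. \<integral>x. f (tr K x) \<partial>gauss_seq ?v) \<longlonglongrightarrow> (\<integral>x. f x \<partial>gauss_seq ?v)"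
    proof (rule integral_dominated_convergence[where w="\<lambda>_. 1"])
      show "f \<in> borel_measurable (gauss_seq ?v)" using fm by simp
      show "(\<lambda>x. f (tr K x)) \<in> borel_measurable (gauss_seq ?v)" for K using ftr by simp
      show "AE x in gauss_seq ?v. (\<lambda>K. f (tr K x)) \<longlonglongrightarrow> f x" by (rule AE_I2, rule flim, rule trl)
      show "AE x in gauss_seq ?v. norm (f (tr K x)) \<le> 1" for K using f01 by simp
    qed simp
    have "\<forall>\<^sub>F K in sequentially. (\<integral>p. f (tr K (?X p)) \<partial>?M) = (\<integral>x. f (tr K x) \<partial>gauss_seq ?v)"
      by (rule eventually_sequentiallyI[of N]) (rule trunc)
    from Lim_transform_eventually[OF lim1 this] have "(\<lambda>K. \<integral>x. f (tr K x) \<partial>gauss_seq ?v) \<longlonglongrightarrow> (\<integral>p. f (?X p) \<partial>?M)" .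
    then have "(\<integral>p. f (?X p) \<partial>?M) = (\<integral>x. f x \<partial>gauss_seq ?v)"
      using lim2 by (rule LIMSEQ_unique)
    then show "integral\<^sup>L (distr ?M borel ?X) f = integral\<^sup>L (gauss_seq ?v) f"
      using Xm fm by (subst integral_distr) auto
  qed simp_all
qed

section \<open>Measurability on Sobolev spaces\<close>

definition sobolev_weight :: "real \<Rightarrow> int \<Rightarrow> real" where
  "sobolev_weight s n = (1 + (real_of_int n)\<^sup>2) powr s"

lemma sobolev_weight_pos: "sobolev_weight s n > 0"
proof -
  have "1 + (real_of_int n)\<^sup>2 > 0" using zero_le_power2[of "real_of_int n"] by linarith
  then show ?thesis by (simp add: sobolev_weight_def)
qed

lemma sobolev_iff:
  "a \<in> sobolev s \<longleftrightarrow> real_valued a \<and> (\<lambda>n. sobolev_weight s n * (cmod (a n))\<^sup>2) summable_on UNIV"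
  by (simp add: sobolev_def sobolev_weight_def)

lemma sobolev_dist_eq:
  "sobolev_dist s a b = sqrt (\<Sum>\<^sub>\<infinity>n. sobolev_weight s n * (cmod (a n - b n))\<^sup>2)"
  by (simp add: sobolev_dist_def sobolev_weight_def)

text \<open>Summability rewritten with quantifiers over naturals only, so that membership in the
  Sobolev space becomes a countable, hence measurable, condition.\<close>

lemma summable_on_int_nonneg_iff:
  fixes f :: "int \<Rightarrow> real"
  assumes "\<And>n. f n \<ge> 0"
  shows "f summable_on UNIV \<longleftrightarrow> (\<exists>B::nat. \<forall>m::nat. (\<Sum>n\<in>{- int m..int m}. f n) \<le> real B)"
proof
  assume f: "f summable_on UNIV"
  obtain B :: nat where B: "infsum f UNIV \<le> real B" using real_arch_simple by blast
  have "(\<Sum>n\<in>{- int m..int m}. f n) \<le> real B" for m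
    using finite_sum_le_infsum[OF f, of "{- int m..int m}"] assms B by fastforce
  then show "\<exists>B::nat. \<forall>m::nat. (\<Sum>n\<in>{- int m..int m}. f n) \<le> real B" by blast
next
  assume "\<exists>B::nat. \<forall>m::nat. (\<Sum>n\<in>{- int m..int m}. f n) \<le> real B"
  then obtain B :: nat where B: "\<And>m. (\<Sum>n\<in>{- int m..int m}. f n) \<le> real B" by blast
  have "sum f F \<le> real B" if F: "finite F" for F
  proof -
    define m where "m = nat (Max (insert 0 (abs ` F)))"
    have "n \<in> {- int m..int m}" if "n \<in> F" for n
    proof -
      have "\<bar>n\<bar> \<le> Max (insert 0 (abs ` F))" using F that by (intro Max_ge) auto
      moreover have "0 \<le> Max (insert 0 (abs ` F))" using F by (intro Max_ge) auto
      ultimately show ?thesis by (simp add: m_def abs_le_iff)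
    qed
    then have "sum f F \<le> (\<Sum>n\<in>{- int m..int m}. f n)" using assms by (intro sum_mono2) auto
    then show ?thesis using B[of m] by linarith
  qed
  then show "f summable_on UNIV"
    using assms by (intro nonneg_bdd_above_summable_on) (auto intro!: bdd_aboveI[of _ "real B"])
qed

lemma infsum_int_tendsto:
  fixes f :: "int \<Rightarrow> real"
  assumes "f summable_on UNIV"
  shows "(\<lambda>m. \<Sum>n\<in>{- int m..int m}. f n) \<longlonglongrightarrow> infsum f UNIV"
proof -
  have "filterlim (\<lambda>m. {- int m..int m}) (finite_subsets_at_top UNIV) sequentially"
    unfolding filterlim_finite_subsets_at_top
  proof (intro allI impI)
    fix X :: "int set" assume X: "finite X \<and> X \<subseteq> UNIV"
    define M where "M = nat (Max (insert 0 (abs ` X)))"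
    have "X \<subseteq> {- int m..int m}" if "m \<ge> M" for m
    proof
      fix n assume "n \<in> X"
      then have "\<bar>n\<bar> \<le> Max (insert 0 (abs ` X))" using X by (intro Max_ge) auto
      then have "\<bar>n\<bar> \<le> int M" using X by (simp add: M_def)
      then show "n \<in> {- int m..int m}" using that by auto
    qed
    then show "\<forall>\<^sub>F m in sequentially. finite {- int m..int m} \<and> X \<subseteq> {- int m..int m} \<and> {- int m..int m} \<subseteq> UNIV"
      by (intro eventually_sequentiallyI[of M]) auto
  qed
  with has_sum_infsum[OF assms] show ?thesis
    unfolding has_sum_def by (rule filterlim_compose)
qed

section \<open>The Sobolev metric and its Borel sets\<close>

lemma sobolev_diff_summable:
  assumes "a \<in> sobolev s" "b \<in> sobolev s"
  shows "(\<lambda>n. sobolev_weight s n * (cmod (a n - b n))\<^sup>2) summable_on UNIV"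
proof (rule summable_on_comparison_test)
  show "(\<lambda>n. 2 * (sobolev_weight s n * (cmod (a n))\<^sup>2) + 2 * (sobolev_weight s n * (cmod (b n))\<^sup>2)) summable_on UNIV"
    using assms by (intro summable_on_add summable_on_cmult_right) (auto simp: sobolev_iff)
  fix n :: int
  have "(cmod (a n - b n))\<^sup>2 \<le> (cmod (a n) + cmod (b n))\<^sup>2"
    by (intro power_mono norm_triangle_ineq4) simp
  also have "\<dots> \<le> 2 * (cmod (a n))\<^sup>2 + 2 * (cmod (b n))\<^sup>2"
    using sum_squares_bound[of "cmod (a n)" "cmod (b n)"] by (simp add: power2_sum)
  finally have "sobolev_weight s n * (cmod (a n - b n))\<^sup>2 \<le> sobolev_weight s n * (2 * (cmod (a n))\<^sup>2 + 2 * (cmod (b n))\<^sup>2)"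
    using sobolev_weight_pos[of s n] by (intro mult_left_mono) auto
  then show "sobolev_weight s n * (cmod (a n - b n))\<^sup>2
      \<le> 2 * (sobolev_weight s n * (cmod (a n))\<^sup>2) + 2 * (sobolev_weight s n * (cmod (b n))\<^sup>2)"
    by (simp add: algebra_simps)
  show "0 \<le> sobolev_weight s n * (cmod (a n - b n))\<^sup>2"
    using sobolev_weight_pos[of s n] by simp
qed

lemma sobolev_dist_partial:
  assumes "a \<in> sobolev s" "b \<in> sobolev s" "finite F"
  shows "L2_set (\<lambda>n. sqrt (sobolev_weight s n) * cmod (a n - b n)) F \<le> sobolev_dist s a b"
proof -
  have "(\<Sum>n\<in>F. (sqrt (sobolev_weight s n) * cmod (a n - b n))\<^sup>2) = (\<Sum>n\<in>F. sobolev_weight s n * (cmod (a n - b n))\<^sup>2)"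
    using sobolev_weight_pos[of s] by (intro sum.cong) (auto simp: power_mult_distrib less_imp_le)
  also have "\<dots> \<le> (\<Sum>\<^sub>\<infinity>n. sobolev_weight s n * (cmod (a n - b n))\<^sup>2)"
    using sobolev_weight_pos[of s] assms by (intro finite_sum_le_infsum sobolev_diff_summable) (auto simp: less_imp_le)
  finally show ?thesis unfolding L2_set_def sobolev_dist_eq by (rule real_sqrt_le_mono)
qed

lemma sobolev_dist_le:
  assumes "a \<in> sobolev s" "b \<in> sobolev s" "D \<ge> 0"
    and "\<And>F. finite F \<Longrightarrow> L2_set (\<lambda>n. sqrt (sobolev_weight s n) * cmod (a n - b n)) F \<le> D"
  shows "sobolev_dist s a b \<le> D"
proof -
  have "(\<Sum>\<^sub>\<infinity>n. sobolev_weight s n * (cmod (a n - b n))\<^sup>2) \<le> D\<^sup>2"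
  proof (rule infsum_le_finite_sums[OF sobolev_diff_summable[OF assms(1,2)]])
    fix F :: "int set" assume F: "finite F"
    have "(\<Sum>n\<in>F. sobolev_weight s n * (cmod (a n - b n))\<^sup>2) = (L2_set (\<lambda>n. sqrt (sobolev_weight s n) * cmod (a n - b n)) F)\<^sup>2"
      using sobolev_weight_pos[of s]
      by (simp add: L2_set_def sum_nonneg power_mult_distrib less_imp_le)
    also have "\<dots> \<le> D\<^sup>2" using assms(4)[OF F] by (intro power_mono) auto
    finally show "(\<Sum>n\<in>F. sobolev_weight s n * (cmod (a n - b n))\<^sup>2) \<le> D\<^sup>2" .
  qed
  then show ?thesis unfolding sobolev_dist_eq using assms(3) by (simp add: real_le_lsqrt real_sqrt_le_iff)
qed

lemma sobolev_dist_coordinate: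
  assumes "a \<in> sobolev s" "b \<in> sobolev s"
  shows "sqrt (sobolev_weight s n) * cmod (a n - b n) \<le> sobolev_dist s a b"
  using sobolev_dist_partial[OF assms, of "{n}"] sobolev_weight_pos[of s n] by (simp add: L2_set_def)

text \<open>The triangle inequality is taken from the Euclidean norm on finite sets of frequencies
  and passes to the infinite sum as a supremum over these sets.\<close>

lemma Metric_space_sobolev: "Metric_space (sobolev s) (sobolev_dist s)"
proof
  show nonneg: "0 \<le> sobolev_dist s a b" for a b
    unfolding sobolev_dist_eq using sobolev_weight_pos[of s] by (simp add: infsum_nonneg less_imp_le)
  show "sobolev_dist s a b = sobolev_dist s b a" for a b
    by (simp add: sobolev_dist_eq norm_minus_commute)
  fix a b assume ab: "a \<in> sobolev s" "b \<in> sobolev s"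
  show "sobolev_dist s a b = 0 \<longleftrightarrow> a = b"
  proof
    assume 0: "sobolev_dist s a b = 0"
    show "a = b"
    proof
      fix n
      have "sqrt (sobolev_weight s n) * cmod (a n - b n) \<le> 0"
        using sobolev_dist_coordinate[OF ab, of n] 0 by simp
      then show "a n = b n" using sobolev_weight_pos[of s n] by (simp add: mult_le_0_iff)
    qed
  qed (simp add: sobolev_dist_eq)
  fix c assume c: "c \<in> sobolev s"
  show "sobolev_dist s a c \<le> sobolev_dist s a b + sobolev_dist s b c"
  proof (rule sobolev_dist_le[OF ab(1) c])
    show "0 \<le> sobolev_dist s a b + sobolev_dist s b c" using nonneg by simp
    fix F :: "int set" assume F: "finite F"
    have "L2_set (\<lambda>n. sqrt (sobolev_weight s n) * cmod (a n - c n)) F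
      \<le> L2_set (\<lambda>n. sqrt (sobolev_weight s n) * cmod (a n - b n) + sqrt (sobolev_weight s n) * cmod (b n - c n)) F"
    proof (rule L2_set_mono)
      fix n
      have "cmod (a n - c n) \<le> cmod (a n - b n) + cmod (b n - c n)"
        using norm_triangle_ineq[of "a n - b n" "b n - c n"] by simp
      then show "sqrt (sobolev_weight s n) * cmod (a n - c n)
        \<le> sqrt (sobolev_weight s n) * cmod (a n - b n) + sqrt (sobolev_weight s n) * cmod (b n - c n)"
        unfolding distrib_left[symmetric] using sobolev_weight_pos[of s n] by (intro mult_left_mono) auto
      show "0 \<le> sqrt (sobolev_weight s n) * cmod (a n - c n)" using sobolev_weight_pos[of s n] by simp
    qed
    also have "\<dots> \<le> L2_set (\<lambda>n. sqrt (sobolev_weight s n) * cmod (a n - b n)) F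
        + L2_set (\<lambda>n. sqrt (sobolev_weight s n) * cmod (b n - c n)) F"
      by (rule L2_set_triangle_ineq)
    also have "\<dots> \<le> sobolev_dist s a b + sobolev_dist s b c"
      by (intro add_mono sobolev_dist_partial F ab c)
    finally show "L2_set (\<lambda>n. sqrt (sobolev_weight s n) * cmod (a n - c n)) F \<le> sobolev_dist s a b + sobolev_dist s b c" .
  qed
qed

lemma openin_sobolev:
  "openin (sobolev_topology s) U \<longleftrightarrow> U \<subseteq> sobolev s \<and>
    (\<forall>a\<in>U. \<exists>r>0. \<forall>b\<in>sobolev s. sobolev_dist s a b < r \<longrightarrow> b \<in> U)"
proof -
  interpret Metric_space "sobolev s" "sobolev_dist s" by (rule Metric_space_sobolev)
  have ball: "mball a r \<subseteq> U \<longleftrightarrow> (\<forall>b\<in>sobolev s. sobolev_dist s a b < r \<longrightarrow> b \<in> U)" if "a \<in> sobolev s" for a r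
    using that by (auto simp: mball_def)
  show ?thesis
    unfolding sobolev_topology_def openin_mtopology
  proof (rule conj_cong[OF refl])
    assume "U \<subseteq> sobolev s"
    then have "(\<exists>r>0. mball a r \<subseteq> U) \<longleftrightarrow> (\<exists>r>0. \<forall>b\<in>sobolev s. sobolev_dist s a b < r \<longrightarrow> b \<in> U)" if "a \<in> U" for a
      using that by (simp only: ball subsetD[of U "sobolev s" a])
    then show "(\<forall>x. x \<in> U \<longrightarrow> (\<exists>r>0. mball x r \<subseteq> U)) \<longleftrightarrow> (\<forall>a\<in>U. \<exists>r>0. \<forall>b\<in>sobolev s. sobolev_dist s a b < r \<longrightarrow> b \<in> U)"
      by (simp add: Ball_def)
  qed
qed

lemma open_subsets_sobolev: "{U. openin (sobolev_topology s) U} \<subseteq> Pow (sobolev s)"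
  by (auto simp: openin_sobolev)

lemma space_sobolev_borel [simp]: "space (sobolev_borel s) = sobolev s"
  and sets_sobolev_borel: "sets (sobolev_borel s) = sigma_sets (sobolev s) {U. openin (sobolev_topology s) U}"
  unfolding sobolev_borel_def using open_subsets_sobolev by (simp_all add: space_measure_of sets_measure_of)

lemma topspace_sobolev [simp]: "topspace (sobolev_topology s) = sobolev s"
proof -
  interpret Metric_space "sobolev s" "sobolev_dist s" by (rule Metric_space_sobolev)
  show ?thesis unfolding sobolev_topology_def by simp
qed

lemma measurable_sobolev_coordinate:
  "(\<lambda>a. a n) \<in> borel_measurable (sobolev_borel s)"
proof (rule borel_measurableI)
  fix V :: "complex set" assume V: "open V"
  have "openin (sobolev_topology s) ((\<lambda>a. a n) -` V \<inter> sobolev s)"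
    unfolding openin_sobolev
  proof (intro conjI ballI)
    fix a assume a: "a \<in> (\<lambda>a. a n) -` V \<inter> sobolev s"
    then obtain e where e: "e > 0" "\<And>z. dist z (a n) < e \<Longrightarrow> z \<in> V" using V unfolding open_dist by blast
    have w: "sqrt (sobolev_weight s n) > 0" using sobolev_weight_pos[of s n] by simp
    show "\<exists>r>0. \<forall>b\<in>sobolev s. sobolev_dist s a b < r \<longrightarrow> b \<in> (\<lambda>a. a n) -` V \<inter> sobolev s"
    proof (intro exI[of _ "sqrt (sobolev_weight s n) * e"] conjI ballI impI)
      show "sqrt (sobolev_weight s n) * e > 0" using w e by simp
      fix b assume b: "b \<in> sobolev s" "sobolev_dist s a b < sqrt (sobolev_weight s n) * e"
      have "sqrt (sobolev_weight s n) * cmod (a n - b n) < sqrt (sobolev_weight s n) * e"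
        using sobolev_dist_coordinate[OF _ b(1), of a n] a b(2) by simp
      then have "dist (b n) (a n) < e" using w by (simp add: dist_norm norm_minus_commute)
      then show "b \<in> (\<lambda>a. a n) -` V \<inter> sobolev s" using e(2) b(1) by simp
    qed
  qed auto
  then show "(\<lambda>a. a n) -` V \<inter> space (sobolev_borel s) \<in> sets (sobolev_borel s)"
    unfolding sets_sobolev_borel by (auto intro: sigma_sets.Basic)
qed

lemma measurable_real_coords_sobolev: "real_coords \<in> borel_measurable (sobolev_borel s)"
proof (rule measurable_coordinatewise_then_product)
  fix n
  note m = measurable_sobolev_coordinate[of _ s]
  have "(\<lambda>a. Re (a k)) \<in> borel_measurable (sobolev_borel s)" "(\<lambda>a. Im (a k)) \<in> borel_measurable (sobolev_borel s)" for k
    by (rule measurable_compose[OF m]; simp)+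
  then show "(\<lambda>a. real_coords a n) \<in> borel_measurable (sobolev_borel s)"
    unfolding real_coords_def by (cases "n = 0"; cases "n > 0") auto
qed

lemma finite_support_in_sobolev:
  assumes "real_valued a" "\<And>n. \<bar>n\<bar> > int K \<Longrightarrow> a n = 0"
  shows "a \<in> sobolev s"
proof -
  have "(\<lambda>n. sobolev_weight s n * (cmod (a n))\<^sup>2) summable_on UNIV \<longleftrightarrow>
      (\<lambda>n. sobolev_weight s n * (cmod (a n))\<^sup>2) summable_on {- int K..int K}"
    using assms(2) by (intro summable_on_cong_neutral) (auto simp: abs_le_iff not_le)
  then show ?thesis using assms(1) by (simp add: sobolev_iff)
qed

text \<open>The countable dense set that witnesses separability: real-valued trigonometric
  polynomials with rational real coordinates.\<close>

definition rational_coeffs :: "coeffs set" where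
  "rational_coeffs = (\<Union>K::nat. (\<lambda>q. of_real_coords (\<lambda>n. if \<bar>n\<bar> \<le> int K then q n else 0)) ` (\<Pi>\<^sub>E n\<in>{- int K..int K}. \<rat>))"

lemma countable_rational_coeffs: "countable rational_coeffs"
  unfolding rational_coeffs_def by (intro countable_UN countable_image countable_PiE) (auto simp: countable_rat)

lemma cmod_of_real_coords_diff:
  "cmod (of_real_coords x n - of_real_coords y n) \<le> \<bar>x n - y n\<bar> + \<bar>x (- n) - y (- n)\<bar>"
proof -
  have s: "\<bar>u / sqrt 2 - v / sqrt 2\<bar> \<le> \<bar>u - v\<bar>" for u v :: real
  proof -
    have "\<bar>u / sqrt 2 - v / sqrt 2\<bar> = \<bar>u - v\<bar> / sqrt 2" by (simp add: diff_divide_distrib[symmetric])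
    also have "\<dots> \<le> \<bar>u - v\<bar> / 1" by (intro divide_left_mono) auto
    finally show ?thesis by simp
  qed
  show ?thesis
  proof (cases "n = 0")
    case True
    then have "of_real_coords x n - of_real_coords y n = complex_of_real (x 0 - y 0)"
      by (simp add: of_real_coords_def)
    then show ?thesis using True by (simp only: norm_of_real)
  next
    case False
    then show ?thesis
      using s[of "x n" "y n"] s[of "x (- n)" "y (- n)"] cmod_le[of "of_real_coords x n - of_real_coords y n"]
      by (cases "n > 0") (auto simp: of_real_coords_def diff_divide_distrib abs_minus_commute)
  qed
qed

lemma rational_coeffs_dense:
  assumes a: "a \<in> sobolev s" and e: "e > 0"
  obtains c where "c \<in> rational_coeffs" "c \<in> sobolev s" "sobolev_dist s c a < e"
proof -
  let ?w = "sobolev_weight s"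
  have w: "?w n > 0" for n by (rule sobolev_weight_pos)
  let ?f = "\<lambda>n. ?w n * (cmod (a n))\<^sup>2"
  have fs: "?f summable_on UNIV" and ra: "real_valued a" using a by (auto simp: sobolev_iff)
  have f0: "?f n \<ge> 0" for n using w[of n] by simp
  have "e\<^sup>2 / 4 > 0" using e by simp
  with infsum_int_tendsto[OF fs] obtain K :: nat where K: "\<bar>(\<Sum>n\<in>{- int K..int K}. ?f n) - infsum ?f UNIV\<bar> < e\<^sup>2 / 4"
    unfolding LIMSEQ_iff real_norm_def by blast
  define W where "W = (\<Sum>n\<in>{- int K..int K}. ?w n)"
  have W: "W \<ge> 0" unfolding W_def using w by (simp add: sum_nonneg less_imp_le)
  \<comment> \<open>Each squared modal error in the window is at most 4 d^2, and d is chosen so that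
    (W + 1) 4 d^2 = e^2 / 4. With the tail below e^2 / 4 the total stays at e^2 / 2.\<close>
  define d where "d = e / (4 * sqrt (W + 1))"
  have d: "d > 0" using e W by (simp add: d_def)
  have "\<exists>q\<in>\<rat>. \<bar>q - real_coords a n\<bar> < d" for n
  proof -
    obtain q where q: "q \<in> \<rat>" "real_coords a n - d < q" "q < real_coords a n + d"
      using Rats_dense_in_real[of "real_coords a n - d" "real_coords a n + d"] d by auto
    then show ?thesis by (intro bexI[of _ q]) auto
  qed
  then obtain q where q: "\<And>n. q n \<in> \<rat>" "\<And>n. \<bar>q n - real_coords a n\<bar> < d" by metis
  define x where "x = (\<lambda>n. if \<bar>n\<bar> \<le> int K then q n else 0)"
  define c where "c = of_real_coords x"
  have c0: "c n = 0" if "\<bar>n\<bar> > int K" for n using that by (auto simp: c_def x_def of_real_coords_def complex_eq_iff)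
  have cs: "c \<in> sobolev s"
    by (rule finite_support_in_sobolev[OF _ c0]) (simp add: c_def real_valued_of_real_coords)
  have "x = (\<lambda>n. if \<bar>n\<bar> \<le> int K then restrict q {- int K..int K} n else 0)"
    by (auto simp: x_def fun_eq_iff abs_le_iff)
  then have cr: "c \<in> rational_coeffs"
    unfolding rational_coeffs_def c_def using q(1) by (intro UN_I[of K] image_eqI[of _ _ "restrict q {- int K..int K}"]) auto
  have near: "(cmod (c n - a n))\<^sup>2 \<le> 4 * d\<^sup>2" if "\<bar>n\<bar> \<le> int K" for n
  proof -
    have "cmod (c n - a n) = cmod (of_real_coords x n - of_real_coords (real_coords a) n)"
      by (simp add: c_def of_real_coords_real_coords[OF ra])
    also have "\<dots> \<le> \<bar>x n - real_coords a n\<bar> + \<bar>x (- n) - real_coords a (- n)\<bar>" by (rule cmod_of_real_coords_diff)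
    also have "\<dots> \<le> 2 * d" using q(2)[of n] q(2)[of "- n"] that by (simp add: x_def)
    finally have "(cmod (c n - a n))\<^sup>2 \<le> (2 * d)\<^sup>2" by (intro power_mono) auto
    then show ?thesis by (simp add: power_mult_distrib)
  qed
  have ds: "(\<lambda>n. ?w n * (cmod (c n - a n))\<^sup>2) summable_on UNIV" by (rule sobolev_diff_summable[OF cs a])
  have "(\<Sum>\<^sub>\<infinity>n. ?w n * (cmod (c n - a n))\<^sup>2) \<le> e\<^sup>2 / 2"
  proof (rule LIMSEQ_le_const2[OF infsum_int_tendsto[OF ds]], intro exI[of _ K] allI impI)
    fix m assume m: "m \<ge> K"
    let ?I = "{- int K..int K}" and ?J = "{- int m..int m}"
    have J: "?J = ?I \<union> (?J - ?I)" using m by auto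
    have "(\<Sum>n\<in>?J. ?w n * (cmod (c n - a n))\<^sup>2)
      = (\<Sum>n\<in>?I. ?w n * (cmod (c n - a n))\<^sup>2) + (\<Sum>n\<in>?J - ?I. ?w n * (cmod (c n - a n))\<^sup>2)"
      by (subst J, rule sum.union_disjoint) auto
    also have "(\<Sum>n\<in>?J - ?I. ?w n * (cmod (c n - a n))\<^sup>2) = (\<Sum>n\<in>?J - ?I. ?f n)"
      using c0 by (intro sum.cong) (auto simp: abs_le_iff not_le)
    also have "(\<Sum>n\<in>?J - ?I. ?f n) = (\<Sum>n\<in>?J. ?f n) - (\<Sum>n\<in>?I. ?f n)"
      using m by (intro sum_diff) auto
    also have "\<dots> \<le> e\<^sup>2 / 4"
    proof -
      have "sum ?f ?J \<le> infsum ?f UNIV" by (rule finite_sum_le_infsum[OF fs]) (use f0 in auto)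
      then show ?thesis using K by linarith
    qed
    also have "(\<Sum>n\<in>?I. ?w n * (cmod (c n - a n))\<^sup>2) \<le> (\<Sum>n\<in>?I. ?w n * (4 * d\<^sup>2))"
      using near w by (intro sum_mono mult_left_mono) (auto simp: less_imp_le)
    also have "\<dots> = W * (4 * d\<^sup>2)" by (simp add: W_def sum_distrib_right)
    also have "\<dots> \<le> (W + 1) * (4 * d\<^sup>2)" by (intro mult_right_mono) auto
    also have "\<dots> = e\<^sup>2 / 4"
    proof -
      have d2: "d\<^sup>2 = e\<^sup>2 / (16 * (W + 1))" using W by (simp add: d_def power_divide power_mult_distrib)
      have scale: "V * (4 * (E / (16 * V))) = E / 4" if "V \<noteq> 0" for V E :: real
        using that by (simp add: field_simps)
      show ?thesis unfolding d2 by (rule scale) (use W in simp)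
    qed
    finally show "(\<Sum>n\<in>?J. ?w n * (cmod (c n - a n))\<^sup>2) \<le> e\<^sup>2 / 2" by simp
  qed
  also have "e\<^sup>2 / 2 < e\<^sup>2" using e by simp
  finally have "sobolev_dist s c a < sqrt (e\<^sup>2)" unfolding sobolev_dist_eq by (rule real_sqrt_less_mono)
  then show thesis using that[OF cr cs] e by simp
qed

lemma measurable_sobolev_dist:
  assumes f: "\<And>n. (\<lambda>\<omega>. f \<omega> n) \<in> borel_measurable M" "\<And>\<omega>. \<omega> \<in> space M \<Longrightarrow> f \<omega> \<in> sobolev s"
    and c: "c \<in> sobolev s"
  shows "(\<lambda>\<omega>. sobolev_dist s c (f \<omega>)) \<in> borel_measurable M"
proof -
  have "(\<lambda>\<omega>. \<Sum>\<^sub>\<infinity>n. sobolev_weight s n * (cmod (c n - f \<omega> n))\<^sup>2) \<in> borel_measurable M"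
  proof (rule borel_measurable_LIMSEQ_real)
    show "(\<lambda>m. \<Sum>n\<in>{- int m..int m}. sobolev_weight s n * (cmod (c n - f \<omega> n))\<^sup>2)
        \<longlonglongrightarrow> (\<Sum>\<^sub>\<infinity>n. sobolev_weight s n * (cmod (c n - f \<omega> n))\<^sup>2)" if "\<omega> \<in> space M" for \<omega>
      by (rule infsum_int_tendsto[OF sobolev_diff_summable[OF c f(2)[OF that]]])
    show "(\<lambda>\<omega>. \<Sum>n\<in>{- int m..int m}. sobolev_weight s n * (cmod (c n - f \<omega> n))\<^sup>2) \<in> borel_measurable M" for m
      using f(1) by measurable
  qed
  then show ?thesis unfolding sobolev_dist_eq by (rule measurable_compose) simp
qed

text \<open>By separability an open set is a countable union of balls with centres in
  \<open>rational_coeffs\<close> and rational radii, and the distance to a fixed centre is a limit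
  of finite sums of coordinates. So measurable coordinates suffice for Borel measurability in
  norm.\<close>

lemma measurable_sobolev_borel:
  assumes f: "\<And>n. (\<lambda>\<omega>. f \<omega> n) \<in> borel_measurable M" "\<And>\<omega>. \<omega> \<in> space M \<Longrightarrow> f \<omega> \<in> sobolev s"
  shows "f \<in> measurable M (sobolev_borel s)"
  unfolding sobolev_borel_def
proof (rule measurable_measure_of[OF open_subsets_sobolev])
  show "f \<in> space M \<rightarrow> sobolev s" using f(2) by auto
  fix U assume "U \<in> {U. openin (sobolev_topology s) U}"
  then have U: "U \<subseteq> sobolev s" "\<forall>a\<in>U. \<exists>r>0. \<forall>b\<in>sobolev s. sobolev_dist s a b < r \<longrightarrow> b \<in> U"
    by (simp_all add: openin_sobolev)
  interpret Metric_space "sobolev s" "sobolev_dist s" by (rule Metric_space_sobolev)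
  define D where "D = {(c, q). c \<in> rational_coeffs \<inter> sobolev s \<and> q \<in> \<rat> \<and> (\<forall>b\<in>sobolev s. sobolev_dist s c b < q \<longrightarrow> b \<in> U)}"
  have "D \<subseteq> rational_coeffs \<times> \<rat>" by (auto simp: D_def)
  then have D: "countable D"
    by (rule countable_subset) (intro countable_SIGMA countable_rational_coeffs countable_rat)
  have cover: "\<exists>p\<in>D. sobolev_dist s (fst p) a < snd p" if a: "a \<in> U" for a
  proof -
    obtain r where r: "r > 0" "\<And>b. b \<in> sobolev s \<Longrightarrow> sobolev_dist s a b < r \<Longrightarrow> b \<in> U" using U(2) a by blast
    have as: "a \<in> sobolev s" using U(1) a by blast
    \<comment> \<open>A radius q > r/4 covers \<open>a\<close> from a centre closer than r/4, and q
      < r/2 keeps the ball within distance 3r/4 of \<open>a\<close>, hence inside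
      \<open>U\<close>.\<close>
    obtain q where q: "q \<in> \<rat>" "r / 4 < q" "q < r / 2" using Rats_dense_in_real[of "r / 4" "r / 2"] r(1) by auto
    obtain c where c: "c \<in> rational_coeffs" "c \<in> sobolev s" "sobolev_dist s c a < r / 4"
      using rational_coeffs_dense[OF as, of "r / 4"] r(1) by auto
    have "b \<in> U" if b: "b \<in> sobolev s" "sobolev_dist s c b < q" for b
    proof (rule r(2)[OF b(1)])
      have "sobolev_dist s a b \<le> sobolev_dist s a c + sobolev_dist s c b" by (rule triangle[OF as c(2) b(1)])
      then show "sobolev_dist s a b < r" using c(3) b(2) q r(1) commute[of a c] by linarith
    qed
    then have "(c, q) \<in> D" using c q by (auto simp: D_def)
    moreover have "sobolev_dist s c a < q" using c(3) q by linarith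
    ultimately show ?thesis by (intro bexI[of _ "(c, q)"]) auto
  qed
  have "f -` U \<inter> space M = (\<Union>p\<in>D. {\<omega> \<in> space M. sobolev_dist s (fst p) (f \<omega>) < snd p})"
  proof (intro equalityI subsetI)
    fix \<omega> assume "\<omega> \<in> f -` U \<inter> space M"
    then show "\<omega> \<in> (\<Union>p\<in>D. {\<omega> \<in> space M. sobolev_dist s (fst p) (f \<omega>) < snd p})" using cover by blast
  next
    fix \<omega> assume "\<omega> \<in> (\<Union>p\<in>D. {\<omega> \<in> space M. sobolev_dist s (fst p) (f \<omega>) < snd p})"
    then show "\<omega> \<in> f -` U \<inter> space M" using f(2) by (auto simp: D_def)
  qed
  also have "\<dots> \<in> sets M"
  proof (rule sets.countable_UN'[OF D], rule image_subsetI)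
    fix p assume "p \<in> D"
    then have p: "fst p \<in> sobolev s" by (auto simp: D_def)
    have [measurable]: "(\<lambda>\<omega>. sobolev_dist s (fst p) (f \<omega>)) \<in> borel_measurable M"
      by (rule measurable_sobolev_dist[OF f p])
    show "{\<omega> \<in> space M. sobolev_dist s (fst p) (f \<omega>) < snd p} \<in> sets M" by measurable
  qed
  finally show "f -` U \<inter> space M \<in> sets M" .
qed

lemma measurable_of_real_coords_component: "(\<lambda>x. of_real_coords x n) \<in> borel_measurable borel"
proof -
  have "of_real_coords x n = complex_of_real (if n = 0 then x 0 else x \<bar>n\<bar> / sqrt 2)
      + \<i> * complex_of_real (if n = 0 then 0 else sgn (real_of_int n) * x (- \<bar>n\<bar>) / sqrt 2)" for x
    by (auto simp: of_real_coords_def complex_eq_iff)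
  then show ?thesis by simp
qed

text \<open>The truncation to 0 off the Sobolev space is a measurable case distinction, and the
  result lies in the space everywhere.\<close>

lemma measurable_to_sobolev: "(\<lambda>x. to_sobolev s (of_real_coords x)) \<in> measurable borel (sobolev_borel s)"
proof (rule measurable_sobolev_borel)
  have *: "of_real_coords x \<in> sobolev s \<longleftrightarrow>
      (\<exists>B::nat. \<forall>m::nat. (\<Sum>n\<in>{- int m..int m}. sobolev_weight s n * (cmod (of_real_coords x n))\<^sup>2) \<le> real B)" for x
    unfolding sobolev_iff using sobolev_weight_pos[of s] real_valued_of_real_coords
    by (subst summable_on_int_nonneg_iff) (auto simp: less_imp_le)
  note [measurable] = measurable_of_real_coords_component
  have S [measurable]: "{x \<in> space borel. of_real_coords x \<in> sobolev s} \<in> sets borel"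
    unfolding * by measurable
  show "(\<lambda>x. to_sobolev s (of_real_coords x) n) \<in> borel_measurable borel" for n
  proof -
    have "(\<lambda>x. to_sobolev s (of_real_coords x) n) = (\<lambda>x. if of_real_coords x \<in> sobolev s then of_real_coords x n else 0)"
      by (auto simp: to_sobolev_def)
    also have "\<dots> \<in> borel_measurable borel"
      using S by (intro measurable_If) auto
    finally show ?thesis .
  qed
  show "to_sobolev s (of_real_coords x) \<in> sobolev s" for x
    using finite_support_in_sobolev[of "\<lambda>n. 0" 0 s] by (auto simp: to_sobolev_def real_valued_def)
qed

section \<open>White noise takes values in the Sobolev space\<close>

text \<open>Here s < -1/2 enters: the weight at n \<noteq> 0 is dominated by |n| to the power 2 s,
  and 2 s < -1.\<close>

lemma sobolev_weight_summable:
  assumes s: "s < - 1 / 2"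
  shows "\<exists>B. \<forall>m::nat. (\<Sum>n\<in>{- int m..int m}. sobolev_weight s n) \<le> B"
proof -
  have sm: "summable (\<lambda>n. of_nat n powr (2 * s) :: real)"
    using s by (subst summable_real_powr_iff) simp
  define B where "B = (\<Sum>n. of_nat n powr (2 * s) :: real)"
  have le: "sobolev_weight s (int n) \<le> of_nat n powr (2 * s)" if "n \<ge> 1" for n
  proof -
    have "sobolev_weight s (int n) \<le> ((real n)\<^sup>2) powr s"
      unfolding sobolev_weight_def using s that by (intro powr_mono2') auto
    also have "\<dots> = real n powr (2 * s)" using that by (simp add: powr_powr[symmetric])
    finally show ?thesis by simp
  qed
  have even: "sobolev_weight s (- n) = sobolev_weight s n" for n by (simp add: sobolev_weight_def)
  have pos: "(\<Sum>n\<in>{1..int m}. sobolev_weight s n) \<le> B" for m :: nat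
  proof -
    have "(\<Sum>n\<in>{1..int m}. sobolev_weight s n) = (\<Sum>n\<in>{1..m}. sobolev_weight s (int n))"
      by (rule sum.reindex_bij_witness[of _ int nat]) auto
    also have "\<dots> \<le> (\<Sum>n\<in>{1..m}. of_nat n powr (2 * s))" by (intro sum_mono le) auto
    also have "\<dots> \<le> B" unfolding B_def by (rule sum_le_suminf[OF sm]) auto
    finally show ?thesis .
  qed
  have "(\<Sum>n\<in>{- int m..int m}. sobolev_weight s n) \<le> 1 + 2 * B" for m :: nat
  proof -
    have "{- int m..int m} = {- int m..-1} \<union> ({0} \<union> {1..int m})" by auto
    then have "(\<Sum>n\<in>{- int m..int m}. sobolev_weight s n)
      = (\<Sum>n\<in>{- int m..-1}. sobolev_weight s n) + (sobolev_weight s 0 + (\<Sum>n\<in>{1..int m}. sobolev_weight s n))"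
      by (simp add: sum.union_disjoint)
    also have "(\<Sum>n\<in>{- int m..-1}. sobolev_weight s n) = (\<Sum>n\<in>{1..int m}. sobolev_weight s n)"
      by (rule sum.reindex_bij_witness[of _ uminus uminus]) (auto simp: even)
    finally show ?thesis using pos[of m] by (simp add: sobolev_weight_def)
  qed
  then show ?thesis by blast
qed

lemma nn_integral_gauss_square:
  assumes "v > 0"
  shows "(\<integral>\<^sup>+y. ennreal (y\<^sup>2) \<partial>gauss v) = ennreal v"
proof -
  have "(\<integral>\<^sup>+y. ennreal (y\<^sup>2) \<partial>gauss v) = (\<integral>\<^sup>+y. ennreal (normal_density 0 (sqrt v) y * y\<^sup>2) \<partial>lborel)"
    unfolding gauss_def by (subst nn_integral_density) (auto simp: ennreal_mult)
  also have "\<dots> = ennreal v"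
  proof -
    have "has_bochner_integral lborel (\<lambda>y. normal_density 0 (sqrt v) y * y\<^sup>2) v"
      using normal_moment_even[of "sqrt v" 0 1] assms by (simp add: fact_numeral)
    then show ?thesis
      by (subst nn_integral_eq_integral) (auto simp: has_bochner_integral_iff)
  qed
  finally show ?thesis .
qed

text \<open>All modes have comparable variance, so the expected partial Sobolev norms are bounded by
  the sum of the weights. Monotone convergence makes the full norm integrable, hence finite almost
  surely.\<close>

lemma AE_gauss_seq_sobolev:
  assumes s: "s < - 1 / 2" and v: "v > 0"
  shows "AE x in gauss_seq v. of_real_coords x \<in> sobolev s"
proof -
  interpret prob_space "gauss_seq v" by (rule prob_space_gauss_seq[OF v])
  let ?w = "sobolev_weight s"
  have w: "?w n \<ge> 0" for n using sobolev_weight_pos[of s n] by simp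
  define h where "h m x = ennreal (\<Sum>n\<in>{- int m..int m}. ?w n * (cmod (of_real_coords x n))\<^sup>2)" for m x
  obtain B where B: "\<And>m::nat. (\<Sum>n\<in>{- int m..int m}. ?w n) \<le> B"
    using sobolev_weight_summable[OF s] by blast
  note [measurable] = measurable_of_real_coords_component
  have hm [measurable]: "h m \<in> borel_measurable borel" for m unfolding h_def by measurable
  have sq: "(\<integral>\<^sup>+x. ennreal ((x n)\<^sup>2) \<partial>gauss_seq v) = ennreal v" for n
  proof -
    have "(\<integral>\<^sup>+x. ennreal ((x n)\<^sup>2) \<partial>gauss_seq v) = (\<integral>\<^sup>+y. ennreal (y\<^sup>2) \<partial>distr (gauss_seq v) borel (\<lambda>x. x n))"
      by (subst nn_integral_distr) auto
    then show ?thesis by (simp add: distr_gauss_seq_component[OF v] nn_integral_gauss_square[OF v])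
  qed
  have mode: "(cmod (of_real_coords x n))\<^sup>2 \<le> (x n)\<^sup>2 + (x (- n))\<^sup>2" for x n
  proof -
    have "u\<^sup>2 / 2 + v\<^sup>2 / 2 \<le> u\<^sup>2 + v\<^sup>2" for u v :: real
      using zero_le_power2[of u] zero_le_power2[of v] by linarith
    from this[of "x n" "x (- n)"] show ?thesis
      unfolding of_real_coords_def cmod_power2 by (auto simp: power_divide)
  qed
  have int: "(\<integral>\<^sup>+x. h m x \<partial>gauss_seq v) \<le> ennreal (B * (2 * v))" for m
  proof -
    have "(\<integral>\<^sup>+x. h m x \<partial>gauss_seq v) \<le> (\<integral>\<^sup>+x. (\<Sum>n\<in>{- int m..int m}. ennreal (?w n) * (ennreal ((x n)\<^sup>2) + ennreal ((x (- n))\<^sup>2))) \<partial>gauss_seq v)"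
    proof (rule nn_integral_mono)
      fix x
      have "h m x \<le> ennreal (\<Sum>n\<in>{- int m..int m}. ?w n * ((x n)\<^sup>2 + (x (- n))\<^sup>2))"
        unfolding h_def using w mode by (intro ennreal_leI sum_mono mult_left_mono) auto
      also have "\<dots> = (\<Sum>n\<in>{- int m..int m}. ennreal (?w n * ((x n)\<^sup>2 + (x (- n))\<^sup>2)))"
        using w by (intro sum_ennreal[symmetric]) simp
      also have "\<dots> = (\<Sum>n\<in>{- int m..int m}. ennreal (?w n) * (ennreal ((x n)\<^sup>2) + ennreal ((x (- n))\<^sup>2)))"
        using w by (intro sum.cong) (auto simp: ennreal_mult)
      finally show "h m x \<le> (\<Sum>n\<in>{- int m..int m}. ennreal (?w n) * (ennreal ((x n)\<^sup>2) + ennreal ((x (- n))\<^sup>2)))" .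
    qed
    also have "\<dots> = (\<Sum>n\<in>{- int m..int m}. ennreal (?w n) * (ennreal v + ennreal v))"
      by (simp add: nn_integral_sum nn_integral_cmult nn_integral_add sq)
    also have "\<dots> = (\<Sum>n\<in>{- int m..int m}. ennreal (?w n * (2 * v)))"
      using w v by (intro sum.cong) (auto simp: ennreal_mult ennreal_plus[symmetric] simp del: ennreal_plus)
    also have "\<dots> = ennreal ((\<Sum>n\<in>{- int m..int m}. ?w n) * (2 * v))"
      using w v by (subst sum_ennreal) (auto simp: sum_distrib_right)
    also have "\<dots> \<le> ennreal (B * (2 * v))" using B v by (intro ennreal_leI mult_right_mono) auto
    finally show ?thesis .
  qed
  have inc: "incseq h"
    unfolding incseq_def le_fun_def h_def using w
    by (auto intro!: ennreal_leI sum_mono2)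
  have "(\<integral>\<^sup>+x. (SUP m. h m x) \<partial>gauss_seq v) = (SUP m. \<integral>\<^sup>+x. h m x \<partial>gauss_seq v)"
    by (rule nn_integral_monotone_convergence_SUP[OF inc]) simp
  also have "\<dots> \<le> ennreal (B * (2 * v))" using int by (rule SUP_least)
  finally have "(\<integral>\<^sup>+x. (SUP m. h m x) \<partial>gauss_seq v) \<noteq> \<infinity>" by (auto simp: top_unique)
  then have "AE x in gauss_seq v. (SUP m. h m x) \<noteq> \<infinity>" by (intro nn_integral_noteq_infinite) auto
  then show ?thesis
  proof (rule AE_mp, intro AE_I2 impI)
    fix x assume "(SUP m. h m x) \<noteq> \<infinity>"
    then obtain r where r: "(SUP m. h m x) = ennreal r" "r \<ge> 0" by (cases "SUP m. h m x") auto
    obtain b :: nat where b: "r \<le> real b" using real_arch_simple by blast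
    have "(\<Sum>n\<in>{- int m..int m}. ?w n * (cmod (of_real_coords x n))\<^sup>2) \<le> real b" for m
    proof -
      have "h m x \<le> ennreal r" unfolding r(1)[symmetric] by (rule SUP_upper) simp
      then show ?thesis using r(2) b unfolding h_def by simp
    qed
    then show "of_real_coords x \<in> sobolev s"
      unfolding sobolev_iff using w real_valued_of_real_coords by (subst summable_on_int_nonneg_iff) auto
  qed
qed

section \<open>The evolution system\<close>

lemma to_sobolev_in: "to_sobolev s a \<in> sobolev s"
  using finite_support_in_sobolev[of "\<lambda>n. 0" 0 s] by (auto simp: to_sobolev_def real_valued_def)

text \<open>Replaces the given probability space and Gaussian family by the canonical product
  measure, so that from here on white noise is a fixed image of
  \<open>gauss_seq \<alpha>\<close>.\<close>

lemma white_noise_gauss_seq: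
  assumes g: "gaussian_coeffs M g" and \<alpha>: "\<alpha> > 0"
  shows "white_noise s M g \<alpha> = distr (gauss_seq \<alpha>) (sobolev_borel s) (\<lambda>x. to_sobolev s (of_real_coords x))"
proof -
  let ?a = "\<lambda>\<omega> n. complex_of_real (sqrt \<alpha>) * g n \<omega>"
  have rv: "real_valued (?a \<omega>)" if "\<omega> \<in> space M" for \<omega>
    using g that by (simp add: gaussian_coeffs_def real_valued_def)
  note am = white_noise_coords(2)[OF g \<alpha>]
  have "white_noise s M g \<alpha> = distr M (sobolev_borel s) (\<lambda>\<omega>. to_sobolev s (of_real_coords (real_coords (?a \<omega>))))"
    unfolding white_noise_def by (rule distr_cong) (simp_all add: of_real_coords_real_coords[OF rv])
  also have "\<dots> = distr (distr M borel (\<lambda>\<omega>. real_coords (?a \<omega>))) (sobolev_borel s) (\<lambda>x. to_sobolev s (of_real_coords x))"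
    by (subst distr_distr[OF measurable_to_sobolev am]) (simp add: comp_def)
  finally show ?thesis by (simp only: white_noise_coords(1)[OF g \<alpha>])
qed

lemma sets_white_noise [simp]: "sets (white_noise s M g \<alpha>) = sets (sobolev_borel s)"
  by (simp add: white_noise_def)

lemma prob_space_white_noise:
  assumes "gaussian_coeffs M g" "\<alpha> > 0"
  shows "prob_space (white_noise s M g \<alpha>)"
  unfolding white_noise_gauss_seq[OF assms]
  by (rule prob_space.prob_space_distr[OF prob_space_gauss_seq[OF assms(2)]])
     (simp add: measurable_to_sobolev measurable_cong_sets[OF sets_gauss_seq refl])

lemma kdv_flow_real_coords:
  assumes \<beta>: "brownian_coeffs P \<beta>" and \<omega>: "\<omega> \<in> space P" and t: "0 \<le> t1" "t1 \<le> t2" and \<phi>: "real_valued \<phi>"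
  shows "kdv_flow N (\<lambda>n t. \<beta> n t \<omega>) t1 t2 \<phi> = of_real_coords (kdv_flow_coords N \<beta> t1 t2 (real_coords \<phi>) \<omega>)"
  using kdv_flow_scheme(1)[where N=N, OF t(2) \<phi> brownian_paths[where ?t2.0=t2, OF \<beta> \<omega> t(1)]]
  by (simp add: kdv_flow_coords_def of_real_coords_real_coords[OF \<phi>] of_real_coords_real_coords)

lemma kdv_flow_same_time_coords:
  assumes \<beta>: "brownian_coeffs P \<beta>" and \<omega>: "\<omega> \<in> space P" and t: "0 \<le> t"
  shows "kdv_flow_coords N \<beta> t t x \<omega> = x"
proof -
  obtain u where u: "solves_kdv N (\<lambda>n t. \<beta> n t \<omega>) t t (of_real_coords x) u"
    using solves_kdv_exists[where N=N and \<phi>="of_real_coords x", OF order_refl real_valued_of_real_coords brownian_paths[where ?t2.0=t, OF \<beta> \<omega> t]] by blast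
  have "kdv_flow N (\<lambda>n t. \<beta> n t \<omega>) t t (of_real_coords x) = of_real_coords x"
    using kdv_flow_eq[OF order_refl u] kdv_flow_same_time[OF u] by simp
  then show ?thesis by (simp add: kdv_flow_coords_def)
qed

text \<open>Equal times are treated apart: the increments would have variance 0 and no density, but
  the flow is then the identity.\<close>

lemma kdv_flow_coords_law_le:
  assumes \<beta>: "brownian_coeffs P \<beta>" and t: "0 \<le> t1" "t1 \<le> t2" and v: "v > 0"
  shows "(\<lambda>p. kdv_flow_coords N \<beta> t1 t2 (fst p) (snd p)) \<in> borel_measurable (gauss_seq v \<Otimes>\<^sub>M P)"
    and "distr (gauss_seq v \<Otimes>\<^sub>M P) borel (\<lambda>p. kdv_flow_coords N \<beta> t1 t2 (fst p) (snd p)) = gauss_seq (v + (t2 - t1))"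
proof -
  have "prob_space P" using \<beta> by (simp add: brownian_coeffs_def)
  then interpret P: prob_space P .
  let ?M = "gauss_seq v \<Otimes>\<^sub>M P"
  have eq: "kdv_flow_coords N \<beta> t1 t2 (fst p) (snd p) = fst p" if "t1 = t2" "p \<in> space ?M" for p
    using kdv_flow_same_time_coords[OF \<beta> _ t(1), of "snd p"] that by (auto simp: space_pair_measure)
  show m: "(\<lambda>p. kdv_flow_coords N \<beta> t1 t2 (fst p) (snd p)) \<in> borel_measurable ?M"
  proof (cases "t1 = t2")
    case True
    have "fst \<in> borel_measurable ?M" by simp
    then show ?thesis by (subst measurable_cong[of _ _ fst]) (auto simp: eq[OF True])
  next
    case False
    then show ?thesis using measurable_kdv_flow_coords[OF \<beta> t(1)] t(2) by simp
  qed
  show "distr ?M borel (\<lambda>p. kdv_flow_coords N \<beta> t1 t2 (fst p) (snd p)) = gauss_seq (v + (t2 - t1))"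
  proof (cases "t1 = t2")
    case True
    have "distr ?M borel (\<lambda>p. kdv_flow_coords N \<beta> t1 t2 (fst p) (snd p)) = distr ?M (gauss_seq v) fst"
      by (rule distr_cong) (auto simp: eq[OF True])
    also have "\<dots> = gauss_seq v" by (rule P.distr_pair_fst)
    finally show ?thesis using True by simp
  next
    case False
    then show ?thesis using kdv_flow_coords_law[OF \<beta> t(1) _ v] t(2) by simp
  qed
qed

text \<open>The common core of both claims, used with indicators for the adjoint and with bounded
  continuous functions for the evolution system. Bounded measurable \<open>F\<close> covers
  both.\<close>

lemma kdv_transition_integral:
  fixes F :: "coeffs \<Rightarrow> real"
  assumes s: "s < - 1 / 2" and g: "gaussian_coeffs M g" and \<beta>: "brownian_coeffs P \<beta>"
    and t: "0 \<le> t1" "t1 \<le> t2"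
    and F: "F \<in> borel_measurable (sobolev_borel s)" "\<And>a. a \<in> sobolev s \<Longrightarrow> \<bar>F a\<bar> \<le> B"
  shows "integrable (white_noise s M g (1 + t1)) (kdv_transition s P \<beta> N t1 t2 F)"
    and "(\<integral>\<phi>. kdv_transition s P \<beta> N t1 t2 F \<phi> \<partial>white_noise s M g (1 + t1)) = (\<integral>\<phi>. F \<phi> \<partial>white_noise s M g (1 + t2))"
proof -
  have P: "prob_space P" using \<beta> by (simp add: brownian_coeffs_def)
  interpret P: prob_space P by (rule P)
  have v: "1 + t1 > 0" "1 + t2 > 0" using t by auto
  let ?G = "gauss_seq (1 + t1)"
  interpret G: prob_space ?G by (rule prob_space_gauss_seq[OF v(1)])
  interpret GP: pair_prob_space ?G P ..
  let ?TS = "\<lambda>x. to_sobolev s (of_real_coords x)"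
  let ?X = "\<lambda>x \<omega>. kdv_flow_coords N \<beta> t1 t2 x \<omega>"
  note Xm = kdv_flow_coords_law_le(1)[OF \<beta> t v(1), of N]
  note Xlaw = kdv_flow_coords_law_le(2)[OF \<beta> t v(1), of N]
  have FTS: "(\<lambda>x. F (?TS x)) \<in> borel_measurable borel"
    by (rule measurable_compose[OF measurable_to_sobolev F(1)])
  have FB: "\<bar>F (?TS x)\<bar> \<le> B" for x by (rule F(2)[OF to_sobolev_in])
  have B: "B \<ge> 0" using FB by (meson abs_ge_zero order_trans)
  define H where "H x = (\<integral>\<omega>. F (?TS (?X x \<omega>)) \<partial>P)" for x
  have FXm: "(\<lambda>p. F (?TS (?X (fst p) (snd p)))) \<in> borel_measurable (?G \<Otimes>\<^sub>M P)"
    by (rule measurable_compose[OF Xm FTS])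
  have FXi: "integrable (?G \<Otimes>\<^sub>M P) (\<lambda>p. F (?TS (?X (fst p) (snd p))))"
    by (rule GP.P.integrable_const_bound[where B=B]) (use FXm FB in auto)
  have Hm: "H \<in> borel_measurable ?G"
    unfolding H_def using FXm by (intro P.borel_measurable_lebesgue_integral) (simp add: case_prod_unfold)
  have HB: "\<bar>H x\<bar> \<le> B" for x
  proof -
    have "norm (H x) \<le> (\<integral>\<omega>. norm (F (?TS (?X x \<omega>))) \<partial>P)" unfolding H_def by (rule integral_norm_bound)
    also have "\<dots> \<le> (\<integral>\<omega>. B \<partial>P)"
      using FB B by (intro integral_mono') auto
    also have "\<dots> = B" by (simp add: P.prob_space)
    finally show ?thesis by simp
  qed
  \<comment> \<open>For data in the phase space the transition operator factors through the real
    coordinates, where the law of the flow is known.\<close>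
  have TF: "kdv_transition s P \<beta> N t1 t2 F \<phi> = H (real_coords \<phi>)" if "\<phi> \<in> sobolev s" for \<phi>
  proof -
    have "real_valued \<phi>" using that by (simp add: sobolev_iff)
    then show ?thesis
      unfolding kdv_transition_def H_def
      by (intro Bochner_Integration.integral_cong refl) (simp add: kdv_flow_real_coords[OF \<beta> _ t])
  qed
  have Hrc: "(\<lambda>\<phi>. H (real_coords \<phi>)) \<in> borel_measurable (sobolev_borel s)"
    using Hm by (intro measurable_compose[OF measurable_real_coords_sobolev]) simp
  have Tm: "kdv_transition s P \<beta> N t1 t2 F \<in> borel_measurable (sobolev_borel s)"
    using Hrc by (subst measurable_cong[of _ _ "\<lambda>\<phi>. H (real_coords \<phi>)"]) (auto simp: TF)
  interpret W: prob_space "white_noise s M g (1 + t1)" by (rule prob_space_white_noise[OF g v(1)])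
  have spW: "space (white_noise s M g (1 + t1)) = sobolev s"
    using sets_eq_imp_space_eq[OF sets_white_noise] by simp
  show "integrable (white_noise s M g (1 + t1)) (kdv_transition s P \<beta> N t1 t2 F)"
  proof (rule W.integrable_const_bound[where B=B])
    show "AE \<phi> in white_noise s M g (1 + t1). norm (kdv_transition s P \<beta> N t1 t2 F \<phi>) \<le> B"
      using HB by (intro AE_I2) (simp add: spW TF)
    show "kdv_transition s P \<beta> N t1 t2 F \<in> borel_measurable (white_noise s M g (1 + t1))"
      using Tm by (simp add: measurable_cong_sets[OF sets_white_noise refl])
  qed
  have TSm: "?TS \<in> measurable (gauss_seq v) (sobolev_borel s)" for v
    using measurable_to_sobolev[of s] by (simp add: measurable_cong_sets[OF sets_gauss_seq refl])
  have "(\<integral>\<phi>. kdv_transition s P \<beta> N t1 t2 F \<phi> \<partial>white_noise s M g (1 + t1))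
      = (\<integral>x. kdv_transition s P \<beta> N t1 t2 F (?TS x) \<partial>?G)"
    unfolding white_noise_gauss_seq[OF g v(1)] by (rule integral_distr[OF TSm Tm])
  also have "\<dots> = (\<integral>x. H x \<partial>?G)"
  proof (rule integral_cong_AE)
    show "(\<lambda>x. kdv_transition s P \<beta> N t1 t2 F (?TS x)) \<in> borel_measurable ?G"
      by (rule measurable_compose[OF TSm Tm])
    show "AE x in ?G. kdv_transition s P \<beta> N t1 t2 F (?TS x) = H x"
      \<comment> \<open>The initial datum is altered by \<open>to_sobolev\<close> only on a null
        set. The alteration of the final state needs no such argument: it is part of the test
        function \<open>F (?TS x)\<close> on both sides.\<close>
      using AE_gauss_seq_sobolev[OF s v(1)]
    proof (rule AE_mp, intro AE_I2 impI)
      fix x assume "of_real_coords x \<in> sobolev s"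
      then show "kdv_transition s P \<beta> N t1 t2 F (?TS x) = H x"
        using TF[of "of_real_coords x"] by (simp add: to_sobolev_def)
    qed
  qed (rule Hm)
  also have "\<dots> = (\<integral>p. F (?TS (?X (fst p) (snd p))) \<partial>(?G \<Otimes>\<^sub>M P))"
    unfolding H_def using GP.integral_fst'[OF FXi] by simp
  also have "\<dots> = (\<integral>x. F (?TS x) \<partial>distr (?G \<Otimes>\<^sub>M P) borel (\<lambda>p. ?X (fst p) (snd p)))"
    by (rule integral_distr[OF Xm FTS, symmetric])
  also have "\<dots> = (\<integral>x. F (?TS x) \<partial>gauss_seq (1 + t2))"
    unfolding Xlaw by (simp add: algebra_simps)
  also have "\<dots> = (\<integral>\<phi>. F \<phi> \<partial>white_noise s M g (1 + t2))"
    unfolding white_noise_gauss_seq[OF g v(2)] by (rule integral_distr[OF TSm F(1), symmetric])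
  finally show "(\<integral>\<phi>. kdv_transition s P \<beta> N t1 t2 F \<phi> \<partial>white_noise s M g (1 + t1)) = (\<integral>\<phi>. F \<phi> \<partial>white_noise s M g (1 + t2))" .
qed

text \<open>The adjoint is a measure built from a set function, so it is enough that this function
  agrees with the white noise measure on the Borel sets; no separate proof of countable additivity
  is required.\<close>

lemma kdv_dual_action:
  assumes s: "s < - 1 / 2" and g: "gaussian_coeffs M g" and \<beta>: "brownian_coeffs P \<beta>"
    and t: "0 \<le> t1" "t1 \<le> t2"
  shows "dual_action s (kdv_transition s P \<beta> N t1 t2) (white_noise s M g (1 + t1)) = white_noise s M g (1 + t2)"
proof -
  have v: "1 + t2 > 0" using t by simp
  let ?W1 = "white_noise s M g (1 + t1)" and ?W2 = "white_noise s M g (1 + t2)"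
  interpret W2: prob_space ?W2 by (rule prob_space_white_noise[OF g v])
  have spW: "space ?W2 = sobolev s" using sets_eq_imp_space_eq[OF sets_white_noise] by simp
  have "(\<integral>\<^sup>+\<phi>. ennreal (kdv_transition s P \<beta> N t1 t2 (indicator A) \<phi>) \<partial>?W1) = emeasure ?W2 A"
    if A: "A \<in> sets (sobolev_borel s)" for A
  proof -
    have ind: "(indicator A :: coeffs \<Rightarrow> real) \<in> borel_measurable (sobolev_borel s)" using A by simp
    have bd: "\<bar>indicator A a :: real\<bar> \<le> 1" for a by (simp add: indicator_def)
    note T = kdv_transition_integral[OF s g \<beta> t ind bd, of N]
    have "(\<integral>\<^sup>+\<phi>. ennreal (kdv_transition s P \<beta> N t1 t2 (indicator A) \<phi>) \<partial>?W1)
      = ennreal (\<integral>\<phi>. kdv_transition s P \<beta> N t1 t2 (indicator A) \<phi> \<partial>?W1)"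
      by (rule nn_integral_eq_integral[OF T(1)]) (simp add: kdv_transition_def)
    also have "\<dots> = ennreal (measure ?W2 (A \<inter> space ?W2))" unfolding T(2) by simp
    also have "A \<inter> space ?W2 = A" using sets.sets_into_space[OF A] spW by auto
    finally show ?thesis by (simp add: W2.emeasure_eq_measure)
  qed
  \<comment> \<open>The generator handed to \<open>measure_of\<close> is already a sigma-algebra, so
    agreement on it is agreement on everything it generates.\<close>
  moreover have "sigma_sets (sobolev s) (sets (sobolev_borel s)) = sets (sobolev_borel s)"
    using sets.sigma_sets_eq[of "sobolev_borel s"] by simp
  ultimately have "dual_action s (kdv_transition s P \<beta> N t1 t2) ?W1 = measure_of (sobolev s) (sets (sobolev_borel s)) (emeasure ?W2)"
    unfolding dual_action_def using sets.space_closed[of "sobolev_borel s"]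
    by (intro measure_of_eq) auto
  also have "\<dots> = ?W2" using measure_of_of_measure[of ?W2] spW by simp
  finally show ?thesis .
qed

lemma continuous_map_sobolev_measurable:
  assumes "continuous_map (sobolev_topology s) euclideanreal F"
  shows "F \<in> borel_measurable (sobolev_borel s)"
proof (rule borel_measurableI)
  fix V :: "real set" assume "open V"
  then have "openin (sobolev_topology s) {a \<in> sobolev s. F a \<in> V}"
    using openin_continuous_map_preimage[OF assms, of V] by simp
  moreover have "F -` V \<inter> space (sobolev_borel s) = {a \<in> sobolev s. F a \<in> V}" by auto
  ultimately show "F -` V \<inter> space (sobolev_borel s) \<in> sets (sobolev_borel s)"
    unfolding sets_sobolev_borel by (auto intro: sigma_sets.Basic)
qed

theorem proposition1p4:
  fixes N :: nat and s :: real
    and M :: "'a measure" and g :: "int \<Rightarrow> 'a \<Rightarrow> complex"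
    and P :: "'b measure" and \<beta> :: "int \<Rightarrow> real \<Rightarrow> 'b \<Rightarrow> complex"
  assumes "s < - 1 / 2"
    and "gaussian_coeffs M g"
    and "brownian_coeffs P \<beta>"
  shows "(\<forall>t1 t2. 0 \<le> t1 \<longrightarrow> t1 \<le> t2 \<longrightarrow>
            dual_action s (kdv_transition s P \<beta> N t1 t2) (white_noise s M g (1 + t1))
              = white_noise s M g (1 + t2))
       \<and> evolution_system s (kdv_transition s P \<beta> N) (\<lambda>t. white_noise s M g (1 + t))"
  unfolding evolution_system_def
proof (intro conjI allI impI)
  fix t1 t2 :: real assume "0 \<le> t1" "t1 \<le> t2"
  then show "dual_action s (kdv_transition s P \<beta> N t1 t2) (white_noise s M g (1 + t1)) = white_noise s M g (1 + t2)"
    by (rule kdv_dual_action[OF assms])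
next
  fix t :: real assume "0 \<le> t"
  then show "prob_space (white_noise s M g (1 + t))" by (intro prob_space_white_noise[OF assms(2)]) simp
  show "sets (white_noise s M g (1 + t)) = sets (sobolev_borel s)" by simp
next
  fix F :: "coeffs \<Rightarrow> real" and t1 t2 :: real
  assume F: "continuous_map (sobolev_topology s) euclideanreal F" "bounded (F ` sobolev s)" and t: "0 \<le> t1" "t1 \<le> t2"
  obtain B where "\<And>a. a \<in> sobolev s \<Longrightarrow> \<bar>F a\<bar> \<le> B"
    using F(2) unfolding bounded_iff by auto
  from kdv_transition_integral(2)[OF assms t continuous_map_sobolev_measurable[OF F(1)] this, of N]
  show "(\<integral>\<phi>. F \<phi> \<partial>white_noise s M g (1 + t2)) = (\<integral>\<phi>. kdv_transition s P \<beta> N t1 t2 F \<phi> \<partial>white_noise s M g (1 + t1))"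
    by simp
qed

end
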